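(* For every $n\ge1$: 1) The polynomial $s_n$ is the maximal element $h^{\max}(n)=h_1(n)+h_2(n)+h_3(n)+h_4(n)$ of the Boolean cube $B^+(n)$, and $$s_n=\mathcal R^{n-1}(s_1)=\sum_{r+s+t=n-1}\gamma_{12}^t\gamma_{13}^s\gamma_{14}^r(e_1+e_2+e_3+e_4)=\sum_{i=1}^4e_i^\vee(n)=\sum_{i=1}^4e_i(n).$$ 2) The polynomial $t_n$ is linearly equivalent to the minimal element $h^{\min}(n)=h_1(n)h_2(n)h_3(n)h_4(n)$ of $B^+(n)$, and $$t_n=\mathcal R^{n-1}(t_1)=\sum_{r+s+t=n-1}\gamma_{12}^t\gamma_{13}^s\gamma_{14}^r\bigl(e_1(e_2+e_3+e_4)+e_2(e_1+e_3+e_4)+e_3(e_1+e_2+e_4)\bigr)=f_0^\vee(n+1)=f_0(n+1).$$ 3) For $\{i,j,k,l\}=\{1,2,3,4\}$, the polynomial $p_{i,n}$ is linearly equivalent to the element $h_j(n)h_k(n)h_l(n)$ of $B^+(n)$, and $$p_{i,n}=e_i(n)+f_0^\vee(n+1)=e_i(n)+f_0(n+1).$$ (Sums over $r+s+t=m$ run over nonnegative integers.)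
   Context: **Lattice.** $D^4$ is the free modular lattice generated by $e_1,e_2,e_3,e_4$, with a least element $0$ and a greatest element $I$ adjoined. Join is written $+$ (and $\sum$), meet is written as juxtaposition. **Linear equivalence.** A representation of $D^4$ in a finite-dimensional vector space $V$ is a lattice homomorphism $\rho$ from $D^4$ to the lattice of subspaces of $V$ with $\rho(I)=V$, $\rho(0)=0$. Elements $a,b\in D^4$ are linearly equivalent, $a\simeq b$, if $\rho(a)=\rho(b)$ for every indecomposable finite-dimensional representation $\rho$ over any field. **Herrmann's endomorphisms.** For $\{i,j,k,l\}=\{1,2,3,4\}$ put $q_{ij}=q_{ji}=q_{kl}=q_{lk}=(e_i+e_j)(e_k+e_l)$. $\gamma_{ij}$ is the lattice endomorphism of $D^4$ with $I\mapsto q_{ij}$, $0\mapsto0$, $e_m\mapsto e_mq_{ij}$. $\mathcal R=\gamma_{12}+\gamma_{13}+\gamma_{14}$, i.e. $\mathcal R(a)=\gamma_{12}(a)+\gamma_{13}(a)+\gamma_{14}(a)$. **Herrmann's polynomials.** For $n\ge1$: $s_1=e_1+e_2+e_3+e_4$, $s_{n+1}=\gamma_{12}(s_n)+\gamma_{13}(s_n)+\gamma_{14}(s_n)$; $t_1=(e_1+e_2+e_3)(e_1+e_2+e_4)(e_1+e_3+e_4)(e_2+e_3+e_4)$, $t_{n+1}=\gamma_{12}(t_n)+\gamma_{13}(t_n)+\gamma_{14}(t_n)$; $p_{i,1}=e_i+t_1$, $p_{i,n+1}=\gamma_{ij}(p_{j,n})+\gamma_{ik}(p_{k,n})+\gamma_{il}(p_{l,n})$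 for $\{i,j,k,l\}=\{1,2,3,4\}$. **Atomic elements.** For $\{i,j,k,l\}=\{1,2,3,4\}$: $a^{ij}_0=I$ and $a^{ij}_n=e_i+e_ja^{kl}_{n-1}$ for $n\ge1$ (here $e_ja^{kl}_{n-1}=e_ja^{lk}_{n-1}$). **Admissible sequences.** An admissible sequence is a nonempty finite sequence $\alpha=i_n\dots i_1$ with entries in $\{1,2,3,4\}$ and $i_p\ne i_{p+1}$; two are identified if one is obtained from the other by repeatedly replacing consecutive entries $ijl$ by $ikl$, where $\{i,j,k,l\}=\{1,2,3,4\}$. $i_1$ is the start, $i_n$ the end, $n$ the length. $(pq)^t$ denotes $pq$ repeated $t$ times. **Admissible elements $e_\alpha$.** An admissible sequence starting at $1$ is, up to the identification, exactly one of the following, and $e_\alpha$ is defined accordingly ($r,s,t\ge0$ with the extra restriction listed): - $(21)^t(41)^r(31)^s$, $t\ge1$: $e_\alpha=e_2a^{31}_{2s}a^{41}_{2r}a^{34}_{2t-1}$; - $(31)^s(41)^r(21)^t$, $s\ge1$: $e_\alpha=e_3a^{21}_{2t}a^{41}_{2r}a^{24}_{2s-1}$; - $(41)^r(31)^s(21)^t$, $r\ge1$: $e_\alpha=e_4a^{21}_{2t}a^{31}_{2s}a^{32}_{2r-1}$; - $1(41)^r(31)^s(21)^t$: $e_\alpha=e_1a^{24}_{2s}a^{34}_{2t}a^{32}_{2r}$; - $2(41)^r(31)^s(21)^t$, $r\ge1$: $e_\alpha=e_2a^{34}_{2t}a^{31}_{2s+1}a^{14}_{2r-1}$; - $3(41)^r(21)^t(31)^s$,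 $r\ge1$: $e_\alpha=e_3a^{24}_{2s}a^{21}_{2t+1}a^{14}_{2r-1}$; - $4(21)^t(31)^s(41)^r$, $t\ge1$: $e_\alpha=e_4a^{32}_{2r}a^{31}_{2s+1}a^{12}_{2t-1}$; - $(14)^r(31)^s(21)^t$, $r,s\ge1$: $e_\alpha=e_1a^{23}_{2r-1}a^{24}_{2s-1}a^{34}_{2t+1}$. For a sequence starting at $m\ne1$, interchange the indices $1$ and $m$ everywhere. **Admissible elements $f_{\alpha0}$.** For $\alpha=i$ of length 1, $f_{i0}=e_i(e_j+e_k+e_l)$, $\{i,j,k,l\}=\{1,2,3,4\}$. If $\alpha$ has length $\ge2$, write the expression defining $e_\alpha$ (a meet of one generator and three atomic elements) as $e_\alpha=e_ia^{jk}_ta^{kl}_sa^{lj}_r$ with $\{i,j,k,l\}=\{1,2,3,4\}$ labelled so that $r\ge1$ (the order of the two upper indices is irrelevant under meet with $e_i$); then $f_{\alpha0}=e_\alpha(e_ia^{jk}_{t+1}+a^{kl}_{s+1}a^{lj}_{r-1})$, which does not depend on the labelling chosen. **Cumulative elements.** $e_i(n)=\sum e_\alpha$ over admissible $\alpha$ of length $n$ starting at $i$. For $n\ge2$, $f_0(n)=\sum f_{\alpha0}$ over all admissible $\alpha$ of length $n-1$. **Inverse cumulative elements.** For $\{i,j,k,l\}=\{1,2,3,4\}$, $e_i^\vee(n)=\sum_{r+s+t=n-1}e_ia^{jk}_ra^{kl}_sa^{jl}_t$. For $n\ge2$, $f_0^\vee(n)=\sum_{i=1}^4\sum f_{\alpha0}$,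 the inner sum over admissible $\alpha$ of length $n-1$ ending at $i$. **Perfect elements.** $h_i(n)=\sum_{j\ne i}e_j(n)$; $B^+(n)$ is the sublattice of $D^4$ generated by $h_1(n),\dots,h_4(n)$. *)

theory Defs
  imports HOL.Vector_Spaces "HOL-Combinatorics.Transposition"
begin

unbundle lattice_syntax

section \<open>The free modular lattice\<close>

class modular_lattice = lattice +
  assumes modular: "x \<le> z \<Longrightarrow> x \<squnion> (y \<sqinter> z) = (x \<squnion> y) \<sqinter> z"

definition lattice_hom :: "('a::lattice \<Rightarrow> 'b::lattice) \<Rightarrow> bool" where
  "lattice_hom g \<longleftrightarrow> (\<forall>x y. g (x \<squnion> y) = g x \<squnion> g y \<and> g (x \<sqinter> y) = g x \<sqinter> g y)"

datatype 'x lterm = Gen 'x | Join "'x lterm" "'x lterm" | Meet "'x lterm" "'x lterm"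

inductive meq :: "'x lterm \<Rightarrow> 'x lterm \<Rightarrow> bool" where
  meq_refl: "meq x x"
| meq_sym: "meq x y \<Longrightarrow> meq y x"
| meq_trans: "meq x y \<Longrightarrow> meq y z \<Longrightarrow> meq x z"
| meq_join_cong: "meq x x' \<Longrightarrow> meq y y' \<Longrightarrow> meq (Join x y) (Join x' y')"
| meq_meet_cong: "meq x x' \<Longrightarrow> meq y y' \<Longrightarrow> meq (Meet x y) (Meet x' y')"
| meq_join_comm: "meq (Join x y) (Join y x)"
| meq_meet_comm: "meq (Meet x y) (Meet y x)"
| meq_join_assoc: "meq (Join (Join x y) z) (Join x (Join y z))"
| meq_meet_assoc: "meq (Meet (Meet x y) z) (Meet x (Meet y z))"
| meq_join_absorb: "meq (Join x (Meet x y)) x"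
| meq_meet_absorb: "meq (Meet x (Join x y)) x"
| meq_modular: "meq (Join (Meet x z) (Meet y z)) (Meet (Join (Meet x z) y) z)"

quotient_type 'x free_mod = "'x lterm" / meq
  by (intro equivpI reflpI sympI transpI) (blast intro: meq.intros)+

instantiation free_mod :: (type) modular_lattice
begin

lift_definition sup_free_mod :: "'a free_mod \<Rightarrow> 'a free_mod \<Rightarrow> 'a free_mod" is Join
  by (rule meq_join_cong)

lift_definition inf_free_mod :: "'a free_mod \<Rightarrow> 'a free_mod \<Rightarrow> 'a free_mod" is Meet
  by (rule meq_meet_cong)

definition less_eq_free_mod :: "'a free_mod \<Rightarrow> 'a free_mod \<Rightarrow> bool" where
  "less_eq_free_mod x y \<longleftrightarrow> x \<sqinter> y = x"

definition less_free_mod :: "'a free_mod \<Rightarrow> 'a free_mod \<Rightarrow> bool" where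
  "less_free_mod x y \<longleftrightarrow> x \<le> y \<and> x \<noteq> y"

instance
proof -
  have jc: "x \<squnion> y = y \<squnion> x" for x y :: "'a free_mod" by transfer (rule meq_join_comm)
  have mc: "x \<sqinter> y = y \<sqinter> x" for x y :: "'a free_mod" by transfer (rule meq_meet_comm)
  have ja: "(x \<squnion> y) \<squnion> z = x \<squnion> (y \<squnion> z)" for x y z :: "'a free_mod"
    by transfer (rule meq_join_assoc)
  have ma: "(x \<sqinter> y) \<sqinter> z = x \<sqinter> (y \<sqinter> z)" for x y z :: "'a free_mod"
    by transfer (rule meq_meet_assoc)
  have jm: "x \<squnion> (x \<sqinter> y) = x" for x y :: "'a free_mod" by transfer (rule meq_join_absorb)
  have mj: "x \<sqinter> (x \<squnion> y) = x" for x y :: "'a free_mod" by transfer (rule meq_meet_absorb)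
  have mo: "(x \<sqinter> z) \<squnion> (y \<sqinter> z) = ((x \<sqinter> z) \<squnion> y) \<sqinter> z" for x y z :: "'a free_mod"
    by transfer (rule meq_modular)
  have mi: "x \<sqinter> x = x" for x :: "'a free_mod" by (metis jm mj)
  have le_j: "x \<le> y \<longleftrightarrow> x \<squnion> y = y" for x y :: "'a free_mod"
    unfolding less_eq_free_mod_def by (metis jc mc jm mj)
  show "OFCLASS('a free_mod, modular_lattice_class)"
  proof
    fix x y z :: "'a free_mod"
    show "x < y \<longleftrightarrow> x \<le> y \<and> \<not> y \<le> x"
      unfolding less_free_mod_def less_eq_free_mod_def by (metis mc mi)
    show "x \<le> x" by (simp add: less_eq_free_mod_def mi)
    show "x \<le> y \<Longrightarrow> y \<le> z \<Longrightarrow> x \<le> z" unfolding less_eq_free_mod_def by (metis ma)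
    show "x \<le> y \<Longrightarrow> y \<le> x \<Longrightarrow> x = y" unfolding less_eq_free_mod_def by (metis mc)
    show "x \<sqinter> y \<le> x" unfolding less_eq_free_mod_def by (metis ma mc mi)
    show "x \<sqinter> y \<le> y" unfolding less_eq_free_mod_def by (metis ma mi)
    show "x \<le> y \<Longrightarrow> x \<le> z \<Longrightarrow> x \<le> y \<sqinter> z" unfolding less_eq_free_mod_def by (metis ma)
    show "x \<le> x \<squnion> y" by (simp add: less_eq_free_mod_def mj)
    show "y \<le> x \<squnion> y" by (metis less_eq_free_mod_def mj jc)
    show "y \<le> x \<Longrightarrow> z \<le> x \<Longrightarrow> y \<squnion> z \<le> x" unfolding le_j by (metis ja)
    show "x \<le> z \<Longrightarrow> x \<squnion> (y \<sqinter> z) = (x \<squnion> y) \<sqinter> z"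
      unfolding less_eq_free_mod_def by (metis mo)
  qed
qed

end

lift_definition fgen :: "'x \<Rightarrow> 'x free_mod" is Gen .

lemma free_mod_induct [case_names gen sup inf]:
  assumes "\<And>m. P (fgen m)" "\<And>x y. P x \<Longrightarrow> P y \<Longrightarrow> P (x \<squnion> y)"
    "\<And>x y. P x \<Longrightarrow> P y \<Longrightarrow> P (x \<sqinter> y)"
  shows "P (x :: 'x free_mod)"
proof -
  have "P (abs_free_mod t)" for t
    by (induction t)
      (use assms in \<open>simp_all add: fgen.abs_eq sup_free_mod.abs_eq [symmetric]
        inf_free_mod.abs_eq [symmetric]\<close>)
  then show ?thesis by (rule free_mod.abs_induct)
qed

primrec lterm_eval :: "('x \<Rightarrow> 'a::lattice) \<Rightarrow> 'x lterm \<Rightarrow> 'a" where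
  "lterm_eval \<phi> (Gen m) = \<phi> m"
| "lterm_eval \<phi> (Join s t) = lterm_eval \<phi> s \<squnion> lterm_eval \<phi> t"
| "lterm_eval \<phi> (Meet s t) = lterm_eval \<phi> s \<sqinter> lterm_eval \<phi> t"

lemma lterm_eval_meq:
  fixes \<phi> :: "'x \<Rightarrow> 'a::modular_lattice"
  assumes "meq s t"
  shows "lterm_eval \<phi> s = lterm_eval \<phi> t"
  using assms
proof induction
  case (meq_modular x z y)
  show ?case by (simp add: modular)
qed (simp_all add: ac_simps)

theorem free_mod_universal:
  fixes \<phi> :: "'x \<Rightarrow> 'a::modular_lattice"
  shows "\<exists>!g :: 'x free_mod \<Rightarrow> 'a. lattice_hom g \<and> (\<forall>m. g (fgen m) = \<phi> m)"
proof -
  define g where "g x = lterm_eval \<phi> (rep_free_mod x)" for x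
  have g: "g (abs_free_mod t) = lterm_eval \<phi> t" for t
    unfolding g_def by (intro lterm_eval_meq) (rule rep_abs_rsp_left[OF Quotient3_free_mod meq_refl])
  have "g (x \<squnion> y) = g x \<squnion> g y \<and> g (x \<sqinter> y) = g x \<sqinter> g y" for x y
    by (induction x rule: free_mod.abs_induct, induction y rule: free_mod.abs_induct)
      (simp add: g sup_free_mod.abs_eq inf_free_mod.abs_eq)
  then have "lattice_hom g" by (simp add: lattice_hom_def)
  moreover have "g (fgen m) = \<phi> m" for m by (simp add: g fgen.abs_eq)
  moreover have "g' = g" if "lattice_hom g'" "\<forall>m. g' (fgen m) = \<phi> m" for g'
  proof
    fix x show "g' x = g x"
      by (induction x rule: free_mod_induct)
        (use that calculation in \<open>auto simp: lattice_hom_def\<close>)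
  qed
  ultimately show ?thesis by blast
qed

section \<open>The lattice $D^4$\<close>

datatype idx = G1 | G2 | G3 | G4

lemma UNIV_idx: "UNIV = {G1, G2, G3, G4}"
  using idx.exhaust by auto

instance idx :: finite
  by standard (simp add: UNIV_idx)

datatype d4 = Bot | Mid "idx free_mod" | Top

instantiation d4 :: "{modular_lattice, bounded_lattice}"
begin

definition bot_d4 :: d4 where "bot_d4 = Bot"

definition top_d4 :: d4 where "top_d4 = Top"

fun sup_d4 :: "d4 \<Rightarrow> d4 \<Rightarrow> d4" where
  "sup_d4 Bot y = y"
| "sup_d4 x Bot = x"
| "sup_d4 (Mid x) (Mid y) = Mid (x \<squnion> y)"
| "sup_d4 Top y = Top"
| "sup_d4 x Top = Top"

fun inf_d4 :: "d4 \<Rightarrow> d4 \<Rightarrow> d4" where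
  "inf_d4 Top y = y"
| "inf_d4 x Top = x"
| "inf_d4 (Mid x) (Mid y) = Mid (x \<sqinter> y)"
| "inf_d4 Bot y = Bot"
| "inf_d4 x Bot = Bot"

fun less_eq_d4 :: "d4 \<Rightarrow> d4 \<Rightarrow> bool" where
  "less_eq_d4 Bot y = True"
| "less_eq_d4 x Top = True"
| "less_eq_d4 (Mid x) (Mid y) = (x \<le> y)"
| "less_eq_d4 x y = False"

definition less_d4 :: "d4 \<Rightarrow> d4 \<Rightarrow> bool" where
  "less_d4 x y \<longleftrightarrow> x \<le> y \<and> \<not> y \<le> x"

instance
proof
  fix x y z :: d4
  show "x < y \<longleftrightarrow> x \<le> y \<and> \<not> y \<le> x" by (rule less_d4_def)
  show "x \<le> x" by (cases x) auto
  show "x \<le> y \<Longrightarrow> y \<le> z \<Longrightarrow> x \<le> z" by (cases x; cases y; cases z) auto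
  show "x \<le> y \<Longrightarrow> y \<le> x \<Longrightarrow> x = y" by (cases x; cases y) auto
  show "x \<sqinter> y \<le> x" by (cases x; cases y) auto
  show "x \<sqinter> y \<le> y" by (cases x; cases y) auto
  show "x \<le> y \<Longrightarrow> x \<le> z \<Longrightarrow> x \<le> y \<sqinter> z" by (cases x; cases y; cases z) auto
  show "x \<le> x \<squnion> y" by (cases x; cases y) auto
  show "y \<le> x \<squnion> y" by (cases x; cases y) auto
  show "y \<le> x \<Longrightarrow> z \<le> x \<Longrightarrow> y \<squnion> z \<le> x" by (cases x; cases y; cases z) auto
  show "\<bottom> \<le> x" by (simp add: bot_d4_def)
  show "x \<le> \<top>" by (cases x) (auto simp: top_d4_def)
  show "x \<le> z \<Longrightarrow> x \<squnion> (y \<sqinter> z) = (x \<squnion> y) \<sqinter> z"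
    by (cases x; cases y; cases z) (auto simp: modular sup_absorb2 inf_absorb1)
qed

end

definition e :: "idx \<Rightarrow> d4" where
  "e m = Mid (fgen m)"

lemma d4_induct [case_names bot top gen sup inf]:
  assumes "P \<bottom>" "P \<top>" "\<And>m. P (e m)" "\<And>x y. P x \<Longrightarrow> P y \<Longrightarrow> P (x \<squnion> y)"
    "\<And>x y. P x \<Longrightarrow> P y \<Longrightarrow> P (x \<sqinter> y)"
  shows "P x"
proof (cases x)
  case (Mid u)
  have "P (Mid u)"
  proof (induction u rule: free_mod_induct)
    case (gen m) show ?case using assms(3)[of m] by (simp add: e_def)
  next
    case (sup x y) then show ?case using assms(4)[of "Mid x" "Mid y"] by simp
  next
    case (inf x y) then show ?case using assms(5)[of "Mid x" "Mid y"] by simp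
  qed
  then show ?thesis using Mid by simp
qed (use assms in \<open>simp_all add: bot_d4_def top_d4_def\<close>)

section \<open>Linear equivalence\<close>

context vector_space
begin

definition subspace_sum :: "'b set \<Rightarrow> 'b set \<Rightarrow> 'b set" where
  "subspace_sum A B = {x + y | x y. x \<in> A \<and> y \<in> B}"

definition d4_rep :: "'b set \<Rightarrow> (d4 \<Rightarrow> 'b set) \<Rightarrow> bool" where
  "d4_rep V \<rho> \<longleftrightarrow>
     (\<exists>B. finite B \<and> span B = V) \<and>
     (\<forall>a. subspace (\<rho> a) \<and> \<rho> a \<subseteq> V) \<and>
     (\<forall>a b. \<rho> (a \<squnion> b) = subspace_sum (\<rho> a) (\<rho> b) \<and> \<rho> (a \<sqinter> b) = \<rho> a \<inter> \<rho> b) \<and>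
     \<rho> \<top> = V \<and> \<rho> \<bottom> = {0}"

definition indecomposable_rep :: "'b set \<Rightarrow> (d4 \<Rightarrow> 'b set) \<Rightarrow> bool" where
  "indecomposable_rep V \<rho> \<longleftrightarrow> d4_rep V \<rho> \<and> V \<noteq> {0} \<and>
     \<not> (\<exists>V\<^sub>1 \<rho>\<^sub>1 V\<^sub>2 \<rho>\<^sub>2. d4_rep V\<^sub>1 \<rho>\<^sub>1 \<and> d4_rep V\<^sub>2 \<rho>\<^sub>2 \<and> V\<^sub>1 \<noteq> {0} \<and> V\<^sub>2 \<noteq> {0} \<and>
          V\<^sub>1 \<inter> V\<^sub>2 = {0} \<and> (\<forall>a. \<rho> a = subspace_sum (\<rho>\<^sub>1 a) (\<rho>\<^sub>2 a)))"

text \<open>HOL cannot quantify over types inside a formula, so the field \<^typ>\<open>'a\<close> and the ambient vector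
  space \<^typ>\<open>'b\<close> are parameters here. A statement asserting this relation with \<^typ>\<open>'a\<close>, \<^typ>\<open>'b\<close>
  and the scalar multiplication all universally quantified is linear equivalence over all fields;
  every finite-dimensional vector space occurs as \<open>V = UNIV\<close>.\<close>

definition lin_equiv :: "d4 \<Rightarrow> d4 \<Rightarrow> bool" where
  "lin_equiv a b \<longleftrightarrow> (\<forall>V \<rho>. indecomposable_rep V \<rho> \<longrightarrow> \<rho> a = \<rho> b)"

end

section \<open>Herrmann's endomorphisms and polynomials\<close>

definition q :: "idx \<Rightarrow> idx \<Rightarrow> d4" where
  "q i j = (e i \<squnion> e j) \<sqinter> Sup_fin (e ` (- {i, j}))"

definition is_gamma :: "idx \<Rightarrow> idx \<Rightarrow> (d4 \<Rightarrow> d4) \<Rightarrow> bool" where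
  "is_gamma i j g \<longleftrightarrow> lattice_hom g \<and> g \<top> = q i j \<and> g \<bottom> = \<bottom> \<and> (\<forall>m. g (e m) = e m \<sqinter> q i j)"

definition gamma :: "idx \<Rightarrow> idx \<Rightarrow> d4 \<Rightarrow> d4" where
  "gamma i j = (THE g. is_gamma i j g)"

lemma ex1_is_gamma: "\<exists>!g. is_gamma i j g"
proof -
  obtain h :: "idx free_mod \<Rightarrow> d4"
    where h: "lattice_hom h" "\<And>m. h (fgen m) = e m \<sqinter> q i j"
    using free_mod_universal[of "\<lambda>m. e m \<sqinter> q i j"] by blast
  have hle: "h x \<le> q i j" for x
    by (induction x rule: free_mod_induct) (use h in \<open>auto simp: lattice_hom_def le_infI1\<close>)
  define g where "g x = (case x of Bot \<Rightarrow> \<bottom> | Mid u \<Rightarrow> h u | Top \<Rightarrow> q i j)" for x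
  have "g (x \<squnion> y) = g x \<squnion> g y \<and> g (x \<sqinter> y) = g x \<sqinter> g y" for x y
    by (cases x; cases y)
      (use h(1) hle in \<open>auto simp: g_def lattice_hom_def sup_absorb1 sup_absorb2
          inf_absorb1 inf_absorb2\<close>)
  then have "is_gamma i j g"
    by (auto simp: is_gamma_def lattice_hom_def g_def bot_d4_def top_d4_def e_def h(2))
  moreover have "g' = g''" if "is_gamma i j g'" "is_gamma i j g''" for g' g''
  proof
    fix x show "g' x = g'' x"
      by (induction x rule: d4_induct)
        (use that in \<open>auto simp: is_gamma_def lattice_hom_def\<close>)
  qed
  ultimately show ?thesis by blast
qed

lemma is_gamma_gamma: "is_gamma i j (gamma i j)"
  unfolding gamma_def using ex1_is_gamma by (rule theI')

definition R :: "d4 \<Rightarrow> d4" where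
  "R x = gamma G1 G2 x \<squnion> gamma G1 G3 x \<squnion> gamma G1 G4 x"

text \<open>The three families are indexed from 1; their values at 0 are unspecified.\<close>

fun s_poly :: "nat \<Rightarrow> d4" where
  "s_poly (Suc 0) = e G1 \<squnion> e G2 \<squnion> e G3 \<squnion> e G4"
| "s_poly (Suc (Suc n)) =
     gamma G1 G2 (s_poly (Suc n)) \<squnion> gamma G1 G3 (s_poly (Suc n)) \<squnion> gamma G1 G4 (s_poly (Suc n))"

fun t_poly :: "nat \<Rightarrow> d4" where
  "t_poly (Suc 0) = (e G1 \<squnion> e G2 \<squnion> e G3) \<sqinter> (e G1 \<squnion> e G2 \<squnion> e G4) \<sqinter>
     (e G1 \<squnion> e G3 \<squnion> e G4) \<sqinter> (e G2 \<squnion> e G3 \<squnion> e G4)"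
| "t_poly (Suc (Suc n)) =
     gamma G1 G2 (t_poly (Suc n)) \<squnion> gamma G1 G3 (t_poly (Suc n)) \<squnion> gamma G1 G4 (t_poly (Suc n))"

fun p_poly :: "idx \<Rightarrow> nat \<Rightarrow> d4" where
  "p_poly i (Suc 0) = e i \<squnion> t_poly 1"
| "p_poly i (Suc (Suc n)) = Sup_fin ((\<lambda>j. gamma i j (p_poly j (Suc n))) ` (- {i}))"

section \<open>Atomic and admissible elements\<close>

definition rest :: "idx set \<Rightarrow> idx list" where
  "rest A = filter (\<lambda>m. m \<notin> A) [G1, G2, G3, G4]"

text \<open>For \<open>i \<noteq> j\<close>, \<open>rest {i, j} = [k, l]\<close> with \<open>k\<close>, \<open>l\<close> the complementary indices in increasing
  order. Their order is immaterial below because $e_j a^{kl}_n = e_j a^{lk}_n$.\<close>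

fun atomic :: "idx \<Rightarrow> idx \<Rightarrow> nat \<Rightarrow> d4" where
  "atomic i j 0 = \<top>"
| "atomic i j (Suc n) = e i \<squnion> (e j \<sqinter> atomic (rest {i, j} ! 0) (rest {i, j} ! 1) n)"

text \<open>A sequence \<open>i\<^sub>n \<dots> i\<^sub>1\<close> is the list \<open>[i\<^sub>n, \<dots>, i\<^sub>1]\<close>: its start is \<^term>\<open>last\<close>, its
  end is \<^term>\<open>hd\<close>.\<close>

definition admissible :: "idx list \<Rightarrow> bool" where
  "admissible \<alpha> \<longleftrightarrow> \<alpha> \<noteq> [] \<and> distinct_adj \<alpha>"

inductive adm_step :: "idx list \<Rightarrow> idx list \<Rightarrow> bool" where
  "{i, j, k, l} = UNIV \<Longrightarrow> adm_step (u @ [i, j, l] @ v) (u @ [i, k, l] @ v)"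

definition alt :: "nat \<Rightarrow> 'i \<Rightarrow> 'i \<Rightarrow> 'i list" where
  "alt t x y = concat (replicate t [x, y])"

text \<open>\<open>AE i (j\<^sub>1, k\<^sub>1, n\<^sub>1) (j\<^sub>2, k\<^sub>2, n\<^sub>2) (j\<^sub>3, k\<^sub>3, n\<^sub>3)\<close> is the formal expression
  $e_i a^{j_1k_1}_{n_1} a^{j_2k_2}_{n_2} a^{j_3k_3}_{n_3}$. The expression, not only its value,
  is needed because the elements $f_{\alpha0}$ are read off from it.\<close>

datatype 'i aexpr = AE 'i "'i \<times> 'i \<times> nat" "'i \<times> 'i \<times> nat" "'i \<times> 'i \<times> nat"

fun aexpr_val :: "idx aexpr \<Rightarrow> d4" where
  "aexpr_val (AE i (j1, k1, n1) (j2, k2, n2) (j3, k3, n3)) =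
     e i \<sqinter> atomic j1 k1 n1 \<sqinter> atomic j2 k2 n2 \<sqinter> atomic j3 k3 n3"

inductive adm_table :: "idx list \<Rightarrow> idx aexpr \<Rightarrow> bool" where
  "t \<ge> 1 \<Longrightarrow> adm_table (alt t G2 G1 @ alt r G4 G1 @ alt s G3 G1)
     (AE G2 (G3, G1, 2 * s) (G4, G1, 2 * r) (G3, G4, 2 * t - 1))"
| "s \<ge> 1 \<Longrightarrow> adm_table (alt s G3 G1 @ alt r G4 G1 @ alt t G2 G1)
     (AE G3 (G2, G1, 2 * t) (G4, G1, 2 * r) (G2, G4, 2 * s - 1))"
| "r \<ge> 1 \<Longrightarrow> adm_table (alt r G4 G1 @ alt s G3 G1 @ alt t G2 G1)
     (AE G4 (G2, G1, 2 * t) (G3, G1, 2 * s) (G3, G2, 2 * r - 1))"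
| "adm_table ([G1] @ alt r G4 G1 @ alt s G3 G1 @ alt t G2 G1)
     (AE G1 (G2, G4, 2 * s) (G3, G4, 2 * t) (G3, G2, 2 * r))"
| "r \<ge> 1 \<Longrightarrow> adm_table ([G2] @ alt r G4 G1 @ alt s G3 G1 @ alt t G2 G1)
     (AE G2 (G3, G4, 2 * t) (G3, G1, 2 * s + 1) (G1, G4, 2 * r - 1))"
| "r \<ge> 1 \<Longrightarrow> adm_table ([G3] @ alt r G4 G1 @ alt t G2 G1 @ alt s G3 G1)
     (AE G3 (G2, G4, 2 * s) (G2, G1, 2 * t + 1) (G1, G4, 2 * r - 1))"
| "t \<ge> 1 \<Longrightarrow> adm_table ([G4] @ alt t G2 G1 @ alt s G3 G1 @ alt r G4 G1)
     (AE G4 (G3, G2, 2 * r) (G3, G1, 2 * s + 1) (G1, G2, 2 * t - 1))"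
| "r \<ge> 1 \<Longrightarrow> s \<ge> 1 \<Longrightarrow> adm_table (alt r G1 G4 @ alt s G3 G1 @ alt t G2 G1)
     (AE G1 (G2, G3, 2 * r - 1) (G2, G4, 2 * s - 1) (G3, G4, 2 * t + 1))"

text \<open>\<^const>\<open>adm_step\<close> is symmetric, so its reflexive transitive closure is the identification of
  admissible sequences.\<close>

definition adm_expr :: "idx list \<Rightarrow> idx aexpr" where
  "adm_expr \<alpha> = (THE w. \<exists>m \<beta> w'. adm_table \<beta> w' \<and>
     adm_step\<^sup>*\<^sup>* \<alpha> (map (transpose G1 m) \<beta>) \<and> w = map_aexpr (transpose G1 m) w')"

definition e_adm :: "idx list \<Rightarrow> d4" where
  "e_adm \<alpha> = aexpr_val (adm_expr \<alpha>)"

fun labelled_as ::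
    "idx aexpr \<Rightarrow> idx \<Rightarrow> idx \<Rightarrow> idx \<Rightarrow> idx \<Rightarrow> nat \<Rightarrow> nat \<Rightarrow> nat \<Rightarrow> bool" where
  "labelled_as (AE i' (j1, k1, n1) (j2, k2, n2) (j3, k3, n3)) i j k l t s r \<longleftrightarrow>
     i' = i \<and> {i, j, k, l} = UNIV \<and>
     {({j1, k1}, n1), ({j2, k2}, n2), ({j3, k3}, n3)} = {({j, k}, t), ({k, l}, s), ({l, j}, r)}"

text \<open>The value for length at least 2 is independent of the chosen labelling.\<close>

definition f_adm :: "idx list \<Rightarrow> d4" where
  "f_adm \<alpha> =
     (if length \<alpha> = 1 then e (hd \<alpha>) \<sqinter> Sup_fin (e ` (- {hd \<alpha>}))
      else (SOME x. \<exists>i j k l t s r. labelled_as (adm_expr \<alpha>) i j k l t s r \<and> r \<ge> 1 \<and>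
        x = e_adm \<alpha> \<sqinter>
          ((e i \<sqinter> atomic j k (t + 1)) \<squnion> (atomic k l (s + 1) \<sqinter> atomic l j (r - 1)))))"

section \<open>Cumulative and perfect elements\<close>

definition e_cum :: "idx \<Rightarrow> nat \<Rightarrow> d4" where
  "e_cum i n = Sup_fin {e_adm \<alpha> | \<alpha>. admissible \<alpha> \<and> length \<alpha> = n \<and> last \<alpha> = i}"

definition f0_cum :: "nat \<Rightarrow> d4" where
  "f0_cum n = Sup_fin {f_adm \<alpha> | \<alpha>. admissible \<alpha> \<and> length \<alpha> = n - 1}"

definition e_inv :: "idx \<Rightarrow> nat \<Rightarrow> d4" where
  "e_inv i n = (let j = rest {i} ! 0; k = rest {i} ! 1; l = rest {i} ! 2 in
     Sup_fin {e i \<sqinter> atomic j k r \<sqinter> atomic k l s \<sqinter> atomic j l t | r s t. r + s + t = n - 1})"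

definition f0_inv :: "nat \<Rightarrow> d4" where
  "f0_inv n =
     Sup_fin (range (\<lambda>i. Sup_fin {f_adm \<alpha> | \<alpha>. admissible \<alpha> \<and> length \<alpha> = n - 1 \<and> hd \<alpha> = i}))"

definition h :: "idx \<Rightarrow> nat \<Rightarrow> d4" where
  "h i n = Sup_fin ((\<lambda>j. e_cum j n) ` (- {i}))"

definition h_max :: "nat \<Rightarrow> d4" where
  "h_max n = h G1 n \<squnion> h G2 n \<squnion> h G3 n \<squnion> h G4 n"

definition h_min :: "nat \<Rightarrow> d4" where
  "h_min n = h G1 n \<sqinter> h G2 n \<sqinter> h G3 n \<sqinter> h G4 n"

inductive_set sublattice :: "'a::lattice set \<Rightarrow> 'a set" for A where
  subl_base: "x \<in> A \<Longrightarrow> x \<in> sublattice A"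
| subl_sup: "x \<in> sublattice A \<Longrightarrow> y \<in> sublattice A \<Longrightarrow> x \<squnion> y \<in> sublattice A"
| subl_inf: "x \<in> sublattice A \<Longrightarrow> y \<in> sublattice A \<Longrightarrow> x \<sqinter> y \<in> sublattice A"

definition B_plus :: "nat \<Rightarrow> d4 set" where
  "B_plus n = sublattice (range (\<lambda>i. h i n))"

end

theory Submission
  imports Defs "HOL-Library.Function_Algebras" "HOL-Library.Multiset"
begin

text \<open>The equalities in $D^4$ and the linear equivalences have separate reasons.

  \<^emph>\<open>Equalities.\<close> Identify the four indices with the four-group, \<open>G1\<close> being neutral. Each of the three
  partitions of the indices into two pairs is then a nonzero group element \<open>p\<close>, and $\gamma_{ij}$
  depends only on the partition \<open>i \<oplus> j\<close>. Among the three atomic elements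
  $a^{jk}, a^{kl}, a^{jl}$ on the indices other than \<open>i\<close> there is one for each partition, so a meet
  $e_i a^{jk}_r a^{kl}_s a^{jl}_t$ is given by \<open>i\<close> and a function \<open>c\<close> from partitions to numbers; call
  it \<open>e_elem i c\<close>. The decisive computation is that $\gamma$ for the partition \<open>p\<close> raises \<open>c p\<close> by one
  and changes nothing else (\<open>gamma_e_elem\<close>); in particular the three endomorphisms commute on these
  elements. The elements $f_{\alpha0}$ obey the same rule (\<open>gamma_f_elem\<close>).

  Two consecutive entries of an admissible sequence determine a partition, and replacing \<open>ijl\<close>
  by \<open>ikl\<close> transposes two neighbouring partitions. A class of admissible sequences is therefore
  the same as the end index together with the number of occurrences of each partition, and the table
  of definitions says that $e_\alpha$ is \<open>e_elem\<close> of these data (\<open>e_adm_eq\<close>, \<open>f_adm_eq\<close>). Lengthening a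
  sequence at its start by \<open>i\<close> applies $\gamma_{mi}$, where \<open>m\<close> is the old start. So the
  cumulative elements satisfy the recursions that define $s_n$, $t_n$ and $p_{i,n}$, while counting
  multiplicities turns them into the sums over $r+s+t=n-1$. The modular law gives
  $h_jh_kh_l = e_i(n)+h^{\min}(n)$, and an induction gives $t_n \le h^{\min}(n)$.

  \<^emph>\<open>Linear equivalence.\<close> It remains to prove $\rho(h^{\min}(n)) \subseteq \rho(t_n)$ for a
  representation $\rho$; this is done by induction on \<open>n\<close>, using the Coxeter functor. Let $V^+$ consist
  of the families $x_i \in \rho(e_i)$ with $\sum x_i = 0$, let $\rho^+$ send $e_i$ to the families with
  $x_i=0$, and let $\varphi_i$ be the projection $x \mapsto x_i$. For $i\ne k$, $\varphi_i$ maps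
  $\rho^+(e_k\dots)$ onto $\rho(e_i\dots)$ with the exponent of \<open>i \<oplus> k\<close> raised (\<open>\<phi>_e_elem\<close>). With
  \<open>push X\<close> denoting $\sum_i\varphi_i(X)$ this yields
  $\rho(h_i(n+1)) = $ \<open>push\<close> $(\rho^+(h_i(n)))$ and
  \<open>push\<close> $(\rho^+(t_n)) \subseteq \rho(t_{n+1})$. What is needed is that \<open>push\<close> commutes with
  the intersection of the $h_i(n)$. This is so because each $\rho(h_i(n))$ is the image of an
  idempotent endomorphism of the representation, and such retractions pass from $\rho^+$ to
  $\rho$ (\<open>push_inf\<close>, \<open>retraction_lift\<close>).\<close>

section \<open>The four-group of indices\<close>

fun kadd :: "idx \<Rightarrow> idx \<Rightarrow> idx" (infixl "\<oplus>" 65) where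
  "kadd G1 y = y"
| "kadd x G1 = x"
| "kadd G2 G2 = G1" | "kadd G2 G3 = G4" | "kadd G2 G4 = G3"
| "kadd G3 G2 = G4" | "kadd G3 G3 = G1" | "kadd G3 G4 = G2"
| "kadd G4 G2 = G3" | "kadd G4 G3 = G2" | "kadd G4 G4 = G1"

lemma kadd_comm: "x \<oplus> y = y \<oplus> x"
  by (cases x; cases y) simp_all

lemma kadd_assoc: "x \<oplus> y \<oplus> z = x \<oplus> (y \<oplus> z)"
  by (cases x; cases y; cases z) simp_all

lemma kadd_self [simp]: "x \<oplus> x = G1"
  by (cases x) simp_all

lemma kadd_G1 [simp]: "x \<oplus> G1 = x"
  by (cases x) simp_all

lemma kadd_cancel [simp]: "x \<oplus> (x \<oplus> y) = y"
  by (simp flip: kadd_assoc)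

lemma kadd_eq_G1 [simp]: "x \<oplus> y = G1 \<longleftrightarrow> x = y"
  by (cases x; cases y) simp_all

lemma idx_all: "(\<forall>i. P i) \<longleftrightarrow> P G1 \<and> P G2 \<and> P G3 \<and> P G4"
  by (metis idx.exhaust)

lemma UNIV_idx_iff:
  "{i, j, k, l} = (UNIV :: idx set) \<longleftrightarrow>
     i \<noteq> j \<and> i \<noteq> k \<and> i \<noteq> l \<and> j \<noteq> k \<and> j \<noteq> l \<and> k \<noteq> l"
  unfolding UNIV_idx by (cases i; cases j; cases k; cases l) auto

text \<open>The two pairs of a partition have the same sum, which is why the group element names the partition.\<close>

lemma kadd_complement:
  assumes "{i, j, k, l} = (UNIV :: idx set)"
  shows "k \<oplus> l = i \<oplus> j"
  using assms unfolding UNIV_idx_iff by (cases i; cases j; cases k; cases l) simp_all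

lemma compl_pair:
  assumes "{i, j, k, l} = (UNIV :: idx set)"
  shows "- {i, j} = {k, l}"
  using assms unfolding UNIV_idx_iff
  by (cases i; cases j; cases k; cases l) (simp_all add: set_eq_iff idx_all)

section \<open>Modular lattices\<close>

lemma modular':
  fixes x y z :: "'a::modular_lattice"
  assumes "x \<le> z"
  shows "(x \<squnion> y) \<sqinter> z = x \<squnion> (y \<sqinter> z)"
  using modular[OF assms] by simp

lemma modular_inf_sup:
  fixes x y z :: "'a::modular_lattice"
  assumes "x \<le> z"
  shows "z \<sqinter> (x \<squnion> y) = x \<squnion> z \<sqinter> y"
  using modular[OF assms, of y] by (simp add: inf_commute)

text \<open>Two applications of the modular law. In this form it evaluates sums $xq_{ij}+yq_{ij}$, where
$q_{ij}$ is a meet of two joins, one of them above \<open>x\<close> and the other above \<open>y\<close>.\<close>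

lemma sup_of_meets:
  fixes a b u v :: "'a::modular_lattice"
  assumes "a \<le> u" "b \<le> v"
  shows "a \<sqinter> v \<squnion> b \<sqinter> u = (a \<squnion> b) \<sqinter> (u \<sqinter> v)"
proof -
  have "a \<sqinter> v \<squnion> b \<sqinter> u = (a \<sqinter> v \<squnion> b) \<sqinter> u"
    using assms(1) by (intro modular) (simp add: le_infI1)
  also have "a \<sqinter> v \<squnion> b = (b \<squnion> a) \<sqinter> v"
    using modular[OF assms(2), of a] by (simp add: sup_commute)
  finally show ?thesis by (simp add: ac_simps)
qed

section \<open>Atomic elements\<close>

lemma gamma_hom [simp]:
  "gamma i j (x \<squnion> y) = gamma i j x \<squnion> gamma i j y"
  "gamma i j (x \<sqinter> y) = gamma i j x \<sqinter> gamma i j y"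
  "gamma i j \<top> = q i j" "gamma i j \<bottom> = \<bottom>" "gamma i j (e m) = e m \<sqinter> q i j"
  using is_gamma_gamma[of i j] by (auto simp: is_gamma_def lattice_hom_def)

lemma gamma_mono: "x \<le> y \<Longrightarrow> gamma i j x \<le> gamma i j y"
  by (metis gamma_hom(2) inf.orderE inf.orderI)

lemma q_eq:
  assumes "{i, j, k, l} = UNIV"
  shows "q i j = (e i \<squnion> e j) \<sqinter> (e k \<squnion> e l)"
  using compl_pair[OF assms] by (simp add: q_def)

lemma gamma_cong: "q i j = q k l \<Longrightarrow> gamma i j = gamma k l"
  by (simp add: gamma_def is_gamma_def)

lemma gamma_sym: "gamma i j = gamma j i"
  by (rule gamma_cong) (simp add: q_def insert_commute sup_commute)

lemma gamma_compl:
  assumes "{i, j, k, l} = UNIV"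
  shows "gamma i j = gamma k l"
proof (rule gamma_cong)
  have "{k, l, i, j} = UNIV" using assms by (auto simp: UNIV_idx_iff)
  then show "q i j = q k l" using assms by (simp add: q_eq inf_commute)
qed

text \<open>$\gamma_{ij}$ depends only on $q_{ij}$, hence only on the partition; $\gamma_{12}$, $\gamma_{13}$,
$\gamma_{14}$ represent all of them.\<close>

lemma gamma_kadd:
  assumes "i \<noteq> j"
  shows "gamma i j = gamma G1 (i \<oplus> j)"
proof -
  consider "i = G1" | "j = G1" | "i \<noteq> G1" "j \<noteq> G1" by blast
  then show ?thesis
  proof cases
    case 2
    have "gamma i G1 = gamma G1 i" by (rule gamma_sym)
    then show ?thesis using 2 by simp
  next
    case 3
    have "{G1, i \<oplus> j, i, j} = UNIV"
      using 3 assms unfolding UNIV_idx_iff by (cases i; cases j) simp_all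
    then show ?thesis by (rule gamma_compl [symmetric])
  qed simp
qed

lemma rest_pair:
  assumes "{i, j, k, l} = UNIV"
  shows "rest {i, j} = [k, l] \<or> rest {i, j} = [l, k]"
  using assms unfolding UNIV_idx_iff rest_def
  by (cases i; cases j; cases k; cases l) simp_all

text \<open>Both sides have the form $e_i(e_j+e_kU)$ with \<open>j\<close> and \<open>k\<close> interchanged, where \<open>U \<ge> e\<^sub>i\<close> is
the inner atomic element. As $e_i \le U$, modularity turns this into the symmetric expression
$e_i(e_jU+e_kU)$.\<close>

lemma atomic_swap:
  assumes "{i, j, k, l} = UNIV"
  shows "e i \<sqinter> atomic j k n = e i \<sqinter> atomic k j n"
  using assms
proof (induction n arbitrary: i j k l rule: less_induct)
  case (less n)
  have inner: "e b \<sqinter> atomic (rest {a, b} ! 0) (rest {a, b} ! 1) m = e b \<sqinter> atomic c d m"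
    if "{a, b, c, d} = UNIV" "m < n" for a b c d m
  proof -
    have "{b, c, d, a} = UNIV" using that by (auto simp: UNIV_idx_iff)
    from less.IH[OF that(2) this] show ?thesis
      using rest_pair[OF that(1)]
        by (elim disjE) (simp_all only: nth_Cons_0 nth_Cons_Suc One_nat_def)
  qed
  show ?case
  proof (cases n)
    case (Suc m)
    define U where "U = atomic i l m"
    have U: "e i \<le> U" by (cases m) (simp_all add: U_def)
    have j: "atomic j k n = e j \<squnion> (e k \<sqinter> U)"
    proof -
      have "{j, k, i, l} = UNIV" using less.prems by (auto simp: UNIV_idx_iff)
      from inner[OF this, of m] show ?thesis by (simp only: Suc U_def atomic.simps lessI)
    qed
    have k: "atomic k j n = e k \<squnion> (e j \<sqinter> U)"
    proof -
      have "{k, j, i, l} = UNIV" using less.prems by (auto simp: UNIV_idx_iff)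
      from inner[OF this, of m] show ?thesis by (simp only: Suc U_def atomic.simps lessI)
    qed
    have *: "e i \<sqinter> (a \<squnion> (b \<sqinter> U)) = e i \<sqinter> (a \<sqinter> U \<squnion> b \<sqinter> U)" for a b
    proof -
      have "e i \<sqinter> (a \<squnion> b \<sqinter> U) = e i \<sqinter> (U \<sqinter> (b \<sqinter> U \<squnion> a))"
        using U by (simp only: sup_commute[of a] inf_absorb1 flip: inf_assoc)
      also have "U \<sqinter> (b \<sqinter> U \<squnion> a) = b \<sqinter> U \<squnion> U \<sqinter> a"
        by (rule modular_inf_sup) simp
      finally show ?thesis by (simp only: inf_commute[of U] sup_commute)
    qed
    have "e i \<sqinter> atomic j k n = e i \<sqinter> (e j \<sqinter> U \<squnion> e k \<sqinter> U)"
      unfolding j by (rule *)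
    moreover have "e i \<sqinter> atomic k j n = e i \<sqinter> (e k \<sqinter> U \<squnion> e j \<sqinter> U)"
      unfolding k by (rule *)
    ultimately show ?thesis by (simp only: sup_commute)
  qed simp
qed

lemma atomic_Suc:
  assumes "{i, j, k, l} = UNIV"
  shows "atomic i j (Suc n) = e i \<squnion> (e j \<sqinter> atomic k l n)"
proof -
  have "{j, k, l, i} = UNIV" using assms by (auto simp: UNIV_idx_iff)
  from atomic_swap[OF this, of n] show ?thesis
    using rest_pair[OF assms]
      by (elim disjE) (simp_all only: nth_Cons_0 nth_Cons_Suc One_nat_def atomic.simps)
qed

declare atomic.simps(2) [simp del]

lemma atomic_Suc_le:
  assumes "i \<noteq> j"
  shows "atomic i j (Suc n) \<le> atomic i j n"
  using assms
proof (induction n arbitrary: i j)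
  case (Suc n)
  then obtain k l where kl: "{i, j, k, l} = UNIV"
    unfolding UNIV_idx_iff by (metis idx.distinct idx.exhaust)
  then have "k \<noteq> l" by (simp add: UNIV_idx_iff)
  from Suc.IH[OF this] show ?case
    unfolding atomic_Suc[OF kl] by (meson inf_mono order_refl sup_mono)
qed simp

lemma atomic_antimono:
  assumes "i \<noteq> j" "m \<le> n"
  shows "atomic i j n \<le> atomic i j m"
  by (rule lift_Suc_antimono_le[of "atomic i j"]) (use assms atomic_Suc_le in auto)

lemma atomic_Suc_le_sup:
  assumes "i \<noteq> j"
  shows "atomic i j (Suc n) \<le> e i \<squnion> e j"
proof -
  obtain k l where kl: "{i, j, k, l} = UNIV"
    using assms unfolding UNIV_idx_iff by (metis idx.distinct idx.exhaust)
  show ?thesis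
    unfolding atomic_Suc[OF kl] by (meson inf_le1 order_refl sup_mono)
qed

text \<open>An atomic element on one index from each pair of the partition is only cut down to $q_{ij}$.\<close>

lemma gamma_atomic_across:
  assumes "{i, j, k, l} = UNIV"
  shows "gamma i j (atomic i k n) = q i j \<sqinter> atomic i k n"
  using assms
proof (induction n arbitrary: i j k l)
  case (Suc n)
  have ikjl: "{i, k, j, l} = UNIV" and jilk: "{j, i, l, k} = UNIV"
    using Suc.prems by (auto simp: UNIV_idx_iff)
  note q = q_eq[OF Suc.prems]
  have "gamma i j (atomic j l n) = q i j \<sqinter> atomic j l n"
    using Suc.IH[OF jilk] by (simp add: gamma_sym[of j i] q_def insert_commute sup_commute)
  then have "gamma i j (atomic i k (Suc n)) =
      e i \<sqinter> q i j \<squnion> e k \<sqinter> q i j \<sqinter> (q i j \<sqinter> atomic j l n)"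
    unfolding atomic_Suc[OF ikjl] by simp
  also have "e i \<sqinter> q i j = e i \<sqinter> (e k \<squnion> e l)"
    unfolding q by (rule antisym) (auto intro: le_infI1 le_infI2 le_supI1)
  also have "e k \<sqinter> q i j \<sqinter> (q i j \<sqinter> atomic j l n) = e k \<sqinter> q i j \<sqinter> atomic j l n"
    by (simp add: inf_assoc)
  also have "e k \<sqinter> q i j = e k \<sqinter> (e i \<squnion> e j)"
    unfolding q by (rule antisym) (auto intro: le_infI1 le_infI2 le_supI1)
  also have "e k \<sqinter> (e i \<squnion> e j) \<sqinter> atomic j l n = (e k \<sqinter> atomic j l n) \<sqinter> (e i \<squnion> e j)"
    by (simp only: ac_simps)
  also have "e i \<sqinter> (e k \<squnion> e l) \<squnion> (e k \<sqinter> atomic j l n) \<sqinter> (e i \<squnion> e j) =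
      (e i \<squnion> (e k \<sqinter> atomic j l n)) \<sqinter> ((e i \<squnion> e j) \<sqinter> (e k \<squnion> e l))"
    by (rule sup_of_meets) (simp_all add: le_infI1)
  finally show ?case
    unfolding atomic_Suc[OF ikjl] q by (simp add: inf_commute)
qed simp

text \<open>Inductively, $\gamma_{ij}=\gamma_{kl}$ maps $e_k+e_la^{ij}_n$ to $e_kq_{ij}+e_la^{ij}_{n+1}$. The second
summand lies below $e_i+e_j$, so the modular law extracts this factor from the sum.\<close>

lemma gamma_atomic_along:
  assumes "{i, j, k, l} = UNIV"
  shows "gamma i j (atomic k l n) = q i j \<sqinter> atomic k l (Suc n)"
  using assms
proof (induction n arbitrary: i j k l)
  case 0
  have klij: "{k, l, i, j} = UNIV" using 0 by (auto simp: UNIV_idx_iff)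
  show ?case unfolding atomic_Suc[OF klij] q_eq[OF 0]
    by (simp add: ac_simps q_eq[OF 0])
next
  case (Suc n)
  have klij: "{k, l, i, j} = UNIV" using Suc.prems by (auto simp: UNIV_idx_iff)
  have "gamma i j (atomic i j n) = q i j \<sqinter> atomic i j (Suc n)"
    using Suc.IH[OF klij] gamma_compl[OF klij]
      q_eq[OF klij] q_eq[OF Suc.prems] by (simp add: inf_commute)
  then have "gamma i j (atomic k l (Suc n)) =
      e k \<sqinter> q i j \<squnion> e l \<sqinter> q i j \<sqinter> (q i j \<sqinter> atomic i j (Suc n))"
    unfolding atomic_Suc[OF klij] by simp
  also have "e k \<sqinter> q i j = e k \<sqinter> (e i \<squnion> e j)"
    unfolding q_eq[OF Suc.prems] by (rule antisym) (auto intro: le_infI1 le_infI2 le_supI1)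
  also have "e l \<sqinter> q i j \<sqinter> (q i j \<sqinter> atomic i j (Suc n)) = e l \<sqinter> atomic i j (Suc n)"
  proof (rule antisym)
    have "atomic i j (Suc n) \<le> e i \<squnion> e j"
      using Suc.prems by (intro atomic_Suc_le_sup) (simp add: UNIV_idx_iff)
    then show "e l \<sqinter> atomic i j (Suc n) \<le> e l \<sqinter> q i j \<sqinter> (q i j \<sqinter> atomic i j (Suc n))"
      unfolding q_eq[OF Suc.prems] by (auto simp: le_infI1 le_infI2)
  qed (auto intro: le_infI1 le_infI2)
  also have "e k \<sqinter> (e i \<squnion> e j) \<squnion> e l \<sqinter> atomic i j (Suc n) =
      (e k \<squnion> e l \<sqinter> atomic i j (Suc n)) \<sqinter> (e i \<squnion> e j)"
    using Suc.prems modular[of "e l \<sqinter> atomic i j (Suc n)" "e i \<squnion> e j" "e k"]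
      atomic_Suc_le_sup[of i j n]
    by (simp add: UNIV_idx_iff le_infI2 sup_commute)
  also have "\<dots> = q i j \<sqinter> atomic k l (Suc (Suc n))"
  proof -
    have "e k \<squnion> e l \<sqinter> atomic i j (Suc n) \<le> e k \<squnion> e l" by (simp add: le_supI2 le_infI1)
    then show ?thesis unfolding q_eq[OF Suc.prems] atomic_Suc[OF klij, of "Suc n"]
      by (simp add: inf_absorb1 inf_absorb2 ac_simps)
  qed
  finally show ?case .
qed

section \<open>Powers of the endomorphisms applied to the generators\<close>

text \<open>The atomic element that accompanies $e_k$ and belongs to the partition \<open>p\<close>: its upper indices are
the pair of \<open>p\<close> that does not contain \<open>k\<close>. The value at \<open>p = G1\<close> is meaningless.\<close>

definition atom :: "idx \<Rightarrow> idx \<Rightarrow> nat \<Rightarrow> d4" where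
  "atom k p n = atomic (rest {k, k \<oplus> p} ! 0) (rest {k, k \<oplus> p} ! 1) n"

text \<open>As \<open>gamma_e_elem\<close> shows, this is $\gamma_{12}^{c(2)}\gamma_{13}^{c(3)}\gamma_{14}^{c(4)}(e_k)$.\<close>

definition e_elem :: "idx \<Rightarrow> (idx \<Rightarrow> nat) \<Rightarrow> d4" where
  "e_elem k c = e k \<sqinter> (atom k G2 (c G2) \<sqinter> atom k G3 (c G3) \<sqinter> atom k G4 (c G4))"

lemma kadd_left_cancel [simp]: "x \<oplus> y = x \<oplus> z \<longleftrightarrow> y = z"
  by (metis kadd_cancel)

lemma kadd_eq_self [simp]: "x \<oplus> y = x \<longleftrightarrow> y = G1" "x = x \<oplus> y \<longleftrightarrow> y = G1"
  by (metis kadd_G1 kadd_cancel)+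

lemma four_labels:
  assumes "k \<noteq> m"
  obtains a b where "{k, m, a, b} = (UNIV :: idx set)"
  using assms unfolding UNIV_idx_iff by (metis idx.distinct idx.exhaust)

lemma labels_perm:
  assumes "{i, j, k, l} = (UNIV :: idx set)"
  shows "{i, j, l, k} = UNIV" "{i, k, j, l} = UNIV" "{j, i, k, l} = UNIV" "{k, l, i, j} = UNIV"
  using assms by (simp_all add: insert_commute)

lemma atom_eq_atomic:
  assumes "p \<noteq> G1"
  obtains a b where "{k, k \<oplus> p, a, b} = UNIV" "atom k p = atomic a b"
proof -
  have "k \<noteq> k \<oplus> p" using assms by (metis kadd_cancel kadd_self)
  then obtain a b where ab: "{k, k \<oplus> p, a, b} = UNIV" by (rule four_labels)
  from rest_pair[OF this] show ?thesis
  proof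
    assume "rest {k, k \<oplus> p} = [a, b]"
    then have "atom k p = atomic a b" by (simp add: atom_def fun_eq_iff)
    with ab show ?thesis by (rule that)
  next
    assume "rest {k, k \<oplus> p} = [b, a]"
    then have "atom k p = atomic b a" by (simp add: atom_def fun_eq_iff)
    with labels_perm(1)[OF ab] show ?thesis by (rule that)
  qed
qed

lemma e_inf_atomic:
  assumes "{k, m, a, b} = UNIV"
  shows "e k \<sqinter> atomic a b n = e k \<sqinter> atom k (k \<oplus> m) n"
proof -
  have "{k, a, b, m} = UNIV" using assms by (simp add: insert_commute)
  from atomic_swap[OF this] show ?thesis
    using rest_pair[OF assms] by (elim disjE) (simp_all add: atom_def)
qed

lemma atom_0 [simp]: "atom k p 0 = \<top>"
  by (simp add: atom_def)

lemma atom_antimono: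
  assumes "p \<noteq> G1" "m \<le> n"
  shows "atom k p n \<le> atom k p m"
proof -
  obtain a b where ab: "{k, k \<oplus> p, a, b} = UNIV" "atom k p = atomic a b"
    using atom_eq_atomic[OF assms(1)] .
  then have "a \<noteq> b" by (simp add: UNIV_idx_iff)
  then show ?thesis using ab(2) assms(2) by (simp add: atomic_antimono)
qed

lemma atom_max:
  assumes "p \<noteq> G1"
  shows "atom k p (max m n) = atom k p m \<sqinter> atom k p n"
  using atom_antimono[OF assms] by (simp add: max_def inf_absorb1 inf_absorb2)

lemma e_elem_eq:
  assumes "{G1, p, s, r} = UNIV"
  shows "e_elem k c = e k \<sqinter> (atom k p (c p) \<sqinter> atom k s (c s) \<sqinter> atom k r (c r))"
  using assms unfolding UNIV_idx_iff e_elem_def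
  by (cases p; cases s; cases r) (simp_all add: ac_simps)

lemma e_elem_le_e: "e_elem k c \<le> e k"
  by (simp add: e_elem_def)

lemma e_elem_zero [simp]: "e_elem k (\<lambda>_. 0) = e k"
  by (simp add: e_elem_def)

lemma e_elem_inf: "e_elem k c \<sqinter> e_elem k d = e_elem k (\<lambda>p. max (c p) (d p))"
  by (simp add: e_elem_def atom_max ac_simps)

lemma e_elem_cong: "(\<And>p. p \<noteq> G1 \<Longrightarrow> c p = d p) \<Longrightarrow> e_elem k c = e_elem k d"
  by (simp add: e_elem_def)

lemma e_elem_antimono: "(\<And>p. p \<noteq> G1 \<Longrightarrow> c p \<le> d p) \<Longrightarrow> e_elem k d \<le> e_elem k c"
  unfolding e_elem_def by (meson atom_antimono idx.distinct inf_mono order_refl)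

lemma gamma_atom:
  assumes "p \<noteq> G1"
  shows "gamma G1 p (atom k p n) = q k (k \<oplus> p) \<sqinter> atom k p (Suc n)"
proof -
  obtain a b where ab: "{k, k \<oplus> p, a, b} = UNIV" "atom k p = atomic a b"
    using atom_eq_atomic[OF assms] .
  have "k \<noteq> k \<oplus> p" using ab(1) by (simp add: UNIV_idx_iff)
  then have "gamma k (k \<oplus> p) = gamma G1 p" using gamma_kadd[of k "k \<oplus> p"] by simp
  with gamma_atomic_along[OF ab(1), of n] ab(2) show ?thesis by (simp only:)
qed

lemma q_sym: "q i j = q j i"
  by (simp add: q_def insert_commute sup_commute)

lemma q_compl:
  assumes "{i, j, k, l} = UNIV"
  shows "q i j = q k l"
  using assms labels_perm(4)[OF assms] by (simp add: q_eq inf_commute)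

lemma gamma_atom_other:
  assumes "p \<noteq> G1" "p' \<noteq> G1" "p \<noteq> p'"
  shows "gamma G1 p (atom k p' n) = q k (k \<oplus> p) \<sqinter> atom k p' n"
proof -
  obtain a b where ab: "{k, k \<oplus> p', a, b} = UNIV" "atom k p' = atomic a b"
    using atom_eq_atomic[OF assms(2)] .
  have k: "k \<noteq> k \<oplus> p" using assms(1) by (metis kadd_cancel kadd_self)
  have neq: "k \<oplus> p \<noteq> k \<oplus> p'" using assms(3) by (metis kadd_cancel)
  have g: "gamma k (k \<oplus> p) = gamma G1 p" using k gamma_kadd[of k "k \<oplus> p"] by simp
  have "k \<oplus> p \<in> {k, k \<oplus> p', a, b}" using ab(1) by simp
  then consider "k \<oplus> p = a" | "k \<oplus> p = b" using k neq by auto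
  then show ?thesis
  proof cases
    case 1
    then have *: "{a, k, b, k \<oplus> p'} = UNIV" using ab(1) by (simp add: insert_commute)
    from gamma_atomic_across[OF this] 1 g ab(2) show ?thesis
      by (simp add: gamma_sym[of a k] q_sym[of a k])
  next
    case 2
    then have *: "{a, k \<oplus> p', b, k} = UNIV" using ab(1) by (simp add: insert_commute)
    then have gq: "gamma a (k \<oplus> p') = gamma k b" "q a (k \<oplus> p') = q k b"
      using gamma_compl q_compl gamma_sym q_sym by metis+
    from gamma_atomic_across[OF *] 2 g ab(2) gq show ?thesis by simp
  qed
qed

text \<open>Each factor acquires a further factor $q$, which is absorbed: once the exponent of \<open>p\<close> is positive,
the meet of $e_k$ with its atomic element already lies below $q$.\<close>

lemma gamma_e_elem:
  assumes "p \<noteq> G1"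
  shows "gamma G1 p (e_elem k c) = e_elem k (c(p := Suc (c p)))"
proof -
  obtain s r where psr: "{G1, p, s, r} = UNIV" using assms four_labels[of G1 p] by metis
  then have d: "p \<noteq> s" "p \<noteq> r" "s \<noteq> G1" "r \<noteq> G1" "s \<noteq> p" "r \<noteq> p"
    by (auto simp: UNIV_idx_iff)
  obtain a b where ab: "{k, k \<oplus> p, a, b} = UNIV" "atom k p = atomic a b"
    using atom_eq_atomic[OF assms] .
  have qg: "q G1 p = q k (k \<oplus> p)"
  proof -
    have "k \<noteq> k \<oplus> p" using ab(1) by (simp add: UNIV_idx_iff)
    then have "gamma k (k \<oplus> p) = gamma G1 p" using gamma_kadd[of k "k \<oplus> p"] by simp
    then show ?thesis by (metis gamma_hom(3))
  qed
  define Q where "Q = q k (k \<oplus> p)"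
  have "e k \<sqinter> atom k p (Suc (c p)) \<le> Q"
  proof -
    have "a \<noteq> b" using ab(1) by (simp add: UNIV_idx_iff)
    then have "atom k p (Suc (c p)) \<le> e a \<squnion> e b"
      using ab(2) atomic_Suc_le_sup by simp
    then show ?thesis unfolding Q_def q_eq[OF ab(1)] by (simp add: le_infI1 le_infI2)
  qed
  then have *: "Q \<sqinter> (e k \<sqinter> atom k p (Suc (c p))) = e k \<sqinter> atom k p (Suc (c p))"
    by (simp add: inf_absorb2)
  have "gamma G1 p (e_elem k c) = e k \<sqinter> Q \<sqinter> (Q \<sqinter> atom k p (Suc (c p)) \<sqinter> (Q \<sqinter> atom k s (c s)) \<sqinter>
      (Q \<sqinter> atom k r (c r)))"
    unfolding e_elem_eq[OF psr] using assms d by (simp add: gamma_atom gamma_atom_other Q_def qg)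
  also have "\<dots> = (Q \<sqinter> (e k \<sqinter> atom k p (Suc (c p)))) \<sqinter> (atom k s (c s) \<sqinter> atom k r (c r))"
    by (simp add: ac_simps)
  also have "\<dots> = e k \<sqinter> atom k p (Suc (c p)) \<sqinter> (atom k s (c s) \<sqinter> atom k r (c r))"
    unfolding * by (rule refl)
  also have "\<dots> = e_elem k (c(p := Suc (c p)))"
    unfolding e_elem_eq[OF psr] using d by (simp add: ac_simps)
  finally show ?thesis .
qed

section \<open>The same for the elements $e_i(e_j+e_k+e_l)$\<close>

text \<open>The expression $e_\alpha(e_ia_{t+1}+a_{s+1}a_{r-1})$, the three exponents
being those of the partitions \<open>p\<close>, \<open>s\<close>, \<open>r\<close> in this order. Since $e_\alpha \le e_i$, both summands may be met with
$e_i$, which expresses everything through \<open>e_elem\<close>.\<close>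

definition f_form :: "idx \<Rightarrow> (idx \<Rightarrow> nat) \<Rightarrow> idx \<Rightarrow> idx \<Rightarrow> idx \<Rightarrow> d4" where
  "f_form k c p s r = e_elem k c \<sqinter>
     (e_elem k ((\<lambda>_. 0)(p := Suc (c p))) \<squnion> e_elem k ((\<lambda>_. 0)(s := Suc (c s), r := c r - 1)))"

lemma drop_meet:
  fixes a x y m :: "'a::modular_lattice"
  assumes "a \<le> m" "x \<le> m"
  shows "a \<sqinter> (x \<squnion> y \<sqinter> m) = a \<sqinter> (x \<squnion> y)"
proof -
  have "x \<squnion> y \<sqinter> m = (x \<squnion> y) \<sqinter> m" by (rule modular) fact
  then have "a \<sqinter> (x \<squnion> y \<sqinter> m) = a \<sqinter> m \<sqinter> (x \<squnion> y)" by (simp only: ac_simps)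
  then show ?thesis using assms(1) by (simp only: inf_absorb1)
qed

text \<open>By \<open>gamma_e_elem\<close> the endomorphism raises the exponent of \<open>t\<close> in all three places, whereas the
formula for the new \<open>c\<close> has one occurrence less of it. The surplus occurrence is a meet with the
element having exponent 1 at \<open>t\<close>, and \<open>drop_meet\<close> removes it.\<close>

lemma gamma_f_form:
  assumes psr: "{G1, p, s, r} = UNIV" and "c r \<ge> 1" and "t \<noteq> G1"
  shows "gamma G1 t (f_form k c p s r) = f_form k (c(t := Suc (c t))) p s r"
proof -
  have d: "p \<noteq> s" "p \<noteq> r" "s \<noteq> r" "p \<noteq> G1" "s \<noteq> G1" "r \<noteq> G1" "s \<noteq> p" "r \<noteq> p" "r \<noteq> s"
    using psr by (auto simp: UNIV_idx_iff)
  have "t \<in> {G1, p, s, r}" using psr by simp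
  then consider "t = p" | "t = s" | "t = r" using assms(3) by auto
  then show ?thesis
  proof cases
    case 1
    define m where "m = e_elem k ((\<lambda>_. 0)(p := 1))"
    have 2: "e_elem k ((\<lambda>_. 0)(s := Suc (c s), r := c r - Suc 0, p := Suc 0)) =
        e_elem k ((\<lambda>_. 0)(s := Suc (c s), r := c r - Suc 0)) \<sqinter> m"
      unfolding m_def e_elem_inf using d by (intro e_elem_cong) auto
    have "e_elem k (c(p := Suc (c p))) \<le> m" "e_elem k ((\<lambda>_. 0)(p := Suc (Suc (c p)))) \<le> m"
      unfolding m_def by (rule e_elem_antimono; simp)+
    from drop_meet[OF this] show ?thesis
      unfolding f_form_def using 1 d by (simp add: gamma_e_elem 2)
  next
    case 2
    define m where "m = e_elem k ((\<lambda>_. 0)(s := 1))"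
    have 1: "e_elem k ((\<lambda>_. 0)(p := Suc (c p), s := Suc 0)) = e_elem k ((\<lambda>_. 0)(p := Suc (c p))) \<sqinter> m"
      unfolding m_def e_elem_inf using d by (intro e_elem_cong) auto
    have 3: "(\<lambda>_. 0)(s := Suc (c s), r := c r - Suc 0, s := Suc (Suc (c s))) =
        (\<lambda>_. 0)(s := Suc (Suc (c s)), r := c r - Suc 0)"
      using d by (simp add: fun_upd_twist)
    have "e_elem k (c(s := Suc (c s))) \<le> m"
        "e_elem k ((\<lambda>_. 0)(s := Suc (Suc (c s)), r := c r - Suc 0)) \<le> m"
      unfolding m_def using d by (auto intro!: e_elem_antimono)
    from drop_meet[OF this] show ?thesis
      unfolding f_form_def using 2 d by (simp add: gamma_e_elem 1 3 sup_commute)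
  next
    case 3
    define m where "m = e_elem k ((\<lambda>_. 0)(r := 1))"
    have 1: "e_elem k ((\<lambda>_. 0)(p := Suc (c p), r := Suc 0)) = e_elem k ((\<lambda>_. 0)(p := Suc (c p))) \<sqinter> m"
      unfolding m_def e_elem_inf using d by (intro e_elem_cong) auto
    have "e_elem k (c(r := Suc (c r))) \<le> m"
        "e_elem k ((\<lambda>_. 0)(s := Suc (c s), r := c r)) \<le> m"
      unfolding m_def using d assms(2) by (auto intro!: e_elem_antimono)
    from drop_meet[OF this] show ?thesis
      unfolding f_form_def using 3 d assms(2) by (simp add: gamma_e_elem 1 sup_commute)
  qed
qed

lemma f_form_swap:
  assumes psr: "{G1, p, s, r} = UNIV"
  shows "f_form k c p s r = f_form k c s p r"
proof -
  have d: "p \<noteq> s" "p \<noteq> r" "s \<noteq> r" "p \<noteq> G1" "s \<noteq> G1" "r \<noteq> G1" "s \<noteq> p" "r \<noteq> p" "r \<noteq> s"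
    using psr by (auto simp: UNIV_idx_iff)
  define m where "m = e_elem k ((\<lambda>_. 0)(r := c r - 1))"
  have m: "e_elem k c \<le> m" unfolding m_def by (rule e_elem_antimono) simp
  define x where "x y = e_elem k ((\<lambda>_. 0)(y := Suc (c y)))" for y
  have *: "e_elem k ((\<lambda>_. 0)(y := Suc (c y), r := c r - 1)) = x y \<sqinter> m" if "y \<noteq> r" for y
    unfolding m_def x_def e_elem_inf using that by (intro e_elem_cong) auto
  have sym: "f_form k c y z r = e_elem k c \<sqinter> (x y \<sqinter> m \<squnion> x z \<sqinter> m)" if "z \<noteq> r" for y z
  proof -
    have "e_elem k c \<sqinter> (x z \<sqinter> m \<squnion> x y \<sqinter> m) = e_elem k c \<sqinter> (x z \<sqinter> m \<squnion> x y)"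
      by (rule drop_meet[OF m]) simp
    then show ?thesis
      unfolding f_form_def *[OF that] x_def[of y, symmetric] by (simp only: sup_commute)
  qed
  show ?thesis
    unfolding sym[OF d(3)] sym[OF d(2)] by (rule arg_cong[OF sup_commute])
qed

lemma f_form_cong:
  assumes "{G1, p, s, r} = UNIV" "c p = d p" "c s = d s" "c r = d r"
  shows "f_form k c p s r = f_form k d p s r"
proof -
  have "x \<in> {p, s, r}" if "x \<noteq> G1" for x using assms(1) that by (metis UNIV_I insertE)
  then have "e_elem k c = e_elem k d" using assms by (intro e_elem_cong) auto
  then show ?thesis using assms unfolding f_form_def by simp
qed

lemma e_elem_single:
  assumes "{k, m, a, b} = UNIV"
  shows "e_elem k ((\<lambda>_. 0)(k \<oplus> m := n)) = e k \<sqinter> atomic a b n"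
proof -
  have "k \<oplus> m \<noteq> G1" using assms by (simp add: UNIV_idx_iff)
  then obtain s r where psr: "{G1, k \<oplus> m, s, r} = UNIV" using four_labels[of G1 "k \<oplus> m"] by metis
  then have "s \<noteq> k \<oplus> m" "r \<noteq> k \<oplus> m" by (auto simp: UNIV_idx_iff)
  then show ?thesis unfolding e_elem_eq[OF psr] e_inf_atomic[OF assms] by simp
qed

lemma labels_kadd:
  assumes "{G1, p, s, r} = UNIV"
  shows "{k, k \<oplus> p, k \<oplus> s, k \<oplus> r} = UNIV"
  using assms unfolding UNIV_idx_iff by auto

text \<open>Here both sides are $e_k$ met with a sum in which
$e_k(e_x+e_y)$ absorbs the difference between $e_y(e_k+e_x)$ and $e_x(e_k+e_y)$: adding either
gives $(e_k+e_x)(e_k+e_y)(e_x+e_y)$.\<close>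

lemma f_form_exchange_base:
  assumes psr: "{G1, p, s, r} = UNIV" and "c p = 0" "c s = 1" "c r = 1"
  shows "f_form k c p s r = f_form k c p r s"
proof -
  define z x y where "z = k \<oplus> p" and "x = k \<oplus> s" and "y = k \<oplus> r"
  have psr': "p = k \<oplus> z" "s = k \<oplus> x" "r = k \<oplus> y" by (simp_all add: x_def y_def z_def)
  have kzxy: "{k, z, x, y} = UNIV" using labels_kadd[OF psr] by (simp add: x_def y_def z_def)
  have l: "{k, x, z, y} = UNIV" "{k, y, z, x} = UNIV" "{z, y, k, x} = UNIV" "{z, x, k, y} = UNIV"
      "{x, y, k, z} = UNIV"
    using kzxy by (simp_all add: insert_commute)
  have P: "e_elem k ((\<lambda>_. 0)(p := Suc 0)) = e k \<sqinter> (e x \<squnion> e y)"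
    using e_elem_single[OF kzxy, of 1] atomic_Suc[OF l(5), of 0] by (simp add: psr')
  have a2: "atomic z y 2 = e z \<squnion> e y \<sqinter> (e k \<squnion> e x)" "atomic z x 2 = e z \<squnion> e x \<sqinter> (e k \<squnion> e y)"
    using atomic_Suc[OF l(3), of 1] atomic_Suc[OF l(1), of 0]
      atomic_Suc[OF l(4), of 1] atomic_Suc[OF l(2), of 0]
    by (simp_all add: numeral_2_eq_2)
  have S: "e_elem k ((\<lambda>_. 0)(s := 2)) = e k \<sqinter> (e z \<squnion> e y \<sqinter> (e k \<squnion> e x))"
    using e_elem_single[OF l(1), of 2] unfolding a2 by (simp add: psr')
  have R: "e_elem k ((\<lambda>_. 0)(r := 2)) = e k \<sqinter> (e z \<squnion> e x \<sqinter> (e k \<squnion> e y))"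
    using e_elem_single[OF l(2), of 2] unfolding a2 by (simp add: psr')
  have *: "e k \<sqinter> (e x \<squnion> e y) \<squnion> e k \<sqinter> (e z \<squnion> e v \<sqinter> (e k \<squnion> e u)) =
      e k \<sqinter> (e z \<squnion> (e k \<squnion> e v) \<sqinter> ((e k \<squnion> e u) \<sqinter> (e x \<squnion> e y)))" if "{u, v} = {x, y}" for u v
  proof -
    have "e v \<le> e x \<squnion> e y" using that by (metis insertCI insertE singletonD sup_ge1 sup_ge2)
    then have "e k \<sqinter> (e x \<squnion> e y) \<squnion> e v \<sqinter> (e k \<squnion> e u) =
        (e k \<squnion> e v) \<sqinter> ((e k \<squnion> e u) \<sqinter> (e x \<squnion> e y))"
      by (intro sup_of_meets) simp_all
    moreover have "e k \<sqinter> (e x \<squnion> e y) \<squnion> e k \<sqinter> (e z \<squnion> e v \<sqinter> (e k \<squnion> e u)) =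
      e k \<sqinter> (e k \<sqinter> (e x \<squnion> e y) \<squnion> (e z \<squnion> e v \<sqinter> (e k \<squnion> e u)))"
      by (rule modular_inf_sup [symmetric]) simp
    ultimately show ?thesis by (simp only: sup_left_commute)
  qed
  have "e k \<sqinter> (e x \<squnion> e y) \<squnion> e k \<sqinter> (e z \<squnion> e y \<sqinter> (e k \<squnion> e x)) =
     e k \<sqinter> (e x \<squnion> e y) \<squnion> e k \<sqinter> (e z \<squnion> e x \<sqinter> (e k \<squnion> e y))"
    using *[of x y] *[of y x] by (simp add: insert_commute inf_left_commute)
  moreover have "(\<lambda>_. 0)(s := 2, r := 0) = (\<lambda>_. 0::nat)(s := 2)"
     "(\<lambda>_. 0)(r := 2, s := 0) = (\<lambda>_. 0::nat)(r := 2)"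
    using psr by (auto simp: UNIV_idx_iff fun_eq_iff)
  ultimately show ?thesis
    unfolding f_form_def using assms P S R by (simp add: numeral_2_eq_2)
qed

text \<open>Applying $\gamma$'s to the case of exponents 0, 1, 1 produces every other case, by
\<open>gamma_f_form\<close>.\<close>

lemma f_form_exchange:
  assumes psr: "{G1, p, s, r} = UNIV" and "c s \<ge> 1" "c r \<ge> 1"
  shows "f_form k c p s r = f_form k c p r s"
  using assms(2,3)
proof (induction "c p + c s + c r" arbitrary: c rule: less_induct)
  case less
  have d: "p \<noteq> s" "p \<noteq> r" "s \<noteq> r" "p \<noteq> G1" "s \<noteq> G1" "r \<noteq> G1" "s \<noteq> p" "r \<noteq> p" "r \<noteq> s"
    using psr by (auto simp: UNIV_idx_iff)
  have step: "f_form k c p s r = f_form k c p r s"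
    if t: "t \<noteq> G1" "c t \<ge> 1" and b: "b = c(t := c t - 1)" "b s \<ge> 1" "b r \<ge> 1"
      "b p + b s + b r < c p + c s + c r" for t b
  proof -
    have c: "c = b(t := Suc (b t))" using t b by (auto simp: fun_eq_iff)
    have "f_form k b p s r = f_form k b p r s" using b by (intro less.hyps) auto
    then have "gamma G1 t (f_form k b p s r) = gamma G1 t (f_form k b p r s)" by simp
    then show ?thesis
      unfolding gamma_f_form[of p s r b t k, OF psr b(3) t(1)]
        gamma_f_form[of p r s b t k, OF labels_perm(1)[OF psr] b(2) t(1)] c[symmetric] .
  qed
  consider "c p \<ge> 1" | "c s \<ge> 2" | "c r \<ge> 2" | "c p = 0" "c s = 1" "c r = 1"
    using less.prems by linarith
  then show ?case
  proof cases
    case 1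
    show ?thesis by (rule step[of p, OF _ _ refl]) (use 1 d less.prems in auto)
  next
    case 2
    show ?thesis by (rule step[of s, OF _ _ refl]) (use 2 d less.prems in auto)
  next
    case 3
    show ?thesis by (rule step[of r, OF _ _ refl]) (use 3 d less.prems in auto)
  next
    case 4
    then show ?thesis by (rule f_form_exchange_base[OF psr])
  qed
qed

lemma f_form_indep:
  assumes "{G1, p, s, r} = UNIV" "{G1, p', s', r'} = UNIV" "c r \<ge> 1" "c r' \<ge> 1"
  shows "f_form k c p s r = f_form k c p' s' r'"
proof -
  have "f_form k c x y r' = f_form k c p' s' r'" if "{G1, x, y, r'} = UNIV" for x y
  proof -
    have "x \<in> {G1, p', s', r'}" "y \<in> {G1, p', s', r'}" using assms(2) by simp_all
    then have "x = p' \<and> y = s' \<or> x = s' \<and> y = p'" using that by (auto simp: UNIV_idx_iff)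
    then show ?thesis using f_form_swap[OF assms(2), of k c] by auto
  qed
  note * = this
  have "r' \<in> {G1, p, s, r}" using assms(1) by simp
  then consider "r' = r" | "r' = s" | "r' = p" using assms(2) by (auto simp: UNIV_idx_iff)
  then show ?thesis
  proof cases
    case 1 then show ?thesis using *[of p s] assms by simp
  next
    case 2
    then have "f_form k c p s r = f_form k c p r s" using f_form_exchange[OF assms(1)] assms by simp
    then show ?thesis using *[of p r] labels_perm(1)[OF assms(1)] 2 by simp
  next
    case 3
    have l: "{G1, s, p, r} = UNIV" by (rule labels_perm(2)[OF assms(1)])
    have "f_form k c p s r = f_form k c s p r" by (rule f_form_swap[OF assms(1)])
    also have "\<dots> = f_form k c s r p" using f_form_exchange[OF l] assms 3 by simp
    finally show ?thesis using *[of s r] labels_perm(1)[OF l] 3 by simp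
  qed
qed

text \<open>The value of $f_{\alpha0}$ in terms of the end index and the exponents. Any labelling with a positive
last exponent gives the same result by \<open>f_form_indep\<close>; the one chosen here is arbitrary.\<close>

definition f_elem :: "idx \<Rightarrow> (idx \<Rightarrow> nat) \<Rightarrow> d4" where
  "f_elem k c = (if c G4 \<ge> 1 then f_form k c G2 G3 G4 else if c G3 \<ge> 1 then f_form k c G2 G4 G3
     else if c G2 \<ge> 1 then f_form k c G3 G4 G2 else e k \<sqinter> Sup_fin (e ` (- {k})))"

lemma f_elem_eq:
  assumes "{G1, p, s, r} = UNIV" "c r \<ge> 1"
  shows "f_elem k c = f_form k c p s r"
proof -
  have l: "{G1, G2, G3, G4} = UNIV" "{G1, G2, G4, G3} = UNIV" "{G1, G3, G4, G2} = UNIV"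
    by (auto simp: UNIV_idx)
  have "r \<noteq> G1" using assms by (auto simp: UNIV_idx_iff)
  then have "c G4 \<ge> 1 \<or> c G3 \<ge> 1 \<or> c G2 \<ge> 1" using assms(2) by (cases r) auto
  then show ?thesis unfolding f_elem_def
    using f_form_indep[OF assms(1) l(1), of c k] f_form_indep[OF assms(1) l(2), of c k]
      f_form_indep[OF assms(1) l(3), of c k] assms(2) by auto
qed

lemma compl_single:
  assumes "{k, m, a, b} = (UNIV :: idx set)"
  shows "- {k} = {m, a, b}"
proof -
  have "- {k} = {k, m, a, b} - {k}" using assms by auto
  also have "\<dots> = {m, a, b}" using assms unfolding UNIV_idx_iff by auto
  finally show ?thesis .
qed

text \<open>Evaluating $\gamma(e_k(e_m+e_a+e_b))$ means adding the three elements $e_mq$, $e_aq$, $e_bq$ with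
$q=(e_k+e_m)(e_a+e_b)$; \<open>sup_of_meets\<close> does this one summand at a time.\<close>

lemma gamma_f_elem_base:
  assumes psr: "{G1, p, s, r} = UNIV"
  shows "gamma G1 r (e k \<sqinter> Sup_fin (e ` (- {k}))) = f_form k ((\<lambda>_. 0)(r := 1)) p s r"
proof -
  define m a b where "m = k \<oplus> r" and "a = k \<oplus> p" and "b = k \<oplus> s"
  have psr': "p = k \<oplus> a" "s = k \<oplus> b" "r = k \<oplus> m" by (simp_all add: a_def b_def m_def)
  have kmab: "{k, m, a, b} = UNIV"
    using labels_kadd[OF psr, of k] by (simp add: a_def b_def m_def insert_commute)
  have l: "{k, a, m, b} = UNIV" "{k, b, m, a} = UNIV" "{a, b, k, m} = UNIV" "{m, b, k, a} = UNIV"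
      "{m, a, k, b} = UNIV"
    using kmab by (simp_all add: insert_commute)
  have P: "e_elem k ((\<lambda>_. 0)(p := Suc 0)) = e k \<sqinter> (e m \<squnion> e b)"
    using e_elem_single[OF l(1), of 1] atomic_Suc[OF l(4), of 0] by (simp add: psr')
  have S: "e_elem k ((\<lambda>_. 0)(s := Suc 0)) = e k \<sqinter> (e m \<squnion> e a)"
    using e_elem_single[OF l(2), of 1] atomic_Suc[OF l(5), of 0] by (simp add: psr')
  have R: "e_elem k ((\<lambda>_. 0)(r := Suc 0)) = e k \<sqinter> (e a \<squnion> e b)"
    using e_elem_single[OF kmab, of 1] atomic_Suc[OF l(3), of 0] by (simp add: psr')
  have "k \<noteq> m" using kmab by (simp add: UNIV_idx_iff)
  then have g: "gamma G1 r = gamma k m" using gamma_kadd[of k m] by (simp add: psr')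
  define u v where "u = e k \<squnion> e m" and "v = e a \<squnion> e b"
  define Z where "Z = e m \<squnion> e k \<sqinter> (e m \<squnion> e a)"
  have q: "q k m = u \<sqinter> v" unfolding u_def v_def by (rule q_eq[OF kmab])
  have em: "e m \<sqinter> q k m = e m \<sqinter> v" unfolding q u_def by (simp add: inf_absorb1 flip: inf_assoc)
  have ea: "e a \<sqinter> q k m = e a \<sqinter> u"
    unfolding q v_def by (simp add: inf_absorb1 inf_commute[of u] flip: inf_assoc)
  have eb: "e b \<sqinter> q k m = e b \<sqinter> u"
    unfolding q v_def by (simp add: inf_absorb1 inf_commute[of u] flip: inf_assoc)
  have "gamma k m (e k \<sqinter> Sup_fin (e ` (- {k}))) =
      e k \<sqinter> q k m \<sqinter> (e m \<sqinter> q k m \<squnion> e a \<sqinter> q k m \<squnion> e b \<sqinter> q k m)"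
    unfolding compl_single[OF kmab] by (simp add: sup_assoc)
  also have "e m \<sqinter> q k m \<squnion> e a \<sqinter> q k m = (e m \<squnion> e a) \<sqinter> (u \<sqinter> v)"
    unfolding em ea by (rule sup_of_meets) (simp_all add: u_def v_def)
  also have "(e m \<squnion> e a) \<sqinter> (u \<sqinter> v) = Z \<sqinter> v"
  proof -
    have "(e m \<squnion> e a) \<sqinter> u = Z"
      unfolding Z_def u_def using modular_inf_sup[of "e m" "e m \<squnion> e a" "e k"]
      by (simp add: sup_commute inf_commute)
    then show ?thesis by (simp add: inf_assoc flip: inf_assoc)
  qed
  also have "Z \<sqinter> v \<squnion> e b \<sqinter> q k m = (Z \<squnion> e b) \<sqinter> (u \<sqinter> v)"
    unfolding eb by (rule sup_of_meets) (simp_all add: u_def v_def Z_def le_infI1)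
  also have "e k \<sqinter> q k m \<sqinter> ((Z \<squnion> e b) \<sqinter> (u \<sqinter> v)) = v \<sqinter> (e k \<sqinter> (Z \<squnion> e b))"
    unfolding q u_def by (rule antisym) (auto intro: le_infI1 le_infI2 le_supI1)
  also have "e k \<sqinter> (Z \<squnion> e b) = e k \<sqinter> (e m \<squnion> e a) \<squnion> e k \<sqinter> (e m \<squnion> e b)"
    using modular_inf_sup[of "e k \<sqinter> (e m \<squnion> e a)" "e k" "e m \<squnion> e b"]
    by (simp add: Z_def ac_simps)
  also have "v \<sqinter> (e k \<sqinter> (e m \<squnion> e a) \<squnion> e k \<sqinter> (e m \<squnion> e b)) =
      e k \<sqinter> v \<sqinter> (e k \<sqinter> (e m \<squnion> e b) \<squnion> e k \<sqinter> (e m \<squnion> e a))" (is "v \<sqinter> ?w = _")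
  proof -
    have "?w \<le> e k" by simp
    then have "?w = e k \<sqinter> ?w" by (simp add: inf_absorb2)
    then show ?thesis by (metis inf_assoc inf_commute sup_commute)
  qed
  also have "\<dots> = f_form k ((\<lambda>_. 0)(r := 1)) p s r"
  proof -
    have "p \<noteq> r" "s \<noteq> r" using psr by (auto simp: UNIV_idx_iff)
    moreover have "(\<lambda>_. 0)(s := Suc 0, r := 0) = (\<lambda>_. 0::nat)(s := Suc 0)"
      using psr by (auto simp: UNIV_idx_iff fun_eq_iff)
    ultimately show ?thesis unfolding f_form_def by (simp add: P S R v_def)
  qed
  finally show ?thesis using g by simp
qed

lemma gamma_f_elem:
  assumes "t \<noteq> G1"
  shows "gamma G1 t (f_elem k c) = f_elem k (c(t := Suc (c t)))"
proof (cases "\<exists>r. r \<noteq> G1 \<and> c r \<ge> 1")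
  case True
  then obtain r where r: "r \<noteq> G1" "c r \<ge> 1" by blast
  then obtain p s where "{G1, r, p, s} = UNIV" using four_labels[of G1 r] by metis
  then have psr: "{G1, p, s, r} = UNIV" by (simp add: insert_commute)
  show ?thesis
    using f_elem_eq[OF psr, of c] f_elem_eq[OF psr, of "c(t := Suc (c t))"] gamma_f_form[OF psr] assms r
    by simp
next
  case False
  then have 0: "c r = 0" if "r \<noteq> G1" for r using that False by auto
  obtain p s where "{G1, t, p, s} = UNIV" using assms four_labels[of G1 t] by metis
  then have psr: "{G1, p, s, t} = UNIV" by (simp add: insert_commute)
  then have d: "p \<noteq> t" "s \<noteq> t" "p \<noteq> G1" "s \<noteq> G1" by (auto simp: UNIV_idx_iff)
  have "f_elem k (c(t := Suc (c t))) = f_form k (c(t := Suc (c t))) p s t"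
    by (rule f_elem_eq[OF psr]) simp
  also have "\<dots> = f_form k ((\<lambda>_. 0)(t := 1)) p s t"
    by (rule f_form_cong[OF psr]) (use 0 d assms in auto)
  finally show ?thesis using gamma_f_elem_base[OF psr, of k] 0 by (simp add: f_elem_def)
qed

section \<open>Admissible sequences\<close>

text \<open>The partitions of consecutive entries, the invariant form of a sequence.\<close>

fun letters :: "idx list \<Rightarrow> idx list" where
  "letters (x # y # zs) = (x \<oplus> y) # letters (y # zs)"
| "letters _ = []"

fun path :: "idx \<Rightarrow> idx list \<Rightarrow> idx list" where
  "path k [] = [k]"
| "path k (p # ps) = k # path (k \<oplus> p) ps"

definition cnt :: "idx list \<Rightarrow> idx \<Rightarrow> nat" where
  "cnt \<alpha> = count (mset (letters \<alpha>))"

lemma cnt_simps [simp]: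
  "cnt [x] = (\<lambda>_. 0)"
  "cnt (x # y # zs) = (cnt (y # zs))(x \<oplus> y := Suc (cnt (y # zs) (x \<oplus> y)))"
  by (auto simp: cnt_def fun_eq_iff)

lemma path_letters: "\<alpha> \<noteq> [] \<Longrightarrow> path (hd \<alpha>) (letters \<alpha>) = \<alpha>"
  by (induction \<alpha> rule: letters.induct) auto

lemma G1_notin_letters: "distinct_adj \<alpha> \<Longrightarrow> G1 \<notin> set (letters \<alpha>)"
  by (induction \<alpha> rule: letters.induct) (auto simp: eq_commute[of G1])

lemma cnt_G1: "admissible \<alpha> \<Longrightarrow> cnt \<alpha> G1 = 0"
  using G1_notin_letters by (simp add: cnt_def admissible_def count_eq_zero_iff)

lemma cnt_append: "cnt (u @ x # v) p = cnt (u @ [x]) p + cnt (x # v) p"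
proof (induction u)
  case (Cons a u)
  then show ?case by (cases u) auto
qed simp

text \<open>The step replaces the letters \<open>i \<oplus> j\<close>, \<open>j \<oplus> l\<close> by \<open>i \<oplus> k = j \<oplus> l\<close>, \<open>k \<oplus> l = i \<oplus> j\<close>.\<close>

lemma adm_step_invariant:
  assumes "adm_step \<alpha> \<beta>"
  shows "hd \<alpha> = hd \<beta> \<and> last \<alpha> = last \<beta> \<and> cnt \<alpha> = cnt \<beta>"
  using assms
proof cases
  case (1 i j k l u v)
  have c: "k \<oplus> l = i \<oplus> j" using kadd_complement[OF 1(3)] .
  have "{i, k, j, l} = UNIV" by (rule labels_perm(2)[OF 1(3)])
  then have c': "j \<oplus> l = i \<oplus> k" using kadd_complement by blast
  have "cnt (u @ i # j # l # v) p = cnt (u @ i # k # l # v) p" for p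
    by (simp only: cnt_append[of u i "j # l # v"] cnt_append[of u i "k # l # v"])
      (auto simp: c c')
  then show ?thesis using 1 by (cases u) (auto simp: fun_eq_iff)
qed

lemma adm_steps_invariant:
  assumes "adm_step\<^sup>*\<^sup>* \<alpha> \<beta>"
  shows "hd \<alpha> = hd \<beta> \<and> last \<alpha> = last \<beta> \<and> cnt \<alpha> = cnt \<beta>"
  using assms by (induction rule: rtranclp_induct) (simp_all add: adm_step_invariant)

lemma adm_step_Cons: "adm_step \<alpha> \<beta> \<Longrightarrow> adm_step (x # \<alpha>) (x # \<beta>)"
proof (induction rule: adm_step.induct)
  case (1 i j k l u v)
  from adm_step.intros[OF this, of "x # u" v] show ?case by simp
qed

lemma adm_steps_Cons: "adm_step\<^sup>*\<^sup>* \<alpha> \<beta> \<Longrightarrow> adm_step\<^sup>*\<^sup>* (x # \<alpha>) (x # \<beta>)"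
  by (induction rule: rtranclp_induct) (auto intro: adm_step_Cons rtranclp.rtrancl_into_rtrancl)

text \<open>The converse: every transposition of different neighbouring letters is an admissible step.\<close>

lemma path_swap:
  assumes "a \<noteq> G1" "b \<noteq> G1" "a \<noteq> b"
  shows "adm_step (path k (a # b # w)) (path k (b # a # w))"
proof -
  have l: "{k, k \<oplus> a, k \<oplus> b, k \<oplus> a \<oplus> b} = UNIV"
    unfolding UNIV_idx_iff using assms by (cases a; cases b; cases k) simp_all
  define v where "v = tl (path (k \<oplus> a \<oplus> b) w)"
  have v: "path (k \<oplus> a \<oplus> b) w = (k \<oplus> a \<oplus> b) # v"
    unfolding v_def by (cases w) simp_all
  have "k \<oplus> b \<oplus> a = k \<oplus> a \<oplus> b" by (metis kadd_assoc kadd_comm)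
  then show ?thesis using adm_step.intros[OF l, of "[]" v] by (simp add: v)
qed

lemma path_move:
  assumes "G1 \<notin> set (y @ x # z)"
  shows "adm_step\<^sup>*\<^sup>* (path k (y @ x # z)) (path k (x # y @ z))"
  using assms
proof (induction y arbitrary: k)
  case (Cons a y)
  have "adm_step\<^sup>*\<^sup>* (path k ((a # y) @ x # z)) (path k (a # x # y @ z))"
    using Cons.IH[of "k \<oplus> a"] Cons.prems by (auto intro: adm_steps_Cons)
  also have "adm_step\<^sup>*\<^sup>* (path k (a # x # y @ z)) (path k (x # a # y @ z))"
  proof (cases "a = x")
    case False
    then show ?thesis using Cons.prems path_swap[of a x k "y @ z"] by auto
  qed simp
  finally show ?case by simp
qed simp

lemma path_perm:
  assumes "mset xs = mset ys" "G1 \<notin> set xs"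
  shows "adm_step\<^sup>*\<^sup>* (path k ys) (path k xs)"
  using assms
proof (induction xs arbitrary: k ys)
  case (Cons x xs)
  then have "x \<in> set ys" by (metis list.set_intros(1) mset_eq_setD)
  then obtain y z where ys: "ys = y @ x # z" by (meson split_list)
  have "G1 \<notin> set ys" using Cons.prems mset_eq_setD by metis
  then have "adm_step\<^sup>*\<^sup>* (path k ys) (path k (x # y @ z))"
    unfolding ys by (rule path_move)
  also have "adm_step\<^sup>*\<^sup>* (path k (x # y @ z)) (path k (x # xs))"
    using Cons.IH[of "y @ z" "k \<oplus> x"] Cons.prems ys by (auto intro: adm_steps_Cons)
  finally show ?case .
qed simp

text \<open>Sequences with the same end and the same letters up to order are connected by transpositions of
neighbouring letters.\<close>

lemma adm_steps_complete:
  assumes "admissible \<alpha>" "admissible \<beta>" "hd \<alpha> = hd \<beta>" "cnt \<alpha> = cnt \<beta>"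
  shows "adm_step\<^sup>*\<^sup>* \<alpha> \<beta>"
proof -
  have "mset (letters \<beta>) = mset (letters \<alpha>)"
    using assms(4) by (intro multiset_eqI) (simp add: cnt_def)
  moreover have "G1 \<notin> set (letters \<beta>)"
    using assms(2) G1_notin_letters by (simp add: admissible_def)
  ultimately have "adm_step\<^sup>*\<^sup>* (path (hd \<beta>) (letters \<alpha>)) (path (hd \<beta>) (letters \<beta>))"
    by (rule path_perm)
  moreover have "path (hd \<beta>) (letters \<alpha>) = \<alpha>"
    using path_letters[of \<alpha>] assms by (simp add: admissible_def)
  moreover have "path (hd \<beta>) (letters \<beta>) = \<beta>"
    using path_letters[of \<beta>] assms by (simp add: admissible_def)
  ultimately show ?thesis by simp
qed

text \<open>The sum in the four-group of all letters, to which only odd multiplicities contribute.\<close>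

definition net_shift :: "(idx \<Rightarrow> nat) \<Rightarrow> idx" where
  "net_shift c = (if odd (c G2) then G2 else G1) \<oplus> (if odd (c G3) then G3 else G1) \<oplus>
     (if odd (c G4) then G4 else G1)"

lemma net_shift_upd: "net_shift (c(p := Suc (c p))) = p \<oplus> net_shift c"
  by (cases p) (simp_all add: net_shift_def)

lemma last_eq_kadd_net_shift: "\<alpha> \<noteq> [] \<Longrightarrow> last \<alpha> = hd \<alpha> \<oplus> net_shift (cnt \<alpha>)"
proof (induction \<alpha> rule: letters.induct)
  case (1 x y zs)
  have "last (x # y # zs) = last (y # zs)" by simp
  also have "\<dots> = y \<oplus> net_shift (cnt (y # zs))" using 1 by simp
  also have "\<dots> = x \<oplus> net_shift (cnt (x # y # zs))"
    unfolding cnt_simps net_shift_upd by (simp add: kadd_assoc)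
  finally show ?case by (simp only: list.sel)
qed (simp_all add: net_shift_def)

lemma alt_0 [simp]: "alt 0 x y = []"
  by (simp add: alt_def)

lemma alt_Suc [simp]: "alt (Suc t) x y = x # y # alt t x y"
  by (simp add: alt_def)

lemma alt_shift: "alt (Suc t) x y @ w = x # alt t y x @ y # w"
  by (induction t) simp_all

lemma cnt_alt:
  assumes "x \<noteq> G1"
  shows "cnt (G1 # alt t x G1 @ w) = (\<lambda>p. cnt (G1 # w) p + (if p = x then 2 * t else 0))"
  using assms by (induction t) (auto simp: fun_eq_iff)

lemma distinct_adj_alt:
  assumes "x \<noteq> G1"
  shows "distinct_adj (G1 # alt t x G1 @ w) \<longleftrightarrow> distinct_adj (G1 # w)"
  using assms by (induction t) auto

lemma alt_eq_Nil [simp]: "alt t x y = [] \<longleftrightarrow> t = 0"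
  by (cases t) simp_all

lemma last_alt: "last (alt t x y) = (if t = 0 then last [] else y)"
  by (induction t) simp_all

lemmas alt_facts = cnt_alt distinct_adj_alt last_alt
  cnt_alt[where w = "[]", simplified] distinct_adj_alt[where w = "[]", simplified]

abbreviation counts :: "nat \<Rightarrow> nat \<Rightarrow> nat \<Rightarrow> idx \<Rightarrow> nat" where
  "counts a b c \<equiv> (\<lambda>_. 0)(G2 := a, G3 := b, G4 := c)"

text \<open>The table of admissible elements starting at 1, indexed by end and multiplicities. For each end, the
requirement that the sequence starts at 1 leaves two parity patterns, which are the two rows of the
table with that end.\<close>

fun table_expr :: "idx \<Rightarrow> (idx \<Rightarrow> nat) \<Rightarrow> idx aexpr" where
  "table_expr G1 c = (if even (c G2) then AE G1 (G2, G4, c G3) (G3, G4, c G2) (G3, G2, c G4)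
     else AE G1 (G2, G3, c G4) (G2, G4, c G3) (G3, G4, c G2))"
| "table_expr G2 c = (if odd (c G2) then AE G2 (G3, G1, c G3) (G4, G1, c G4) (G3, G4, c G2)
     else AE G2 (G3, G4, c G2) (G3, G1, c G3) (G1, G4, c G4))"
| "table_expr G3 c = (if odd (c G3) then AE G3 (G2, G1, c G2) (G4, G1, c G4) (G2, G4, c G3)
     else AE G3 (G2, G4, c G3) (G2, G1, c G2) (G1, G4, c G4))"
| "table_expr G4 c = (if odd (c G4) then AE G4 (G2, G1, c G2) (G3, G1, c G3) (G3, G2, c G4)
     else AE G4 (G3, G2, c G4) (G3, G1, c G3) (G1, G2, c G2))"

definition table_row :: "idx list \<Rightarrow> idx \<Rightarrow> (idx \<Rightarrow> nat) \<Rightarrow> bool" where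
  "table_row \<beta> k c \<longleftrightarrow> hd \<beta> = k \<and> cnt \<beta> = c \<and> last \<beta> = G1 \<and> admissible \<beta>"

text \<open>The exponents that occur in a row of the table are the multiplicities of the three letters. The
positive parameters are written as successors.\<close>

lemma rows:
  "table_row (alt (Suc t) G2 G1 @ alt r G4 G1 @ alt s G3 G1) G2 (counts (2 * t + 1) (2 * s) (2 * r))"
  "table_row (alt (Suc s) G3 G1 @ alt r G4 G1 @ alt t G2 G1) G3 (counts (2 * t) (2 * s + 1) (2 * r))"
  "table_row (alt (Suc r) G4 G1 @ alt s G3 G1 @ alt t G2 G1) G4 (counts (2 * t) (2 * s) (2 * r + 1))"
  "table_row ([G1] @ alt r G4 G1 @ alt s G3 G1 @ alt t G2 G1) G1 (counts (2 * t) (2 * s) (2 * r))"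
  "table_row ([G2] @ alt (Suc r) G4 G1 @ alt s G3 G1 @ alt t G2 G1) G2
     (counts (2 * t) (2 * s + 1) (2 * r + 1))"
  "table_row ([G3] @ alt (Suc r) G4 G1 @ alt t G2 G1 @ alt s G3 G1) G3
     (counts (2 * t + 1) (2 * s) (2 * r + 1))"
  "table_row ([G4] @ alt (Suc t) G2 G1 @ alt s G3 G1 @ alt r G4 G1) G4
     (counts (2 * t + 1) (2 * s + 1) (2 * r))"
  "table_row (alt (Suc r) G1 G4 @ alt (Suc s) G3 G1 @ alt t G2 G1) G1
     (counts (2 * t + 1) (2 * s + 1) (2 * r + 1))"
  unfolding table_row_def alt_shift[of r G1 G4] by (auto simp: alt_facts last_append admissible_def fun_eq_iff)

lemma adm_table_eq_table_expr:
  assumes "adm_table \<beta> w"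
  shows "last \<beta> = G1 \<and> admissible \<beta> \<and> w = table_expr (hd \<beta>) (cnt \<beta>)"
  using assms
proof cases
  case (1 t r s) then show ?thesis using rows(1)[of "t - 1" r s] by (auto simp: table_row_def)
next
  case (2 s r t) then show ?thesis using rows(2)[of "s - 1" r t] by (auto simp: table_row_def)
next
  case (3 r s t) then show ?thesis using rows(3)[of "r - 1" s t] by (auto simp: table_row_def)
next
  case (4 r s t) then show ?thesis using rows(4)[of r s t] by (auto simp: table_row_def)
next
  case (5 r s t) then show ?thesis using rows(5)[of "r - 1" s t] by (auto simp: table_row_def)
next
  case (6 r t s) then show ?thesis using rows(6)[of "r - 1" t s] by (auto simp: table_row_def)
next
  case (7 t s r) then show ?thesis using rows(7)[of "t - 1" s r] by (auto simp: table_row_def)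
next
  case (8 r s t) then show ?thesis using rows(8)[of "r - 1" "s - 1" t] by (auto simp: table_row_def)
qed

text \<open>The parities of the three multiplicities select the row.\<close>

lemma adm_table_exists:
  assumes "c G1 = 0"
  shows "\<exists>\<beta> w. adm_table \<beta> w \<and> hd \<beta> = net_shift c \<and> cnt \<beta> = c"
proof -
  define a b d where "a = c G2 div 2" and "b = c G3 div 2" and "d = c G4 div 2"
  have c: "c = counts (2 * a + c G2 mod 2) (2 * b + c G3 mod 2) (2 * d + c G4 mod 2)"
    using assms by (auto simp: fun_eq_iff idx_all a_def b_def d_def)
  have res: ?thesis if "adm_table \<beta> w" "table_row \<beta> k v" "net_shift c = k" "c = v" for \<beta> w k v
    using that by (auto simp: table_row_def)
  show ?thesis
  proof (cases "even (c G2)"; cases "even (c G3)"; cases "even (c G4)")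
    assume *: "even (c G2)" "even (c G3)" "even (c G4)"
    then have "c = counts (2 * a) (2 * b) (2 * d)"
      using c by (simp add: mod_2_eq_odd)
    then show ?thesis
      by (intro res[OF adm_table.intros(4) rows(4)[of d b a]]) (use * in \<open>simp_all add: net_shift_def\<close>)
  next
    assume *: "even (c G2)" "even (c G3)" "odd (c G4)"
    then have "c = counts (2 * a) (2 * b) (2 * d + 1)"
      using c by (simp add: mod_2_eq_odd)
    then show ?thesis
      by (intro res[OF adm_table.intros(3) rows(3)[of d b a]]) (use * in \<open>simp_all add: net_shift_def\<close>)
  next
    assume *: "even (c G2)" "odd (c G3)" "even (c G4)"
    then have "c = counts (2 * a) (2 * b + 1) (2 * d)"
      using c by (simp add: mod_2_eq_odd)
    then show ?thesis
      by (intro res[OF adm_table.intros(2) rows(2)[of b d a]]) (use * in \<open>simp_all add: net_shift_def\<close>)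
  next
    assume *: "even (c G2)" "odd (c G3)" "odd (c G4)"
    then have "c = counts (2 * a) (2 * b + 1) (2 * d + 1)"
      using c by (simp add: mod_2_eq_odd)
    then show ?thesis
      by (intro res[OF adm_table.intros(5) rows(5)[of d b a]]) (use * in \<open>simp_all add: net_shift_def\<close>)
  next
    assume *: "odd (c G2)" "even (c G3)" "even (c G4)"
    then have "c = counts (2 * a + 1) (2 * b) (2 * d)"
      using c by (simp add: mod_2_eq_odd)
    then show ?thesis
      by (intro res[OF adm_table.intros(1) rows(1)[of a d b]]) (use * in \<open>simp_all add: net_shift_def\<close>)
  next
    assume *: "odd (c G2)" "even (c G3)" "odd (c G4)"
    then have "c = counts (2 * a + 1) (2 * b) (2 * d + 1)"
      using c by (simp add: mod_2_eq_odd)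
    then show ?thesis
      by (intro res[OF adm_table.intros(6) rows(6)[of d a b]]) (use * in \<open>simp_all add: net_shift_def\<close>)
  next
    assume *: "odd (c G2)" "odd (c G3)" "even (c G4)"
    then have "c = counts (2 * a + 1) (2 * b + 1) (2 * d)"
      using c by (simp add: mod_2_eq_odd)
    then show ?thesis
      by (intro res[OF adm_table.intros(7) rows(7)[of a b d]]) (use * in \<open>simp_all add: net_shift_def\<close>)
  next
    assume *: "odd (c G2)" "odd (c G3)" "odd (c G4)"
    then have "c = counts (2 * a + 1) (2 * b + 1) (2 * d + 1)"
      using c by (simp add: mod_2_eq_odd)
    then show ?thesis
      by (intro res[OF adm_table.intros(8) rows(8)[of d b a]]) (use * in \<open>simp_all add: net_shift_def\<close>)
  qed
qed


text \<open>The effect on partitions of interchanging the indices 1 and \<open>m\<close>: the partition that contains the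
pair of 1 and \<open>m\<close> is fixed, the other two are exchanged.\<close>

definition relabel :: "idx \<Rightarrow> idx \<Rightarrow> idx" where
  "relabel m p = (if p = G1 \<or> m = G1 \<or> p = m then p else p \<oplus> m)"

lemma kadd_transpose: "transpose G1 m x \<oplus> transpose G1 m y = relabel m (x \<oplus> y)"
  by (cases m; cases x; cases y) (simp_all add: transpose_def relabel_def)

lemma relabel_invol [simp]: "relabel m (relabel m p) = p"
  by (cases m; cases p) (simp_all add: relabel_def)

lemma relabel_G1 [simp]: "relabel m G1 = G1"
  by (simp add: relabel_def)

lemma relabel_eq_iff [simp]: "relabel m p = relabel m p' \<longleftrightarrow> p = p'"
  by (metis relabel_invol)

lemma cnt_transpose: "\<alpha> \<noteq> [] \<Longrightarrow> cnt (map (transpose G1 m) \<alpha>) (relabel m p) = cnt \<alpha> p"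
proof (induction \<alpha> rule: letters.induct)
  case (1 x y zs)
  have "cnt (map (transpose G1 m) (x # y # zs)) (relabel m p) =
     cnt (map (transpose G1 m) (y # zs)) (relabel m p) + (if p = x \<oplus> y then 1 else 0)"
    by (simp add: kadd_transpose)
  then show ?case using 1 by simp
qed simp_all

lemma map_transpose_invol [simp]: "map (transpose G1 m) (map (transpose G1 m) \<alpha>) = \<alpha>"
  by (simp add: transpose_comp_involutory)

lemma adm_step_map:
  assumes "adm_step \<alpha> \<beta>"
  shows "adm_step (map (transpose G1 m) \<alpha>) (map (transpose G1 m) \<beta>)"
  using assms
proof cases
  case (1 i j k l u v)
  have "transpose G1 m ` {i, j, k, l} = UNIV" unfolding 1(3) by (rule surj_transpose)
  then have "{transpose G1 m i, transpose G1 m j, transpose G1 m k, transpose G1 m l} = UNIV"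
    by simp
  from adm_step.intros[OF this, of "map (transpose G1 m) u" "map (transpose G1 m) v"]
  show ?thesis unfolding 1 by simp
qed

lemma adm_steps_map:
  "adm_step\<^sup>*\<^sup>* \<alpha> \<beta> \<Longrightarrow> adm_step\<^sup>*\<^sup>* (map (transpose G1 m) \<alpha>) (map (transpose G1 m) \<beta>)"
  by (induction rule: rtranclp_induct) (auto intro: adm_step_map rtranclp.rtrancl_into_rtrancl)

lemma admissible_map: "admissible \<alpha> \<Longrightarrow> admissible (map (transpose G1 m) \<alpha>)"
  by (auto simp: admissible_def intro!: distinct_adj_mapI inj_on_transpose)

text \<open>The start \<open>m\<close> of \<open>\<alpha>\<close> is the only possible index to interchange with 1. Afterwards the row of the
table is forced, since end and multiplicities are invariant, and it is reachable since they are
complete invariants.\<close>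

lemma adm_expr_eq:
  fixes \<alpha>
  assumes "admissible \<alpha>"
  defines "m \<equiv> last \<alpha>"
  defines "\<alpha>' \<equiv> map (transpose G1 m) \<alpha>"
  shows "adm_expr \<alpha> = map_aexpr (transpose G1 m) (table_expr (hd \<alpha>') (cnt \<alpha>'))"
  unfolding adm_expr_def
proof (rule the_equality)
  have ne: "\<alpha> \<noteq> []" using assms(1) by (simp add: admissible_def)
  have adm': "admissible \<alpha>'" unfolding \<alpha>'_def by (rule admissible_map[OF assms(1)])
  have l: "last \<alpha>' = G1" using ne by (simp add: \<alpha>'_def m_def last_map)
  have inv: "map (transpose G1 m) \<alpha>' = \<alpha>" unfolding \<alpha>'_def by (rule map_transpose_invol)
  have "hd \<alpha>' = net_shift (cnt \<alpha>')"
    using last_eq_kadd_net_shift[of \<alpha>'] l adm' by (metis admissible_def kadd_eq_G1)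
  then obtain \<beta> w where b: "adm_table \<beta> w" "hd \<beta> = hd \<alpha>'" "cnt \<beta> = cnt \<alpha>'"
    using adm_table_exists[of "cnt \<alpha>'"] cnt_G1[OF adm'] by auto
  have c: "admissible \<beta>" "w = table_expr (hd \<alpha>') (cnt \<alpha>')"
    using adm_table_eq_table_expr[OF b(1)] b by auto
  have "adm_step\<^sup>*\<^sup>* \<alpha>' \<beta>"
    using adm_steps_complete[OF adm' c(1)] b by simp
  from adm_steps_map[OF this, of m] have "adm_step\<^sup>*\<^sup>* \<alpha> (map (transpose G1 m) \<beta>)"
    unfolding inv .
  then show "\<exists>m' \<beta> w'. adm_table \<beta> w' \<and> adm_step\<^sup>*\<^sup>* \<alpha> (map (transpose G1 m') \<beta>) \<and>
      map_aexpr (transpose G1 m) (table_expr (hd \<alpha>') (cnt \<alpha>')) = map_aexpr (transpose G1 m') w'"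
    using b(1) c(2) by blast
next
  fix v
  assume "\<exists>m' \<beta> w'. adm_table \<beta> w' \<and> adm_step\<^sup>*\<^sup>* \<alpha> (map (transpose G1 m') \<beta>) \<and>
      v = map_aexpr (transpose G1 m') w'"
  then obtain m' \<beta> w' where b: "adm_table \<beta> w'"
    "adm_step\<^sup>*\<^sup>* \<alpha> (map (transpose G1 m') \<beta>)" "v = map_aexpr (transpose G1 m') w'"
    by blast
  have c: "last \<beta> = G1" "\<beta> \<noteq> []" "w' = table_expr (hd \<beta>) (cnt \<beta>)"
    using adm_table_eq_table_expr[OF b(1)] by (auto simp: admissible_def)
  have m: "m' = m"
    using adm_steps_invariant[OF b(2)] c by (simp add: m_def last_map)
  from adm_steps_map[OF b(2), of m] have "adm_step\<^sup>*\<^sup>* \<alpha>' \<beta>"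
    unfolding m \<alpha>'_def map_transpose_invol .
  from adm_steps_invariant[OF this] show "v = map_aexpr (transpose G1 m) (table_expr (hd \<alpha>') (cnt \<alpha>'))"
    using b(3) c(3) m by simp
qed

text \<open>The atomic factors, without the order of the factors and of their upper indices; this is exactly
what \<^const>\<open>labelled_as\<close> looks at.\<close>

fun terms :: "'i aexpr \<Rightarrow> ('i set \<times> nat) set" where
  "terms (AE i (j1, k1, n1) (j2, k2, n2) (j3, k3, n3)) =
     {({j1, k1}, n1), ({j2, k2}, n2), ({j3, k3}, n3)}"

fun base :: "'i aexpr \<Rightarrow> 'i" where
  "base (AE i _ _ _) = i"

text \<open>The expression denotes \<open>e_elem k c\<close>, up to the order of factors and of upper indices.\<close>

definition has_shape :: "idx aexpr \<Rightarrow> idx \<Rightarrow> (idx \<Rightarrow> nat) \<Rightarrow> bool" where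
  "has_shape w k c \<longleftrightarrow> base w = k \<and> terms w = (\<lambda>p. (- {k, k \<oplus> p}, c p)) ` {G2, G3, G4}"

lemma has_shape_table_expr: "has_shape (table_expr k c) k c"
proof -
  have "- {G1, G2} = {G3, G4}" "- {G1, G3} = {G2, G4}" "- {G1, G4} = {G2, G3}"
    "- {G2, G1} = {G3, G4}" "- {G2, G3} = {G1, G4}" "- {G2, G4} = {G1, G3}"
    "- {G3, G1} = {G2, G4}" "- {G3, G2} = {G1, G4}" "- {G3, G4} = {G1, G2}"
    "- {G4, G1} = {G2, G3}" "- {G4, G2} = {G1, G3}" "- {G4, G3} = {G1, G2}"
    by (rule compl_pair, simp add: UNIV_idx_iff)+
  then show ?thesis
    unfolding has_shape_def by (cases k) (simp_all add: insert_commute)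
qed

lemma terms_map: "terms (map_aexpr f w) = map_prod (image f) id ` terms w"
  by (cases w rule: terms.cases) simp

lemma base_map: "base (map_aexpr f w) = f (base w)"
  by (cases w) simp

lemma has_shape_map:
  assumes "has_shape w k d" "\<And>p. d (relabel m p) = c p"
  shows "has_shape (map_aexpr (transpose G1 m) w) (transpose G1 m k) c"
proof -
  let ?t = "transpose G1 m"
  have im: "?t ` (- {k, k \<oplus> p}) = - {?t k, ?t k \<oplus> relabel m p}" for p
  proof -
    have "?t (k \<oplus> p) = ?t k \<oplus> relabel m p"
    proof -
      have "?t k \<oplus> ?t (k \<oplus> p) = relabel m p" using kadd_transpose[of m k "k \<oplus> p"] by simp
      then show ?thesis by (metis kadd_cancel)
    qed
    moreover have "?t ` (- {k, k \<oplus> p}) = - ?t ` {k, k \<oplus> p}"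
      by (rule bij_image_Compl_eq) simp
    ultimately show ?thesis by simp
  qed
  have relabel: "relabel m ` {G2, G3, G4} = {G2, G3, G4}"
    by (cases m) (auto simp: relabel_def)
  have "terms (map_aexpr ?t w) = (\<lambda>p. (- {?t k, ?t k \<oplus> relabel m p}, d p)) ` {G2, G3, G4}"
  proof -
    have "terms (map_aexpr ?t w) =
        map_prod (image ?t) id ` (\<lambda>p. (- {k, k \<oplus> p}, d p)) ` {G2, G3, G4}"
      using assms(1) unfolding has_shape_def terms_map by simp
    also have "\<dots> = (\<lambda>p. (?t ` (- {k, k \<oplus> p}), d p)) ` {G2, G3, G4}"
      unfolding image_image by simp
    finally show ?thesis unfolding im .
  qed
  also have "\<dots> = (\<lambda>p. (- {?t k, ?t k \<oplus> relabel m p}, d p)) ` (relabel m ` {G2, G3, G4})"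
    unfolding relabel ..
  also have "\<dots> = (\<lambda>p. (- {?t k, ?t k \<oplus> p}, c p)) ` {G2, G3, G4}"
    unfolding image_image by (simp add: assms(2))
  finally show ?thesis
    using assms(1) unfolding has_shape_def base_map by simp
qed

lemma has_shape_adm_expr:
  assumes "admissible \<alpha>"
  shows "has_shape (adm_expr \<alpha>) (hd \<alpha>) (cnt \<alpha>)"
proof -
  have ne: "\<alpha> \<noteq> []" using assms by (simp add: admissible_def)
  let ?t = "transpose G1 (last \<alpha>)"
  have "has_shape (map_aexpr ?t (table_expr (hd (map ?t \<alpha>)) (cnt (map ?t \<alpha>)))) (?t (hd (map ?t \<alpha>))) (cnt \<alpha>)"
    by (rule has_shape_map[OF has_shape_table_expr]) (rule cnt_transpose[OF ne])
  moreover have "?t (hd (map ?t \<alpha>)) = hd \<alpha>" using ne by (simp add: hd_map)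
  ultimately show ?thesis unfolding adm_expr_eq[OF assms] by simp
qed

lemma doubleton_eq_labels:
  assumes "{i, j, k, l} = (UNIV :: idx set)"
  shows "- {i, l} = {j, k}" "- {i, j} = {k, l}" "- {i, k} = {l, j}"
proof -
  have l: "{i, l, j, k} = UNIV" "{i, k, l, j} = UNIV" using assms by (simp_all add: insert_commute)
  show "- {i, l} = {j, k}" by (rule compl_pair[OF l(1)])
  show "- {i, j} = {k, l}" by (rule compl_pair[OF assms])
  show "- {i, k} = {l, j}" by (rule compl_pair[OF l(2)])
qed

lemma has_shape_terms:
  assumes "has_shape w i c" "{i, j, k, l} = UNIV"
  shows "terms w = {({j, k}, c (i \<oplus> l)), ({k, l}, c (i \<oplus> j)), ({l, j}, c (i \<oplus> k))}"
proof -
  have "{i \<oplus> l, i \<oplus> j, i \<oplus> k} = {G2, G3, G4}"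
  proof -
    have "{G1, i \<oplus> l, i \<oplus> j, i \<oplus> k} = UNIV"
      using assms(2) unfolding UNIV_idx_iff by (auto simp: eq_commute[of G1])
    moreover have "{G1, G2, G3, G4} = UNIV" by (simp add: UNIV_idx)
    ultimately show ?thesis using compl_single by metis
  qed
  then have "terms w = (\<lambda>p. (- {i, i \<oplus> p}, c p)) ` {i \<oplus> l, i \<oplus> j, i \<oplus> k}"
    using assms(1) by (simp add: has_shape_def)
  then show ?thesis using doubleton_eq_labels[OF assms(2)] by simp
qed

lemma labelled_as_iff: "labelled_as w i j k l t s r \<longleftrightarrow> base w = i \<and> {i, j, k, l} = UNIV \<and>
    terms w = {({j, k}, t), ({k, l}, s), ({l, j}, r)}"
  by (cases w rule: terms.cases) simp

lemma labelled_shape: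
  assumes "has_shape w i' c"
  shows "labelled_as w i j k l t s r \<longleftrightarrow> i = i' \<and> {i, j, k, l} = UNIV \<and>
     t = c (i \<oplus> l) \<and> s = c (i \<oplus> j) \<and> r = c (i \<oplus> k)"
proof (cases "i = i' \<and> {i, j, k, l} = UNIV")
  case True
  then have t: "terms w = {({j, k}, c (i \<oplus> l)), ({k, l}, c (i \<oplus> j)), ({l, j}, c (i \<oplus> k))}"
    using assms has_shape_terms by metis
  have ne: "{j, k} \<noteq> {k, l}" "{j, k} \<noteq> {l, j}" "{k, l} \<noteq> {l, j}"
    using True unfolding UNIV_idx_iff doubleton_eq_iff by metis+
  have "terms w = {({j, k}, t), ({k, l}, s), ({l, j}, r)} \<longleftrightarrow>
     t = c (i \<oplus> l) \<and> s = c (i \<oplus> j) \<and> r = c (i \<oplus> k)"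
  proof
    assume "terms w = {({j, k}, t), ({k, l}, s), ({l, j}, r)}"
    then have "({j, k}, t) \<in> terms w" "({k, l}, s) \<in> terms w" "({l, j}, r) \<in> terms w" by simp_all
    then show "t = c (i \<oplus> l) \<and> s = c (i \<oplus> j) \<and> r = c (i \<oplus> k)"
      unfolding t by (simp only: insert_iff empty_iff prod.inject ne ne[symmetric] simp_thms)
  qed (simp only: t)
  moreover have "base w = i" using True assms by (simp add: has_shape_def)
  ultimately show ?thesis unfolding labelled_as_iff using True by simp
next
  case False
  have "base w = i'" using assms unfolding has_shape_def by (rule conjunct1)
  then show ?thesis using False unfolding labelled_as_iff by metis
qed

text \<open>The factors are compared as a set, because the table lists them in varying orders.\<close>

lemma e_adm_eq:
  assumes "admissible \<alpha>"
  shows "e_adm \<alpha> = e_elem (hd \<alpha>) (cnt \<alpha>)"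
proof -
  define k c where "k = hd \<alpha>" and "c = cnt \<alpha>"
  obtain i j1 k1 n1 j2 k2 n2 j3 k3 n3
    where w: "adm_expr \<alpha> = AE i (j1, k1, n1) (j2, k2, n2) (j3, k3, n3)"
    by (cases "adm_expr \<alpha>" rule: terms.cases)
  have sh: "has_shape (adm_expr \<alpha>) k c" unfolding k_def c_def by (rule has_shape_adm_expr[OF assms])
  have i: "i = k" using sh unfolding has_shape_def w by simp
  \<comment> \<open>a factor, as a function of its unordered pair of upper indices\<close>
  define g :: "idx set \<times> nat \<Rightarrow> d4" where
    "g = (\<lambda>(S, n). e k \<sqinter> atom k (THE p. S = - {k, k \<oplus> p}) n)"
  have g: "g (- {k, k \<oplus> p}, n) = e k \<sqinter> atom k p n" for p n
  proof -
    have "(THE p'. - {k, k \<oplus> p} = - {k, k \<oplus> p'}) = p"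
      by (rule the_equality) (auto simp: doubleton_eq_iff)
    then show ?thesis by (simp add: g_def)
  qed
  have t: "terms (adm_expr \<alpha>) = (\<lambda>p. (- {k, k \<oplus> p}, c p)) ` {G2, G3, G4}"
    using sh unfolding has_shape_def by (rule conjunct2)
  have g': "g ({j, m}, n) = e k \<sqinter> atomic j m n" if jm: "({j, m}, n) \<in> terms (adm_expr \<alpha>)" for j m n
  proof -
    obtain p where "({j, m}, n) = (- {k, k \<oplus> p}, c p)"
      using jm unfolding t by (rule imageE)
    then have p: "{j, m} = - {k, k \<oplus> p}" by (rule Pair_inject)
    have "{k, k \<oplus> p, j, m} = {k, k \<oplus> p} \<union> {j, m}" by auto
    then have "{k, k \<oplus> p, j, m} = UNIV" unfolding p by simp
    from e_inf_atomic[OF this, of n] show ?thesis unfolding p g by simp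
  qed
  have "Inf_fin (g ` terms (adm_expr \<alpha>)) = e_adm \<alpha>"
  proof -
    have "g ({j1, k1}, n1) = e k \<sqinter> atomic j1 k1 n1" "g ({j2, k2}, n2) = e k \<sqinter> atomic j2 k2 n2"
      "g ({j3, k3}, n3) = e k \<sqinter> atomic j3 k3 n3"
      by (rule g'; simp add: w)+
    then show ?thesis unfolding e_adm_def w by (simp add: i ac_simps)
  qed
  moreover have "Inf_fin (g ` terms (adm_expr \<alpha>)) = e_elem k c"
  proof -
    have "g ` terms (adm_expr \<alpha>) = (\<lambda>p. e k \<sqinter> atom k p (c p)) ` {G2, G3, G4}"
      unfolding t image_image g ..
    then show ?thesis by (simp add: e_elem_def ac_simps)
  qed
  ultimately show ?thesis by (simp add: k_def c_def)
qed

lemma f_form_atomic: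
  assumes "{i, j, k, l} = UNIV"
  shows "e_elem i c \<sqinter> ((e i \<sqinter> atomic j k (c (i \<oplus> l) + 1)) \<squnion>
      (atomic k l (c (i \<oplus> j) + 1) \<sqinter> atomic l j (c (i \<oplus> k) - 1))) =
    f_form i c (i \<oplus> l) (i \<oplus> j) (i \<oplus> k)"
proof -
  have l: "{i, l, j, k} = UNIV" "{i, k, l, j} = UNIV" using assms by (simp_all add: insert_commute)
  have ne: "i \<oplus> j \<noteq> i \<oplus> k" "i \<oplus> j \<noteq> G1" "i \<oplus> k \<noteq> G1" using assms by (simp_all add: UNIV_idx_iff)
  define a b where "a = c (i \<oplus> j) + 1" and "b = c (i \<oplus> k) - 1"
  have 2: "e_elem i ((\<lambda>_. 0)(i \<oplus> j := a, i \<oplus> k := b)) = e i \<sqinter> (atomic k l a \<sqinter> atomic l j b)"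
  proof -
    have "e_elem i ((\<lambda>_. 0)(i \<oplus> j := a, i \<oplus> k := b)) =
        e_elem i ((\<lambda>_. 0)(i \<oplus> j := a)) \<sqinter> e_elem i ((\<lambda>_. 0)(i \<oplus> k := b))"
      unfolding e_elem_inf using ne by (intro e_elem_cong) auto
    then show ?thesis unfolding e_elem_single[OF assms] e_elem_single[OF l(2)] by (simp add: ac_simps)
  qed
  let ?Y = "e i \<sqinter> atomic j k (c (i \<oplus> l) + 1)" and ?Z = "atomic k l a \<sqinter> atomic l j b"
  have "e_elem i c \<sqinter> (?Y \<squnion> ?Z) = e_elem i c \<sqinter> (?Y \<squnion> ?Z \<sqinter> e i)"
    by (rule drop_meet[symmetric]) (simp_all add: e_elem_le_e)
  then show ?thesis
    unfolding f_form_def a_def[symmetric] b_def[symmetric] Suc_eq_plus1 2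
      e_elem_single[OF l(1)] by (simp only: inf_commute[of ?Z])
qed

text \<open>Every labelling that the choice operator could pick yields \<open>f_form\<close> with suitable labels, and all
of these agree.\<close>

lemma f_adm_eq:
  assumes "admissible \<alpha>"
  shows "f_adm \<alpha> = f_elem (hd \<alpha>) (cnt \<alpha>)"
proof (cases "length \<alpha> = 1")
  case True
  then obtain k where "\<alpha> = [k]" by (auto simp: length_Suc_conv)
  then show ?thesis by (simp add: f_adm_def f_elem_def)
next
  case False
  then obtain x y zs where \<alpha>: "\<alpha> = x # y # zs"
    using assms by (metis One_nat_def admissible_def length_Cons list.exhaust list.size(3))
  define i c where "i = hd \<alpha>" and "c = cnt \<alpha>"
  define P where "P v \<longleftrightarrow> (\<exists>i j k l t s r. labelled_as (adm_expr \<alpha>) i j k l t s r \<and> r \<ge> 1 \<and>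
        v = e_adm \<alpha> \<sqinter>
          ((e i \<sqinter> atomic j k (t + 1)) \<squnion> (atomic k l (s + 1) \<sqinter> atomic l j (r - 1))))" for v
  have sh: "has_shape (adm_expr \<alpha>) i c" unfolding i_def c_def by (rule has_shape_adm_expr[OF assms])
  have ea: "e_adm \<alpha> = e_elem i c" unfolding i_def c_def by (rule e_adm_eq[OF assms])
  have P: "v = f_elem i c" if Pv: "P v" for v
  proof -
    obtain i' j k l t s r where "labelled_as (adm_expr \<alpha>) i' j k l t s r" "r \<ge> 1" and
      v: "v = e_adm \<alpha> \<sqinter>
        ((e i' \<sqinter> atomic j k (t + 1)) \<squnion> (atomic k l (s + 1) \<sqinter> atomic l j (r - 1)))"
      using Pv unfolding P_def by (elim exE conjE)
    then have *: "i' = i" "{i, j, k, l} = UNIV" "t = c (i \<oplus> l)" "s = c (i \<oplus> j)" "r = c (i \<oplus> k)"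
      "c (i \<oplus> k) \<ge> 1"
      using labelled_shape[OF sh] by metis+
    have "v = f_form i c (i \<oplus> l) (i \<oplus> j) (i \<oplus> k)"
      unfolding v ea f_form_atomic[OF *(2), symmetric] *(1,3,4,5) ..
    also have "\<dots> = f_elem i c"
    proof (rule f_elem_eq[symmetric])
      show "{G1, i \<oplus> l, i \<oplus> j, i \<oplus> k} = UNIV"
        using *(2) unfolding UNIV_idx_iff by (auto simp: eq_commute[of G1])
    qed (rule *(6))
    finally show ?thesis .
  qed
  have "x \<noteq> y" using assms by (simp add: \<alpha> admissible_def)
  then obtain a b where ab: "{x, y, a, b} = UNIV" by (rule four_labels)
  then have "{i, a, y, b} = UNIV" by (simp add: i_def \<alpha> insert_commute)
  moreover have "c (i \<oplus> y) \<ge> 1" by (simp add: c_def i_def \<alpha>)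
  ultimately have "\<exists>v. P v"
    unfolding P_def using labelled_shape[OF sh] by metis
  then have "P (SOME v. P v)" by (rule someI_ex)
  then have "(SOME v. P v) = f_elem i c" by (rule P)
  then show ?thesis unfolding f_adm_def P_def[symmetric] using False by (simp add: i_def c_def)
qed

lemma cnt_snoc: "\<alpha> \<noteq> [] \<Longrightarrow> cnt (\<alpha> @ [i]) = (cnt \<alpha>)(last \<alpha> \<oplus> i := Suc (cnt \<alpha> (last \<alpha> \<oplus> i)))"
  by (rule ext, induction \<alpha> rule: letters.induct) (auto simp: cnt_def)

lemma admissible_snoc:
  "admissible (\<alpha> @ [i]) \<longleftrightarrow> \<alpha> = [] \<or> admissible \<alpha> \<and> last \<alpha> \<noteq> i"
  by (auto simp: admissible_def distinct_adj_append_iff)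

lemma admissible_single [simp]: "admissible [i]"
  by (simp add: admissible_def)

text \<open>A family of elements for which appending a new start to the sequence amounts to applying an
endomorphism. It makes the recursion of cumulative sums uniform for $e_\alpha$ and $f_{\alpha0}$.\<close>

definition snoc_compat :: "(idx list \<Rightarrow> d4) \<Rightarrow> bool" where
  "snoc_compat v \<longleftrightarrow>
     (\<forall>\<alpha> i. admissible \<alpha> \<and> last \<alpha> \<noteq> i \<longrightarrow> v (\<alpha> @ [i]) = gamma (last \<alpha>) i (v \<alpha>))"

lemma snoc_compatI:
  assumes v: "\<And>\<alpha>. admissible \<alpha> \<Longrightarrow> v \<alpha> = X (hd \<alpha>) (cnt \<alpha>)"
    and X: "\<And>p k c. p \<noteq> G1 \<Longrightarrow> gamma G1 p (X k c) = X k (c(p := Suc (c p)))"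
  shows "snoc_compat v"
  unfolding snoc_compat_def
proof (intro allI impI, elim conjE)
  fix \<alpha> i
  assume a: "admissible \<alpha>" "last \<alpha> \<noteq> i"
  then have ne: "\<alpha> \<noteq> []" "last \<alpha> \<oplus> i \<noteq> G1" by (auto simp: admissible_def)
  have "v (\<alpha> @ [i]) = X (hd \<alpha>) (cnt (\<alpha> @ [i]))"
    using v[of "\<alpha> @ [i]"] a ne by (simp add: admissible_snoc)
  also have "\<dots> = gamma G1 (last \<alpha> \<oplus> i) (X (hd \<alpha>) (cnt \<alpha>))"
    unfolding cnt_snoc[OF ne(1)] X[OF ne(2)] ..
  finally show "v (\<alpha> @ [i]) = gamma (last \<alpha>) i (v \<alpha>)"
    unfolding gamma_kadd[OF a(2)] v[OF a(1)] .
qed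

lemma snoc_compat_e: "snoc_compat e_adm"
  by (rule snoc_compatI[of _ e_elem]) (simp_all add: e_adm_eq gamma_e_elem)

lemma snoc_compat_f: "snoc_compat f_adm"
  by (rule snoc_compatI[of _ f_elem]) (simp_all add: f_adm_eq gamma_f_elem)

definition adm_set :: "nat \<Rightarrow> idx list set" where
  "adm_set n = {\<alpha>. admissible \<alpha> \<and> length \<alpha> = n}"

lemma finite_adm_set [simp]: "finite (adm_set n)"
proof -
  have "finite {\<alpha>. set \<alpha> \<subseteq> (UNIV :: idx set) \<and> length \<alpha> = n}"
    by (rule finite_lists_length_eq) simp
  then show ?thesis by (rule rev_finite_subset) (auto simp: adm_set_def)
qed

lemma admissible_rev: "admissible (rev \<alpha>) \<longleftrightarrow> admissible \<alpha>"
  by (simp add: admissible_def)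

lemma adm_exists_hd: "n \<ge> 1 \<Longrightarrow> \<exists>\<alpha> \<in> adm_set n. hd \<alpha> = i"
proof (induction n arbitrary: i rule: nat_induct_at_least)
  case base
  show ?case by (rule bexI[of _ "[i]"]) (simp_all add: adm_set_def)
next
  case (Suc n)
  obtain j where "i \<noteq> j" by (metis idx.distinct(1))
  moreover obtain \<alpha> where \<alpha>: "\<alpha> \<in> adm_set n" "hd \<alpha> = j" using Suc.IH by blast
  ultimately show ?case
    by (intro bexI[of _ "i # \<alpha>"]) (auto simp: adm_set_def admissible_def distinct_adj_Cons)
qed

lemma adm_exists_last: "n \<ge> 1 \<Longrightarrow> \<exists>\<alpha> \<in> adm_set n. last \<alpha> = i"
proof -
  assume "n \<ge> 1"
  then obtain \<alpha> where "\<alpha> \<in> adm_set n" "hd \<alpha> = i" using adm_exists_hd by blast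
  then show ?thesis
    by (intro bexI[of _ "rev \<alpha>"]) (auto simp: adm_set_def admissible_rev last_rev)
qed

definition cum :: "(idx list \<Rightarrow> d4) \<Rightarrow> idx \<Rightarrow> nat \<Rightarrow> d4" where
  "cum v i n = Sup_fin (v ` {\<alpha> \<in> adm_set n. last \<alpha> = i})"

lemma cum_upper: "\<alpha> \<in> adm_set n \<Longrightarrow> v \<alpha> \<le> cum v (last \<alpha>) n"
  unfolding cum_def by (rule Sup_fin.coboundedI) auto

lemma cum_le:
  assumes "n \<ge> 1" "\<And>\<alpha>. \<alpha> \<in> adm_set n \<Longrightarrow> last \<alpha> = i \<Longrightarrow> v \<alpha> \<le> x"
  shows "cum v i n \<le> x"
  unfolding cum_def using assms adm_exists_last[OF assms(1), of i]
  by (intro Sup_fin.boundedI) auto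

lemma gamma_Sup_fin: "finite A \<Longrightarrow> A \<noteq> {} \<Longrightarrow> gamma i j (Sup_fin A) = Sup_fin (gamma i j ` A)"
  by (rule Sup_fin.hom_commute) simp_all

lemma cum_1: "cum v i 1 = v [i]"
proof -
  have "{\<alpha> \<in> adm_set 1. last \<alpha> = i} = {[i]}"
    by (auto simp: adm_set_def length_Suc_conv)
  then show ?thesis by (simp add: cum_def)
qed

text \<open>A sequence starting at \<open>i\<close> arises from a unique sequence of one entry less whose start \<open>m\<close> differs
from \<open>i\<close>; sort the summands by \<open>m\<close>.\<close>

lemma cum_Suc:
  assumes "snoc_compat v" "n \<ge> 1" and ijkl: "{i, j, k, l} = UNIV"
  shows "cum v i (Suc n) =
    gamma i j (cum v j n) \<squnion> gamma i k (cum v k n) \<squnion> gamma i l (cum v l n)" (is "_ = ?r")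
proof (rule antisym)
  show "cum v i (Suc n) \<le> ?r"
  proof (rule cum_le)
    fix \<beta>
    assume b: "\<beta> \<in> adm_set (Suc n)" "last \<beta> = i"
    define \<alpha> where "\<alpha> = butlast \<beta>"
    have \<beta>: "\<beta> = \<alpha> @ [i]"
      unfolding \<alpha>_def using b by (metis adm_set_def admissible_def append_butlast_last_id mem_Collect_eq)
    have a: "admissible \<alpha>" "last \<alpha> \<noteq> i" "\<alpha> \<in> adm_set n"
      using b assms(2) unfolding \<beta> by (auto simp: adm_set_def admissible_snoc)
    have "v \<beta> = gamma i (last \<alpha>) (v \<alpha>)"
      unfolding \<beta> using assms(1) a gamma_sym by (simp add: snoc_compat_def)
    also have "\<dots> \<le> gamma i (last \<alpha>) (cum v (last \<alpha>) n)"
      by (intro gamma_mono cum_upper a)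
    also have "\<dots> \<le> ?r"
    proof -
      have "last \<alpha> \<in> {i, j, k, l}" using ijkl by simp
      then consider "last \<alpha> = j" | "last \<alpha> = k" | "last \<alpha> = l" using a(2) by auto
      then show ?thesis by cases (simp_all add: le_supI1 le_supI2)
    qed
    finally show "v \<beta> \<le> ?r" .
  qed simp
  have *: "gamma i m (cum v m n) \<le> cum v i (Suc n)" if "m \<noteq> i" for m
  proof -
    have ne: "v ` {\<alpha> \<in> adm_set n. last \<alpha> = m} \<noteq> {}" using adm_exists_last[OF assms(2), of m] by auto
    have "gamma i m (v \<alpha>) \<le> cum v i (Suc n)" if a: "\<alpha> \<in> adm_set n" "last \<alpha> = m" for \<alpha>
    proof -
      have "\<alpha> @ [i] \<in> adm_set (Suc n)"
        using a \<open>m \<noteq> i\<close> by (simp add: adm_set_def admissible_snoc)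
      from cum_upper[OF this, of v] have "v (\<alpha> @ [i]) \<le> cum v i (Suc n)" by simp
      moreover have "v (\<alpha> @ [i]) = gamma m i (v \<alpha>)"
        using assms(1) a \<open>m \<noteq> i\<close> by (auto simp: snoc_compat_def adm_set_def)
      ultimately show ?thesis by (simp add: gamma_sym[of i m])
    qed
    then show ?thesis
      unfolding cum_def[of v m n] using ne
      by (subst gamma_Sup_fin) (auto intro!: Sup_fin.boundedI)
  qed
  show "?r \<le> cum v i (Suc n)"
    using ijkl unfolding UNIV_idx_iff by (intro sup_least *) auto
qed

lemma gamma_normal:
  "gamma G2 G1 = gamma G1 G2" "gamma G3 G1 = gamma G1 G3" "gamma G4 G1 = gamma G1 G4"
  "gamma G3 G4 = gamma G1 G2" "gamma G4 G3 = gamma G1 G2"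
  "gamma G2 G4 = gamma G1 G3" "gamma G4 G2 = gamma G1 G3"
  "gamma G2 G3 = gamma G1 G4" "gamma G3 G2 = gamma G1 G4"
  using gamma_kadd[of G2 G1] gamma_kadd[of G3 G1] gamma_kadd[of G4 G1] gamma_kadd[of G3 G4]
    gamma_kadd[of G4 G3] gamma_kadd[of G2 G4] gamma_kadd[of G4 G2] gamma_kadd[of G2 G3]
    gamma_kadd[of G3 G2] by simp_all

lemma cum_Suc_all:
  assumes "snoc_compat v" "n \<ge> 1"
  shows
    "cum v G1 (Suc n) =
       gamma G1 G2 (cum v G2 n) \<squnion> gamma G1 G3 (cum v G3 n) \<squnion> gamma G1 G4 (cum v G4 n)"
    "cum v G2 (Suc n) =
       gamma G1 G2 (cum v G1 n) \<squnion> gamma G1 G4 (cum v G3 n) \<squnion> gamma G1 G3 (cum v G4 n)"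
    "cum v G3 (Suc n) =
       gamma G1 G3 (cum v G1 n) \<squnion> gamma G1 G4 (cum v G2 n) \<squnion> gamma G1 G2 (cum v G4 n)"
    "cum v G4 (Suc n) =
       gamma G1 G4 (cum v G1 n) \<squnion> gamma G1 G3 (cum v G2 n) \<squnion> gamma G1 G2 (cum v G3 n)"
  using cum_Suc[OF assms, of G1 G2 G3 G4] cum_Suc[OF assms, of G2 G1 G3 G4]
    cum_Suc[OF assms, of G3 G1 G2 G4] cum_Suc[OF assms, of G4 G1 G2 G3]
  by (simp_all add: UNIV_idx_iff gamma_normal)

section \<open>Cumulative elements and Herrmann polynomials\<close>

lemma compl_idx:
  "- {G1} = {G2, G3, G4}" "- {G2} = {G1, G3, G4}" "- {G3} = {G1, G2, G4}" "- {G4} = {G1, G2, G3}"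
  by (rule compl_single, simp add: UNIV_idx_iff)+

lemma e_cum_eq: "e_cum i n = cum e_adm i n"
proof -
  have "{e_adm \<alpha> | \<alpha>. admissible \<alpha> \<and> length \<alpha> = n \<and> last \<alpha> = i} =
      e_adm ` {\<alpha> \<in> adm_set n. last \<alpha> = i}"
    by (auto simp: adm_set_def)
  then show ?thesis by (simp add: e_cum_def cum_def)
qed

definition total :: "(idx list \<Rightarrow> d4) \<Rightarrow> nat \<Rightarrow> d4" where
  "total v n = cum v G1 n \<squnion> cum v G2 n \<squnion> cum v G3 n \<squnion> cum v G4 n"

lemma total_upper: "cum v i n \<le> total v n"
  by (cases i) (simp_all add: total_def le_supI1)

lemma total_Suc: "snoc_compat v \<Longrightarrow> n \<ge> 1 \<Longrightarrow> total v (Suc n) = R (total v n)"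
  by (simp add: total_def R_def cum_Suc_all ac_simps)

lemma f0_cum_eq:
  assumes "n \<ge> 1"
  shows "f0_cum (n + 1) = total f_adm n"
proof -
  have "{f_adm \<alpha> | \<alpha>. admissible \<alpha> \<and> length \<alpha> = n} = f_adm ` adm_set n"
    by (auto simp: adm_set_def)
  then have eq: "f0_cum (n + 1) = Sup_fin (f_adm ` adm_set n)" by (simp add: f0_cum_def)
  have ne: "f_adm ` adm_set n \<noteq> {}" using adm_exists_hd[OF assms] by auto
  show ?thesis
  proof (rule antisym)
    show "f0_cum (n + 1) \<le> total f_adm n"
      unfolding eq using ne cum_upper[of _ n f_adm] total_upper[of f_adm _ n]
      by (intro Sup_fin.boundedI) (auto intro: order_trans)
    have "cum f_adm i n \<le> f0_cum (n + 1)" for i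
      unfolding eq using assms by (intro cum_le Sup_fin.coboundedI) auto
    then show "total f_adm n \<le> f0_cum (n + 1)" unfolding total_def by simp
  qed
qed

lemma f0_inv_eq:
  assumes "n \<ge> 1"
  shows "f0_inv (n + 1) = f0_cum (n + 1)"
proof -
  define A where "A i = f_adm ` {\<alpha> \<in> adm_set n. hd \<alpha> = i}" for i
  have A: "{f_adm \<alpha> | \<alpha>. admissible \<alpha> \<and> length \<alpha> = n \<and> hd \<alpha> = i} = A i" for i
    by (auto simp: adm_set_def A_def)
  have U: "{f_adm \<alpha> | \<alpha>. admissible \<alpha> \<and> length \<alpha> = n} = f_adm ` adm_set n"
    by (auto simp: adm_set_def)
  have fin: "finite (A i)" "A i \<noteq> {}" for i
    using adm_exists_hd[OF assms, of i] by (auto simp: A_def)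
  have ne: "f_adm ` adm_set n \<noteq> {}" using adm_exists_hd[OF assms] by auto
  have "Sup_fin (range (\<lambda>i. Sup_fin (A i))) = Sup_fin (f_adm ` adm_set n)"
  proof (rule antisym)
    have "Sup_fin (A i) \<le> Sup_fin (f_adm ` adm_set n)" for i
      using fin(2)[of i] by (intro Sup_fin.subset_imp) (auto simp: A_def)
    then show "Sup_fin (range (\<lambda>i. Sup_fin (A i))) \<le> Sup_fin (f_adm ` adm_set n)"
      by (intro Sup_fin.boundedI) auto
    have "f_adm \<alpha> \<le> Sup_fin (range (\<lambda>i. Sup_fin (A i)))" if "\<alpha> \<in> adm_set n" for \<alpha>
    proof -
      have "f_adm \<alpha> \<le> Sup_fin (A (hd \<alpha>))"
        using that fin by (intro Sup_fin.coboundedI) (auto simp: A_def)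
      also have "\<dots> \<le> Sup_fin (range (\<lambda>i. Sup_fin (A i)))"
        by (intro Sup_fin.coboundedI) auto
      finally show ?thesis .
    qed
    then show "Sup_fin (f_adm ` adm_set n) \<le> Sup_fin (range (\<lambda>i. Sup_fin (A i)))"
      using ne by (intro Sup_fin.boundedI) auto
  qed
  then show ?thesis by (simp add: f0_inv_def f0_cum_def A U)
qed

lemma total_one:
  "total e_adm 1 = e G1 \<squnion> e G2 \<squnion> e G3 \<squnion> e G4"
  unfolding total_def cum_1 by (simp add: e_adm_eq)

lemma s_poly_eq: "n \<ge> 1 \<Longrightarrow> s_poly n = total e_adm n"
proof (induction n rule: nat_induct_at_least)
  case base
  show ?case unfolding total_one by simp
next
  case (Suc n)
  then obtain m where "n = Suc m" by (cases n) auto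
  then show ?case using Suc total_Suc[OF snoc_compat_e Suc.hyps] by (simp add: R_def)
qed

lemma meet3:
  fixes a b c d :: "'a::modular_lattice"
  shows "(a \<squnion> b \<squnion> c) \<sqinter> (a \<squnion> b \<squnion> d) \<sqinter> (a \<squnion> c \<squnion> d) =
    a \<squnion> c \<sqinter> (a \<squnion> b \<squnion> d) \<squnion> b \<sqinter> (a \<squnion> c \<squnion> d)"
proof -
  have "(a \<squnion> b \<squnion> c) \<sqinter> (a \<squnion> b \<squnion> d) = a \<squnion> b \<squnion> c \<sqinter> (a \<squnion> b \<squnion> d)"
    by (rule modular') simp
  then have "(a \<squnion> b \<squnion> c) \<sqinter> (a \<squnion> b \<squnion> d) \<sqinter> (a \<squnion> c \<squnion> d) =
      (a \<squnion> c \<sqinter> (a \<squnion> b \<squnion> d) \<squnion> b) \<sqinter> (a \<squnion> c \<squnion> d)"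
    by (simp only: ac_simps)
  also have "\<dots> = a \<squnion> c \<sqinter> (a \<squnion> b \<squnion> d) \<squnion> b \<sqinter> (a \<squnion> c \<squnion> d)"
    by (rule modular') (auto intro: le_infI1 le_supI1 le_supI2)
  finally show ?thesis .
qed

lemma meet4:
  fixes a b c d :: "'a::modular_lattice"
  shows "(a \<squnion> b \<squnion> c) \<sqinter> (a \<squnion> b \<squnion> d) \<sqinter> (a \<squnion> c \<squnion> d) \<sqinter> (b \<squnion> c \<squnion> d) =
    a \<sqinter> (b \<squnion> c \<squnion> d) \<squnion> b \<sqinter> (a \<squnion> c \<squnion> d) \<squnion> c \<sqinter> (a \<squnion> b \<squnion> d)"
proof -
  have "(a \<squnion> b \<squnion> c) \<sqinter> (a \<squnion> b \<squnion> d) \<sqinter> (a \<squnion> c \<squnion> d) \<sqinter> (b \<squnion> c \<squnion> d) =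
      (c \<sqinter> (a \<squnion> b \<squnion> d) \<squnion> b \<sqinter> (a \<squnion> c \<squnion> d) \<squnion> a) \<sqinter> (b \<squnion> c \<squnion> d)"
    unfolding meet3 by (simp only: ac_simps)
  also have "\<dots> = c \<sqinter> (a \<squnion> b \<squnion> d) \<squnion> b \<sqinter> (a \<squnion> c \<squnion> d) \<squnion> a \<sqinter> (b \<squnion> c \<squnion> d)"
    by (rule modular') (auto intro: le_infI1 le_supI1 le_supI2)
  finally show ?thesis by (simp only: ac_simps)
qed

lemma meet4_all:
  fixes a b c d :: "'a::modular_lattice"
  shows "(a \<squnion> b \<squnion> c) \<sqinter> (a \<squnion> b \<squnion> d) \<sqinter> (a \<squnion> c \<squnion> d) \<sqinter> (b \<squnion> c \<squnion> d) =
    a \<sqinter> (b \<squnion> c \<squnion> d) \<squnion> b \<sqinter> (a \<squnion> c \<squnion> d) \<squnion> c \<sqinter> (a \<squnion> b \<squnion> d) \<squnion> d \<sqinter> (a \<squnion> b \<squnion> c)"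
    (is "?l = ?r \<squnion> _")
proof -
  have "d \<sqinter> (a \<squnion> b \<squnion> c) \<le> ?l" by (auto intro: le_infI1 le_supI1 le_supI2)
  then show ?thesis unfolding meet4 by (simp add: sup_absorb1)
qed

text \<open>For the cumulative elements this is $h_jh_kh_l = e_i(n)+h^{\min}(n)$.\<close>

lemma meet3_eq:
  fixes a b c d :: "'a::modular_lattice"
  shows "(a \<squnion> b \<squnion> c) \<sqinter> (a \<squnion> b \<squnion> d) \<sqinter> (a \<squnion> c \<squnion> d) =
    a \<squnion> (a \<squnion> b \<squnion> c) \<sqinter> (a \<squnion> b \<squnion> d) \<sqinter> (a \<squnion> c \<squnion> d) \<sqinter> (b \<squnion> c \<squnion> d)"
proof -
  have "a \<squnion> (a \<sqinter> (b \<squnion> c \<squnion> d) \<squnion> x) = a \<squnion> x" for x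
    by (simp flip: sup_assoc)
  then show ?thesis unfolding meet4 unfolding meet3 by (simp only: sup_assoc) (simp only: ac_simps)
qed

lemma f_adm_single: "f_adm [i] = e i \<sqinter> Sup_fin (e ` (- {i}))"
  by (simp add: f_adm_def)

lemma total_f_one: "total f_adm 1 = t_poly 1"
proof -
  have "total f_adm 1 = e G1 \<sqinter> (e G2 \<squnion> e G3 \<squnion> e G4) \<squnion> e G2 \<sqinter> (e G1 \<squnion> e G3 \<squnion> e G4) \<squnion>
    e G3 \<sqinter> (e G1 \<squnion> e G2 \<squnion> e G4) \<squnion> e G4 \<sqinter> (e G1 \<squnion> e G2 \<squnion> e G3)"
    unfolding total_def cum_1 f_adm_single compl_idx by (simp add: sup_assoc)
  then show ?thesis unfolding meet4_all[symmetric] by simp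
qed

lemma t_poly_eq: "n \<ge> 1 \<Longrightarrow> t_poly n = total f_adm n"
proof (induction n rule: nat_induct_at_least)
  case base
  show ?case unfolding total_f_one by simp
next
  case (Suc n)
  then obtain m where "n = Suc m" by (cases n) auto
  then show ?case using Suc total_Suc[OF snoc_compat_f Suc.hyps] by (simp add: R_def)
qed

lemma R_power:
  assumes "\<And>n. n \<ge> 1 \<Longrightarrow> x (Suc n) = R (x n)" "n \<ge> 1"
  shows "x n = (R ^^ (n - 1)) (x 1)"
  using assms(2) by (induction n rule: nat_induct_at_least) (auto simp: assms(1) Suc_diff_le
    simp flip: funpow_Suc_right dest!: Suc_le_D)

lemma s_poly_Suc: "n \<ge> 1 \<Longrightarrow> s_poly (Suc n) = R (s_poly n)"
  by (simp add: s_poly_eq total_Suc snoc_compat_e)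

lemma t_poly_Suc: "n \<ge> 1 \<Longrightarrow> t_poly (Suc n) = R (t_poly n)"
  by (simp add: t_poly_eq total_Suc snoc_compat_f)

text \<open>The recursion of $p_{i,n}$ splits along the join into that of $e_i(n)$ and that of $t_n$, as
$\gamma_{ij},\gamma_{ik},\gamma_{il}$ are the same three endomorphisms for every \<open>i\<close>.\<close>

lemma p_poly_eq: "n \<ge> 1 \<Longrightarrow> p_poly i n = e_cum i n \<squnion> t_poly n"
proof (induction n arbitrary: i rule: nat_induct_at_least)
  case base
  show ?case unfolding e_cum_eq cum_1 by (simp add: e_adm_eq)
next
  case (Suc n)
  then obtain m where m: "n = Suc m" by (cases n) auto
  have "p_poly i (Suc n) = Sup_fin ((\<lambda>j. gamma i j (e_cum j n) \<squnion> gamma i j (t_poly n)) ` (- {i}))"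
    using Suc.IH by (simp add: m)
  then show ?case
    using cum_Suc_all[OF snoc_compat_e Suc.hyps] t_poly_Suc[OF Suc.hyps]
    by (cases i) (simp_all add: compl_idx gamma_normal e_cum_eq R_def ac_simps)
qed

definition diag_sum :: "((idx \<Rightarrow> nat) \<Rightarrow> d4) \<Rightarrow> nat \<Rightarrow> d4" where
  "diag_sum Y n = Sup_fin {Y (counts t s r) | r s t. r + s + t = n}"

lemma finite_diag: "finite {Y r s t | r s t. r + s + t = (n :: nat)}"
proof -
  have "{Y r s t | r s t. r + s + t = n} \<subseteq> (\<lambda>(r, s, t). Y r s t) ` ({..n} \<times> {..n} \<times> {..n})"
  proof
    fix x
    assume "x \<in> {Y r s t | r s t. r + s + t = n}"
    then obtain r s t where "x = Y r s t" "r + s + t = n" by blast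
    then show "x \<in> (\<lambda>(r, s, t). Y r s t) ` ({..n} \<times> {..n} \<times> {..n})"
      by (intro image_eqI[of _ _ "(r, s, t)"]) auto
  qed
  then show ?thesis by (rule finite_subset) simp
qed

lemma diag_ne: "{Y r s t | r s t. r + s + t = (n :: nat)} \<noteq> {}"
proof -
  have "Y n 0 0 \<in> {Y r s t | r s t. r + s + t = n}" by force
  then show ?thesis by blast
qed

lemma diag_sum_upper: "r + s + t = n \<Longrightarrow> Y (counts t s r) \<le> diag_sum Y n"
  unfolding diag_sum_def by (rule Sup_fin.coboundedI[OF finite_diag]) blast

lemma diag_sum_le: "(\<And>r s t. r + s + t = n \<Longrightarrow> Y (counts t s r) \<le> x) \<Longrightarrow> diag_sum Y n \<le> x"
  unfolding diag_sum_def by (rule Sup_fin.boundedI[OF finite_diag diag_ne]) blast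

lemma diag_sum_0: "diag_sum Y 0 = Y (\<lambda>_. 0)"
proof -
  have "{Y (counts t s r) | r s t. r + s + t = 0} = {Y (counts 0 0 0)}" by simp
  moreover have "counts 0 0 0 = (\<lambda>_. 0)" by auto
  ultimately show ?thesis unfolding diag_sum_def by (simp only: Sup_fin.singleton)
qed

text \<open>Raising one of three exponents of total \<open>n\<close> reaches every triple of total \<open>n + 1\<close>.\<close>

lemma diag_sum_Suc:
  assumes Y: "\<And>p c. p \<noteq> G1 \<Longrightarrow> gamma G1 p (Y c) = Y (c(p := Suc (c p)))"
  shows "diag_sum Y (Suc n) = R (diag_sum Y n)"
proof (rule antisym)
  have g: "gamma G1 G2 (Y (counts t s r)) = Y (counts (Suc t) s r)"
    "gamma G1 G3 (Y (counts t s r)) = Y (counts t (Suc s) r)"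
    "gamma G1 G4 (Y (counts t s r)) = Y (counts t s (Suc r))" for t s r
    by (simp_all add: Y fun_upd_twist)
  show "diag_sum Y (Suc n) \<le> R (diag_sum Y n)"
  proof (rule diag_sum_le)
    fix r s t :: nat
    assume "r + s + t = Suc n"
    then consider t' where "t = Suc t'" "r + s + t' = n" | s' where "s = Suc s'" "r + s' + t = n"
      | r' where "r = Suc r'" "r' + s + t = n"
      by (cases t; cases s; cases r) auto
    then show "Y (counts t s r) \<le> R (diag_sum Y n)"
    proof cases
      case 1
      then show ?thesis unfolding R_def
        using gamma_mono[OF diag_sum_upper[OF 1(2), of Y], of G1 G2] by (simp add: g le_supI1)
    next
      case 2
      then show ?thesis unfolding R_def
        using gamma_mono[OF diag_sum_upper[OF 2(2), of Y], of G1 G3] by (simp add: g le_supI1 le_supI2)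
    next
      case 3
      then show ?thesis unfolding R_def
        using gamma_mono[OF diag_sum_upper[OF 3(2), of Y], of G1 G4] by (simp add: g le_supI2)
    qed
  qed
  have "gamma G1 p (diag_sum Y n) \<le> diag_sum Y (Suc n)" if "p \<noteq> G1" for p
  proof -
    have "gamma G1 p (Y (counts t s r)) \<le> diag_sum Y (Suc n)" if "r + s + t = n" for r s t
      using \<open>p \<noteq> G1\<close> that by (cases p) (auto simp: g intro!: diag_sum_upper)
    then show ?thesis
      unfolding diag_sum_def[of Y n] gamma_Sup_fin[OF finite_diag diag_ne]
      by (intro Sup_fin.boundedI finite_imageI finite_diag)
        (unfold image_is_empty, rule diag_ne, blast)
  qed
  then show "R (diag_sum Y n) \<le> diag_sum Y (Suc n)" by (simp add: R_def)
qed

lemma R_power_diag_sum: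
  assumes Y: "\<And>p c. p \<noteq> G1 \<Longrightarrow> gamma G1 p (Y c) = Y (c(p := Suc (c p)))"
  shows "(R ^^ n) (Y (\<lambda>_. 0)) = diag_sum Y n"
  by (induction n) (simp_all add: diag_sum_0 diag_sum_Suc[OF Y])

lemma gamma_powers:
  assumes Y: "\<And>p c. p \<noteq> G1 \<Longrightarrow> gamma G1 p (Y c) = Y (c(p := Suc (c p)))"
  shows "(gamma G1 G2 ^^ t) ((gamma G1 G3 ^^ s) ((gamma G1 G4 ^^ r) (Y (\<lambda>_. 0)))) = Y (counts t s r)"
proof -
  have *: "(gamma G1 p ^^ n) (Y c) = Y (c(p := n + c p))" if "p \<noteq> G1" for p c n
    using that by (induction n) (simp_all add: Y)
  show ?thesis by (simp add: * fun_upd_twist)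
qed

definition e_total :: "(idx \<Rightarrow> nat) \<Rightarrow> d4" where
  "e_total c = e_elem G1 c \<squnion> e_elem G2 c \<squnion> e_elem G3 c \<squnion> e_elem G4 c"

definition f_total :: "(idx \<Rightarrow> nat) \<Rightarrow> d4" where
  "f_total c = f_elem G1 c \<squnion> f_elem G2 c \<squnion> f_elem G3 c \<squnion> f_elem G4 c"

lemma gamma_e_total: "p \<noteq> G1 \<Longrightarrow> gamma G1 p (e_total c) = e_total (c(p := Suc (c p)))"
  by (simp add: e_total_def gamma_e_elem)

lemma gamma_f_total: "p \<noteq> G1 \<Longrightarrow> gamma G1 p (f_total c) = f_total (c(p := Suc (c p)))"
  by (simp add: f_total_def gamma_f_elem)

lemma e_total_zero: "e_total (\<lambda>_. 0) = e G1 \<squnion> e G2 \<squnion> e G3 \<squnion> e G4"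
  by (simp add: e_total_def)

lemma f_total_zero: "f_total (\<lambda>_. 0) = t_poly 1"
  unfolding total_f_one[symmetric] total_def cum_1 f_total_def by (simp add: f_adm_eq)

lemma s_poly_diag_sum: "n \<ge> 1 \<Longrightarrow> s_poly n = diag_sum e_total (n - 1)"
  using R_power[of s_poly n] s_poly_Suc R_power_diag_sum[of e_total, OF gamma_e_total]
  by (simp add: e_total_zero)

lemma t_poly_diag_sum: "n \<ge> 1 \<Longrightarrow> t_poly n = diag_sum f_total (n - 1)"
  using R_power[of t_poly n] t_poly_Suc R_power_diag_sum[of f_total, OF gamma_f_total]
  by (simp add: f_total_zero)

lemma diag_sum_e_total:
  "diag_sum e_total n =
     diag_sum (e_elem G1) n \<squnion> diag_sum (e_elem G2) n \<squnion> diag_sum (e_elem G3) n \<squnion> diag_sum (e_elem G4) n"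
    (is "_ = ?r")
proof (rule antisym)
  have u: "diag_sum (e_elem k) n \<le> ?r" for k by (cases k) (simp_all add: le_supI1)
  show "diag_sum e_total n \<le> ?r"
    unfolding e_total_def by (intro diag_sum_le sup_least order_trans[OF diag_sum_upper u]) simp_all
  have "diag_sum (e_elem k) n \<le> diag_sum e_total n" for k
  proof (rule diag_sum_le)
    fix r s t :: nat
    assume a: "r + s + t = n"
    have "e_elem k (counts t s r) \<le> e_total (counts t s r)"
      by (cases k) (simp_all add: e_total_def le_supI1)
    then show "e_elem k (counts t s r) \<le> diag_sum e_total n"
      using diag_sum_upper[OF a, of e_total] by (rule order_trans)
  qed
  then show "?r \<le> diag_sum e_total n" by simp
qed

lemma diag_swap:
  "{F r s t | r s t. r + s + t = (n :: nat)} = {F s r t | r s t. r + s + t = n}" (is "?A = ?B")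
  "{F r s t | r s t. r + s + t = n} = {F r t s | r s t. r + s + t = n}" (is "?A = ?C")
proof -
  have B: "F r s t \<in> ?B" "F r s t \<in> ?C" if "r + s + t = n" for r s t
    by (intro CollectI exI conjI, rule refl, use that in simp)+
  have A: "F s r t \<in> ?A" "F r t s \<in> ?A" if "r + s + t = n" for r s t
    by (intro CollectI exI conjI, rule refl, use that in simp)+
  show "?A = ?B"
  proof (intro subset_antisym subsetI)
    fix x assume "x \<in> ?A"
    then obtain r s t where "x = F r s t" "r + s + t = n" by (elim CollectE exE conjE)
    then show "x \<in> ?B" using B(1) by (simp only:)
  next
    fix x assume "x \<in> ?B"
    then obtain r s t where "x = F s r t" "r + s + t = n" by (elim CollectE exE conjE)
    then show "x \<in> ?A" using A(1) by (simp only:)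
  qed
  show "?A = ?C"
  proof (intro subset_antisym subsetI)
    fix x assume "x \<in> ?A"
    then obtain r s t where "x = F r s t" "r + s + t = n" by (elim CollectE exE conjE)
    then show "x \<in> ?C" using B(2) by (simp only:)
  next
    fix x assume "x \<in> ?C"
    then obtain r s t where "x = F r t s" "r + s + t = n" by (elim CollectE exE conjE)
    then show "x \<in> ?A" using A(2) by (simp only:)
  qed
qed

text \<open>For each \<open>i\<close> the three exponents appear in $e_i^\vee(n)$ in an order that depends on \<open>i\<close>; the sum runs
over all triples, so the order is irrelevant.\<close>

lemma e_inv_eq: "e_inv i n = diag_sum (e_elem i) (n - 1)"
proof -
  have rest: "rest {G1} = [G2, G3, G4]" "rest {G2} = [G1, G3, G4]" "rest {G3} = [G1, G2, G4]"
    "rest {G4} = [G1, G2, G3]" by (simp_all add: rest_def)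
  have a:
    "e G1 \<sqinter> atomic G2 G3 n = e G1 \<sqinter> atom G1 G4 n"
    "e G1 \<sqinter> atomic G3 G4 n = e G1 \<sqinter> atom G1 G2 n"
    "e G1 \<sqinter> atomic G2 G4 n = e G1 \<sqinter> atom G1 G3 n"
    "e G2 \<sqinter> atomic G1 G3 n = e G2 \<sqinter> atom G2 G3 n"
    "e G2 \<sqinter> atomic G3 G4 n = e G2 \<sqinter> atom G2 G2 n"
    "e G2 \<sqinter> atomic G1 G4 n = e G2 \<sqinter> atom G2 G4 n"
    "e G3 \<sqinter> atomic G1 G2 n = e G3 \<sqinter> atom G3 G2 n"
    "e G3 \<sqinter> atomic G2 G4 n = e G3 \<sqinter> atom G3 G3 n"
    "e G3 \<sqinter> atomic G1 G4 n = e G3 \<sqinter> atom G3 G4 n"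
    "e G4 \<sqinter> atomic G1 G2 n = e G4 \<sqinter> atom G4 G2 n"
    "e G4 \<sqinter> atomic G2 G3 n = e G4 \<sqinter> atom G4 G4 n"
    "e G4 \<sqinter> atomic G1 G3 n = e G4 \<sqinter> atom G4 G3 n"
    for n
    using e_inf_atomic[of G1 G4 G2 G3 n]
      e_inf_atomic[of G1 G2 G3 G4 n]
      e_inf_atomic[of G1 G3 G2 G4 n]
      e_inf_atomic[of G2 G4 G1 G3 n]
      e_inf_atomic[of G2 G1 G3 G4 n]
      e_inf_atomic[of G2 G3 G1 G4 n]
      e_inf_atomic[of G3 G4 G1 G2 n]
      e_inf_atomic[of G3 G1 G2 G4 n]
      e_inf_atomic[of G3 G2 G1 G4 n]
      e_inf_atomic[of G4 G3 G1 G2 n]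
      e_inf_atomic[of G4 G1 G2 G3 n]
      e_inf_atomic[of G4 G2 G1 G3 n]
    by (simp_all add: UNIV_idx_iff)
  have e_elem: "e_elem i c = (e i \<sqinter> atom i G2 (c G2)) \<sqinter> (e i \<sqinter> atom i G3 (c G3)) \<sqinter> (e i \<sqinter> atom i G4 (c G4))"
    for c by (simp add: e_elem_def ac_simps)
  define f where "f r s t = e i \<sqinter> atomic (rest {i} ! 0) (rest {i} ! 1) r \<sqinter>
    atomic (rest {i} ! 1) (rest {i} ! 2) s \<sqinter> atomic (rest {i} ! 0) (rest {i} ! 2) t" for r s t
  have f: "f r s t = (e i \<sqinter> atomic (rest {i} ! 0) (rest {i} ! 1) r) \<sqinter>
    (e i \<sqinter> atomic (rest {i} ! 1) (rest {i} ! 2) s) \<sqinter> (e i \<sqinter> atomic (rest {i} ! 0) (rest {i} ! 2) t)"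
    for r s t by (simp add: f_def ac_simps)
  have "{f r s t | r s t. r + s + t = n - 1} = {e_elem i (counts t s r) | r s t. r + s + t = n - 1}"
  proof (cases i)
    case G1
    have "f r s t = e_elem i (counts s t r)" for r s t
      unfolding f e_elem by (simp only: G1 rest a nth_Cons_0 nth_Cons_Suc One_nat_def numeral_2_eq_2)
        (simp add: ac_simps)
    then show ?thesis
      using diag_swap(2)[of "\<lambda>r s t. e_elem i (counts s t r)" "n - 1"]
      by (simp only:)
  next
    case G2
    have "f r s t = e_elem i (counts s r t)" for r s t
      unfolding f e_elem by (simp only: G2 rest a nth_Cons_0 nth_Cons_Suc One_nat_def numeral_2_eq_2)
        (simp add: ac_simps)
    then show ?thesis
      using diag_swap(2)[of "\<lambda>r s t. e_elem i (counts s r t)" "n - 1"]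
        diag_swap(1)[of "\<lambda>r s t. e_elem i (counts t r s)" "n - 1"]
      by (simp only:)
  next
    case G3
    have "f r s t = e_elem i (counts r s t)" for r s t
      unfolding f e_elem by (simp only: G3 rest a nth_Cons_0 nth_Cons_Suc One_nat_def numeral_2_eq_2)
        (simp add: ac_simps)
    then show ?thesis
      using diag_swap(1)[of "\<lambda>r s t. e_elem i (counts r s t)" "n - 1"]
        diag_swap(2)[of "\<lambda>r s t. e_elem i (counts s r t)" "n - 1"]
        diag_swap(1)[of "\<lambda>r s t. e_elem i (counts t r s)" "n - 1"]
      by (simp only:)
  next
    case G4
    have "f r s t = e_elem i (counts r t s)" for r s t
      unfolding f e_elem by (simp only: G4 rest a nth_Cons_0 nth_Cons_Suc One_nat_def numeral_2_eq_2)
        (simp add: ac_simps)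
    then show ?thesis
      using diag_swap(1)[of "\<lambda>r s t. e_elem i (counts r t s)" "n - 1"]
        diag_swap(2)[of "\<lambda>r s t. e_elem i (counts s t r)" "n - 1"]
      by (simp only:)
  qed
  then show ?thesis unfolding e_inv_def diag_sum_def Let_def f_def by (rule arg_cong)
qed

section \<open>Perfect elements\<close>

lemma h_eq:
  assumes "{i, j, k, l} = UNIV"
  shows "h i n = e_cum j n \<squnion> e_cum k n \<squnion> e_cum l n"
  unfolding h_def compl_single[OF assms] by (simp add: sup_assoc)

lemma h_eqs:
  "h G1 n = e_cum G2 n \<squnion> e_cum G3 n \<squnion> e_cum G4 n"
  "h G2 n = e_cum G1 n \<squnion> e_cum G3 n \<squnion> e_cum G4 n"
  "h G3 n = e_cum G1 n \<squnion> e_cum G2 n \<squnion> e_cum G4 n"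
  "h G4 n = e_cum G1 n \<squnion> e_cum G2 n \<squnion> e_cum G3 n"
  by (rule h_eq, simp add: UNIV_idx_iff)+

lemma h_max_eq: "h_max n = total e_adm n"
  unfolding h_max_def h_eqs total_def e_cum_eq
  by (rule antisym) (auto intro: le_supI1 le_supI2)

lemma h_in_B: "h i n \<in> B_plus n"
  unfolding B_plus_def by (rule subl_base) simp

lemma h_max_in_B: "h_max n \<in> B_plus n"
  unfolding h_max_def using h_in_B unfolding B_plus_def by (intro subl_sup) auto

lemma h_min_in_B: "h_min n \<in> B_plus n"
  unfolding h_min_def using h_in_B unfolding B_plus_def by (intro subl_inf) auto

lemma h_triple_in_B: "h i n \<sqinter> h j n \<sqinter> h k n \<in> B_plus n"
  using h_in_B unfolding B_plus_def by (intro subl_inf) auto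

lemma h_bounds: "h_min n \<le> h i n" "h i n \<le> h_max n"
  unfolding h_min_def h_max_def by (cases i; simp add: le_supI1 le_infI1)+

lemma B_bounds: "x \<in> B_plus n \<Longrightarrow> h_min n \<le> x \<and> x \<le> h_max n"
  unfolding B_plus_def
  by (induction rule: sublattice.induct) (auto simp: h_bounds le_supI1 le_infI1)

lemma h_triple:
  assumes "{i, j, k, l} = UNIV"
  shows "h j n \<sqinter> h k n \<sqinter> h l n = e_cum i n \<squnion> h_min n"
proof -
  let ?e = "\<lambda>i. e_cum i n"
  have l: "{j, i, k, l} = UNIV" "{k, i, j, l} = UNIV" "{l, i, j, k} = UNIV"
    using assms by (simp_all add: insert_commute)
  have "h_min n = h l n \<sqinter> h k n \<sqinter> h j n \<sqinter> h i n"
  proof -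
    have "Inf_fin ((\<lambda>m. h m n) ` {l, k, j, i}) = Inf_fin ((\<lambda>m. h m n) ` {G1, G2, G3, G4})"
    proof -
      have "{l, k, j, i} = {G1, G2, G3, G4}"
        using assms unfolding UNIV_idx by (simp add: insert_commute)
      then show ?thesis by (rule arg_cong)
    qed
    then show ?thesis by (simp add: h_min_def inf_assoc)
  qed
  moreover have "h l n \<sqinter> h k n \<sqinter> h j n = ?e i \<squnion> h l n \<sqinter> h k n \<sqinter> h j n \<sqinter> h i n"
    unfolding h_eq[OF assms] h_eq[OF l(1)] h_eq[OF l(2)] h_eq[OF l(3)] by (rule meet3_eq)
  ultimately show ?thesis by (simp only: ac_simps)
qed

lemma h_Suc:
  assumes "n \<ge> 1"
  shows
    "h G1 (Suc n) = gamma G1 G2 (h G2 n) \<squnion> gamma G1 G3 (h G3 n) \<squnion> gamma G1 G4 (h G4 n)"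
    "h G2 (Suc n) = gamma G1 G2 (h G1 n) \<squnion> gamma G1 G4 (h G3 n) \<squnion> gamma G1 G3 (h G4 n)"
    "h G3 (Suc n) = gamma G1 G3 (h G1 n) \<squnion> gamma G1 G4 (h G2 n) \<squnion> gamma G1 G2 (h G4 n)"
    "h G4 (Suc n) = gamma G1 G4 (h G1 n) \<squnion> gamma G1 G3 (h G2 n) \<squnion> gamma G1 G2 (h G3 n)"
  unfolding h_eqs e_cum_eq cum_Suc_all[OF snoc_compat_e assms] by (simp_all add: ac_simps)

lemma h_min_one: "h_min 1 = t_poly 1"
  unfolding h_min_def h_eqs e_cum_eq cum_1 by (simp add: e_adm_eq ac_simps)

text \<open>$t_{n+1}$ and all four $h_i(n+1)$ are sums of the same three endomorphisms, applied to $t_n$ in the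
first case and to various $h_j(n) \ge t_n$ in the others.\<close>

lemma t_poly_le_h_min: "n \<ge> 1 \<Longrightarrow> t_poly n \<le> h_min n"
proof (induction n rule: nat_induct_at_least)
  case base
  show ?case by (simp only: h_min_one order_refl)
next
  case (Suc n)
  have "gamma G1 p (t_poly n) \<le> gamma G1 p (h i n)" for p i
    by (intro gamma_mono order_trans[OF Suc.IH] h_bounds)
  then show ?case
    unfolding t_poly_Suc[OF Suc.hyps] R_def h_min_def h_Suc[OF Suc.hyps]
    by (auto intro: le_supI1 le_supI2)
qed

section \<open>Representations and their retractions\<close>

lemma sum_labels:
  fixes f :: "idx \<Rightarrow> 'a::ab_group_add"
  assumes "{i, j, k, l} = UNIV"
  shows "sum f UNIV = f i + f j + f k + f l"
proof -
  have "sum f {i, j, k, l} = f i + f j + f k + f l"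
    using assms unfolding UNIV_idx_iff by (simp add: add.assoc)
  then show ?thesis by (simp only: assms)
qed

text \<open>Evaluation of lattice terms by sum and intersection. It respects the congruence \<^const>\<open>meq\<close> because
subspaces form a modular lattice, and so defines representations of $D^4$.\<close>

primrec eval_sub :: "('x \<Rightarrow> 'b::ab_group_add set) \<Rightarrow> 'x lterm \<Rightarrow> 'b set" where
  "eval_sub A (Gen m) = A m"
| "eval_sub A (Join s t) = {x + y | x y. x \<in> eval_sub A s \<and> y \<in> eval_sub A t}"
| "eval_sub A (Meet s t) = eval_sub A s \<inter> eval_sub A t"

context vector_space
begin

text \<open>Representations of arbitrary dimension in \<open>\<rho> \<top>\<close>.\<close>

definition rep :: "(d4 \<Rightarrow> 'b set) \<Rightarrow> bool" where
  "rep \<rho> \<longleftrightarrow> (\<forall>a. subspace (\<rho> a)) \<and>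
     (\<forall>a b. \<rho> (a \<squnion> b) = subspace_sum (\<rho> a) (\<rho> b) \<and> \<rho> (a \<sqinter> b) = \<rho> a \<inter> \<rho> b) \<and> \<rho> \<bottom> = {0}"

lemma rep_subspace: "rep \<rho> \<Longrightarrow> subspace (\<rho> a)"
  by (simp add: rep_def)

lemma rep_inf: "rep \<rho> \<Longrightarrow> \<rho> (a \<sqinter> b) = \<rho> a \<inter> \<rho> b"
  by (simp add: rep_def)

lemma rep_sup: "rep \<rho> \<Longrightarrow> x \<in> \<rho> (a \<squnion> b) \<longleftrightarrow> (\<exists>y z. x = y + z \<and> y \<in> \<rho> a \<and> z \<in> \<rho> b)"
  by (simp add: rep_def subspace_sum_def)

lemma rep_mono: "rep \<rho> \<Longrightarrow> a \<le> b \<Longrightarrow> \<rho> a \<subseteq> \<rho> b"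
  by (metis inf.orderE inf_le2 rep_inf)

lemma rep_0: "rep \<rho> \<Longrightarrow> 0 \<in> \<rho> a"
  by (simp add: rep_def subspace_0)

lemma rep_add: "rep \<rho> \<Longrightarrow> x \<in> \<rho> a \<Longrightarrow> y \<in> \<rho> a \<Longrightarrow> x + y \<in> \<rho> a"
  by (simp add: rep_def subspace_add)

lemma rep_diff: "rep \<rho> \<Longrightarrow> x \<in> \<rho> a \<Longrightarrow> y \<in> \<rho> a \<Longrightarrow> x - y \<in> \<rho> a"
  by (simp add: rep_def subspace_diff)

lemma rep_neg: "rep \<rho> \<Longrightarrow> x \<in> \<rho> a \<Longrightarrow> - x \<in> \<rho> a"
  by (simp add: rep_def subspace_neg)

lemma rep_Sup_fin:
  assumes "rep \<rho>" "finite A" "A \<noteq> {}" "subspace W" "\<And>a. a \<in> A \<Longrightarrow> \<rho> a \<subseteq> W"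
  shows "\<rho> (Sup_fin A) \<subseteq> W"
  using assms(2,3,5)
proof (induction A rule: finite_ne_induct)
  case (insert a A)
  then have "\<rho> a \<subseteq> W" "\<rho> (Sup_fin A) \<subseteq> W" by auto
  moreover have "\<rho> (Sup_fin (insert a A)) = \<rho> (a \<squnion> Sup_fin A)"
    using insert.hyps by simp
  moreover have "\<rho> (a \<squnion> Sup_fin A) \<subseteq> W"
  proof
    fix x
    assume "x \<in> \<rho> (a \<squnion> Sup_fin A)"
    then obtain y z where "x = y + z" "y \<in> \<rho> a" "z \<in> \<rho> (Sup_fin A)"
      by (auto simp: rep_sup[OF assms(1)])
    then show "x \<in> W" using calculation(1,2) assms(4) by (blast intro: subspace_add)
  qed
  ultimately show ?case by simp
qed simp

lemma subspace_eval_sub: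
  assumes "\<And>m. subspace (A m)"
  shows "subspace (eval_sub A t)"
  by (induction t) (simp_all add: assms subspace_sums subspace_inter)

lemma eval_sub_meq:
  assumes "\<And>m. subspace (A m)" "meq s t"
  shows "eval_sub A s = eval_sub A t"
proof -
  have sub: "subspace (eval_sub A t)" for t
    by (rule subspace_eval_sub) (rule assms(1))
  show ?thesis
    using assms(2)
  proof induction
    case (meq_join_comm x y)
    show ?case by (rule set_eqI) (simp, metis add.commute)
  next
    case (meq_join_assoc x y z)
    have "v \<in> eval_sub A (Join (Join x y) z) \<longleftrightarrow>
        (\<exists>a b c. v = a + b + c \<and> a \<in> eval_sub A x \<and> b \<in> eval_sub A y \<and> c \<in> eval_sub A z)" for v
      unfolding eval_sub.simps by blast
    moreover have "v \<in> eval_sub A (Join x (Join y z)) \<longleftrightarrow>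
        (\<exists>a b c. v = a + (b + c) \<and> a \<in> eval_sub A x \<and> b \<in> eval_sub A y \<and> c \<in> eval_sub A z)" for v
      unfolding eval_sub.simps by blast
    ultimately show ?case by (simp only: add.assoc set_eq_iff simp_thms)
  next
    case (meq_join_absorb x y)
    have "v + 0 \<in> eval_sub A (Join x (Meet x y))" if "v \<in> eval_sub A x" for v
      using that subspace_0[OF sub] unfolding eval_sub.simps by blast
    moreover have "eval_sub A (Join x (Meet x y)) \<subseteq> eval_sub A x"
      using subspace_add[OF sub] by auto
    ultimately show ?case by auto
  next
    case (meq_meet_absorb x y)
    have "v + 0 \<in> eval_sub A (Join x y)" if "v \<in> eval_sub A x" for v
      using that subspace_0[OF sub] unfolding eval_sub.simps by blast
    then show ?case by auto
  next
    case (meq_modular x z y)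
    have "v \<in> eval_sub A z" if "u + v \<in> eval_sub A z" "u \<in> eval_sub A z" for u v
      using subspace_diff[OF sub that] by simp
    then have "eval_sub A (Meet (Join (Meet x z) y) z) \<subseteq> eval_sub A (Join (Meet x z) (Meet y z))"
      unfolding eval_sub.simps by blast
    moreover have "eval_sub A (Join (Meet x z) (Meet y z)) \<subseteq> eval_sub A (Meet (Join (Meet x z) y) z)"
      using subspace_add[OF sub[of z]] unfolding eval_sub.simps by blast
    ultimately show ?case by (rule subset_antisym[rotated])
  qed auto
qed

lemma rep_exists:
  assumes V: "subspace V" and A: "\<And>i. subspace (A i)" "\<And>i. A i \<subseteq> V"
  shows "\<exists>\<rho>. rep \<rho> \<and> \<rho> \<top> = V \<and> (\<forall>i. \<rho> (e i) = A i)"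
proof -
  define g where "g u = eval_sub A (rep_free_mod u)" for u
  have g: "g (abs_free_mod t) = eval_sub A t" for t
    unfolding g_def
    by (intro eval_sub_meq A) (rule rep_abs_rsp_left[OF Quotient3_free_mod meq_refl])
  have gs: "subspace (g u)" for u unfolding g_def by (intro subspace_eval_sub A)
  have evV: "eval_sub A t \<subseteq> V" for t
    by (induction t) (use A V in \<open>auto intro: subspace_add\<close>)
  then have gV: "g u \<subseteq> V" for u unfolding g_def .
  have gop: "g (x \<squnion> y) = subspace_sum (g x) (g y) \<and> g (x \<sqinter> y) = g x \<inter> g y" for x y
    by (induction x rule: free_mod.abs_induct, induction y rule: free_mod.abs_induct)
      (simp add: g sup_free_mod.abs_eq inf_free_mod.abs_eq subspace_sum_def)
  define \<rho> where "\<rho> a = (case a of Bot \<Rightarrow> {0} | Mid u \<Rightarrow> g u | Top \<Rightarrow> V)" for a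
  have [simp]: "subspace_sum {0} W = W" "subspace_sum W {0} = W" for W
    by (auto simp: subspace_sum_def)
  have [simp]: "subspace_sum V W = V" "subspace_sum W V = V" if "subspace W" "W \<subseteq> V" for W
    using that V unfolding subspace_sum_def
    by (auto intro: subspace_add) (metis add.right_neutral add.left_neutral subspace_0)+
  have s: "subspace (\<rho> a)" for a
    by (cases a) (simp_all add: \<rho>_def gs V)
  have 0: "0 \<in> g u" "0 \<in> V" for u using gs V by (simp_all add: subspace_0)
  have op: "\<rho> (a \<squnion> b) = subspace_sum (\<rho> a) (\<rho> b) \<and> \<rho> (a \<sqinter> b) = \<rho> a \<inter> \<rho> b" for a b
    by (cases a; cases b) (use gV gop gs V 0 in \<open>auto simp: \<rho>_def\<close>)
  have "rep \<rho>" using s op by (simp add: rep_def bot_d4_def) (simp add: \<rho>_def)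
  moreover have "\<rho> \<top> = V" by (simp add: \<rho>_def top_d4_def)
  moreover have "\<rho> (e i) = A i" for i by (simp add: \<rho>_def e_def fgen.abs_eq g)
  ultimately show ?thesis by blast
qed

text \<open>The complement is the part of \<open>T\<close> in the kernel of a linear map that is the identity on a basis of
\<open>S\<close> and kills the elements that extend it to a basis of \<open>T\<close>.\<close>

lemma complement_exists:
  assumes "subspace S" "subspace T" "S \<subseteq> T"
  shows "\<exists>C. subspace C \<and> C \<subseteq> T \<and> S \<inter> C = {0} \<and> (\<forall>x \<in> T. \<exists>a \<in> S. \<exists>c \<in> C. x = a + c)"
proof -
  interpret pair: vector_space_pair scale scale ..
  obtain B where B: "B \<subseteq> S" "independent B" "S \<subseteq> span B"
    using maximal_independent_subset[of S] by blast
  obtain B' where B': "B \<subseteq> B'" "B' \<subseteq> T" "independent B'" "T \<subseteq> span B'"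
    using maximal_independent_subset_extend[of B T] B assms(3) by blast
  obtain p where p: "Vector_Spaces.linear scale scale p" "\<forall>x \<in> B'. p x = (if x \<in> B then x else 0)"
    using pair.linear_independent_extend[OF B'(3), of "\<lambda>x. if x \<in> B then x else 0"] by blast
  interpret p: Vector_Spaces.linear scale scale p by (rule p(1))
  have spB: "span B = S" using B assms(1) span_subspace by blast
  have pS: "p x = x" if "x \<in> S" for x
  proof -
    have "x \<in> span B" using that spB by simp
    then show ?thesis
        by (rule pair.linear_eq_on[OF p(1) linear_ident]) (use B' p(2) in auto)
  qed
  have pT: "p x \<in> S" if "x \<in> T" for x
  proof -
    have "p x \<in> p ` span B'" using that B' by blast
    also have "p ` span B' = span (p ` B')" by (rule p.span_image[symmetric])
    also have "\<dots> \<subseteq> S" using p(2) B(1) assms(1) by (intro span_minimal) (auto simp: subspace_0)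
    finally show ?thesis .
  qed
  let ?C = "{x \<in> T. p x = 0}"
  have "subspace ?C"
    using assms(2) unfolding subspace_def by (auto simp: p.add p.scale p.zero)
  moreover have "S \<inter> ?C = {0}"
    using pS assms by (auto simp: p.zero subspace_0)
  moreover have "\<exists>a \<in> S. \<exists>c \<in> ?C. x = a + c" if "x \<in> T" for x
  proof (intro bexI)
    show "x = p x + (x - p x)" by simp
    have "p x \<in> T" using pT[OF that] assms(3) by blast
    then show "x - p x \<in> ?C" using that assms(2) pS[OF pT[OF that]]
      by (simp add: subspace_diff p.diff)
    show "p x \<in> S" by (rule pT[OF that])
  qed
  ultimately show ?thesis by blast
qed

text \<open>An additive idempotent endomorphism of the representation with image \<open>\<rho> a\<close>; it splits off \<open>\<rho> a\<close> as a
direct summand.\<close>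

definition retraction :: "(d4 \<Rightarrow> 'b set) \<Rightarrow> d4 \<Rightarrow> ('b \<Rightarrow> 'b) \<Rightarrow> bool" where
  "retraction \<rho> a p \<longleftrightarrow> (\<forall>x \<in> \<rho> \<top>. \<forall>y \<in> \<rho> \<top>. p (x + y) = p x + p y) \<and>
     (\<forall>i. \<forall>x \<in> \<rho> (e i). p x \<in> \<rho> (e i)) \<and> (\<forall>x \<in> \<rho> \<top>. p x \<in> \<rho> a) \<and> (\<forall>x \<in> \<rho> a. p x = x)"

lemma rep_top: "rep \<rho> \<Longrightarrow> x \<in> \<rho> a \<Longrightarrow> x \<in> \<rho> \<top>"
  using rep_mono[of \<rho> a \<top>] by auto

text \<open>An endomorphism that preserves the generators preserves every lattice polynomial in them.\<close>

lemma retraction_preserves: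
  assumes "rep \<rho>" "retraction \<rho> a p" "x \<in> \<rho> b"
  shows "p x \<in> \<rho> b"
  using assms(3)
proof (induction b arbitrary: x rule: d4_induct)
  case bot
  have "p 0 = 0" using assms(1,2) rep_0[OF assms(1), of a] by (simp add: retraction_def)
  then show ?case using bot assms(1) by (simp add: rep_def)
next
  case top
  then have "p x \<in> \<rho> a" using assms(2) by (simp add: retraction_def)
  then show ?case by (rule rep_top[OF assms(1)])
next
  case (gen m)
  then show ?case using assms(2) by (simp add: retraction_def)
next
  case (sup b c)
  then obtain y z where "x = y + z" "y \<in> \<rho> b" "z \<in> \<rho> c" by (auto simp: rep_sup[OF assms(1)])
  moreover from this have "p x = p y + p z"
    using assms(2) rep_top[OF assms(1)] by (auto simp: retraction_def)
  ultimately show ?case using sup.IH by (auto simp: rep_sup[OF assms(1)])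
next
  case (inf b c)
  then show ?case by (simp add: rep_inf[OF assms(1)])
qed

text \<open>\<open>r\<close> maps everything into \<open>\<rho> b\<close>, and \<open>p\<close> keeps it there by \<open>retraction_preserves\<close>.\<close>

lemma retraction_comp:
  assumes "rep \<rho>" "retraction \<rho> a p" "retraction \<rho> b r"
  shows "retraction \<rho> (a \<sqinter> b) (p \<circ> r)"
  unfolding retraction_def
proof (intro conjI ballI allI)
  note pres = retraction_preserves[OF assms(1)]
  fix x y assume "x \<in> \<rho> \<top>" "y \<in> \<rho> \<top>"
  moreover from this have "r x \<in> \<rho> \<top>" "r y \<in> \<rho> \<top>" using pres assms(3) by blast+
  ultimately show "(p \<circ> r) (x + y) = (p \<circ> r) x + (p \<circ> r) y"
    using assms(2,3) by (simp add: retraction_def)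
next
  fix i x assume "x \<in> \<rho> (e i)"
  then show "(p \<circ> r) x \<in> \<rho> (e i)" using assms(2,3) by (simp add: retraction_def)
next
  fix x assume x: "x \<in> \<rho> \<top>"
  then have "r x \<in> \<rho> b" using assms(3) by (simp add: retraction_def)
  then have "p (r x) \<in> \<rho> b" "p (r x) \<in> \<rho> a"
    using retraction_preserves[OF assms(1,2)] rep_top[OF assms(1)] assms(2) by (auto simp: retraction_def)
  then show "(p \<circ> r) x \<in> \<rho> (a \<sqinter> b)" by (simp add: rep_inf[OF assms(1)])
next
  fix x assume "x \<in> \<rho> (a \<sqinter> b)"
  then show "(p \<circ> r) x = x" using assms by (simp add: retraction_def rep_inf)
qed

text \<open>$h_s(1)$ contains all generators except $e_s$. The kernel \<open>K\<close> of the retraction is chosen so that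
$e_s$ splits: first a complement of $e_sh_s(1)$ in $e_s$, then a complement of the rest.\<close>

lemma retraction_h_one:
  assumes "rep \<rho>"
  shows "\<exists>p. retraction \<rho> (h s 1) p"
proof -
  define H where "H = \<rho> (h s 1)"
  define X where "X = \<rho> (e s)"
  define V where "V = \<rho> \<top>"
  note q = assms
  have sub: "subspace H" "subspace X" "subspace V"
    unfolding H_def X_def V_def by (rule rep_subspace[OF q])+
  have HV: "H \<subseteq> V" "X \<subseteq> V" unfolding H_def X_def V_def by (rule rep_mono[OF q]; simp)+
  obtain C where C: "subspace C" "C \<subseteq> X" "(X \<inter> H) \<inter> C = {0}"
    "\<And>x. x \<in> X \<Longrightarrow> \<exists>a \<in> X \<inter> H. \<exists>c \<in> C. x = a + c"
  proof -
    have "\<exists>C. subspace C \<and> C \<subseteq> X \<and> (X \<inter> H) \<inter> C = {0} \<and>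
        (\<forall>x \<in> X. \<exists>a \<in> X \<inter> H. \<exists>c \<in> C. x = a + c)"
      by (rule complement_exists) (use sub in \<open>simp_all add: subspace_inter\<close>)
    then show ?thesis using that by metis
  qed
  let ?HC = "{x + y | x y. x \<in> H \<and> y \<in> C}"
  have HC: "?HC \<subseteq> V" using HV C(2) subspace_add[OF sub(3)] by blast
  obtain D where D: "subspace D" "D \<subseteq> V" "?HC \<inter> D = {0}"
    "\<forall>x \<in> V. \<exists>a \<in> ?HC. \<exists>d \<in> D. x = a + d"
    using complement_exists[OF subspace_sums[OF sub(1) C(1)] sub(3) HC] by (elim exE conjE)
  define K where "K = {x + y | x y. x \<in> C \<and> y \<in> D}"
  have K: "subspace K" unfolding K_def by (rule subspace_sums[OF C(1) D(1)])
  have HK: "x = 0" if xHK: "x \<in> H" "x \<in> K" for x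
  proof -
    obtain c d where cd: "x = c + d" "c \<in> C" "d \<in> D" using xHK(2) unfolding K_def by blast
    have "d = x + (- c)" using cd by simp
    moreover have "- c \<in> C" using cd C(1) by (simp add: subspace_neg)
    ultimately have "d \<in> ?HC" using xHK by blast
    then have "d = 0" using cd D(3) by blast
    then have "x \<in> (X \<inter> H) \<inter> C" using cd xHK C(2) by auto
    then show ?thesis using C(3) by blast
  qed
  have VK: "\<exists>a. a \<in> H \<and> x - a \<in> K" if xV: "x \<in> V" for x
  proof -
    obtain y d where "y \<in> ?HC" "d \<in> D" "x = y + d" using bspec[OF D(4) xV] by (elim bexE)
    moreover then obtain a c where "y = a + c" "a \<in> H" "c \<in> C" by blast
    ultimately show ?thesis by (intro exI[of _ a]) (auto simp: K_def)
  qed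
  \<comment> \<open>the component in \<open>H\<close> along \<open>K\<close>\<close>
  define p where "p x = (SOME a. a \<in> H \<and> x - a \<in> K)" for x
  have p: "p x \<in> H" "x - p x \<in> K" if "x \<in> V" for x
    using someI_ex[OF VK[OF that]] by (simp_all add: p_def)
  have pI: "p x = a" if "x \<in> V" "a \<in> H" "x - a \<in> K" for x a
  proof -
    have "p x - a \<in> H" using p(1)[OF that(1)] that(2) sub(1) by (simp add: subspace_diff)
    moreover have "p x - a = (x - a) - (x - p x)" by simp
    then have "p x - a \<in> K" using p(2)[OF that(1)] that(3) K by (metis subspace_diff)
    ultimately have "p x - a = 0" by (rule HK)
    then show ?thesis by simp
  qed
  have pH: "p x = x" if "x \<in> H" for x
    using that HV by (intro pI) (auto simp: K subspace_0)
  have "retraction \<rho> (h s 1) p"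
    unfolding retraction_def H_def[symmetric] V_def[symmetric]
  proof (intro conjI ballI allI)
    fix x y assume xy: "x \<in> V" "y \<in> V"
    show "p (x + y) = p x + p y"
    proof (rule pI)
      have "x + y - (p x + p y) = (x - p x) + (y - p y)" by simp
      then show "x + y - (p x + p y) \<in> K" using p(2) xy K by (metis subspace_add)
    qed (use xy sub p(1) in \<open>auto intro: subspace_add\<close>)
  next
    fix i x assume x: "x \<in> \<rho> (e i)"
    show "p x \<in> \<rho> (e i)"
    proof (cases "i = s")
      case True
      then have "x \<in> X" using x by (simp add: X_def)
      then obtain a c where ac: "a \<in> X" "a \<in> H" "c \<in> C" "x = a + c" using C(4) by blast
      have "0 \<in> D" using D(1) by (rule subspace_0)
      then have "c \<in> K" using ac(3) by (force simp: K_def)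
      then have "p x = a" using ac \<open>x \<in> X\<close> HV by (intro pI) auto
      then show ?thesis using ac True by (simp add: X_def)
    next
      case False
      have "e i = e_cum i 1" unfolding e_cum_eq cum_1 by (simp add: e_adm_eq)
      also have "\<dots> \<le> h s 1" unfolding h_def using False by (intro Sup_fin.coboundedI) auto
      finally have "x \<in> H" using x rep_mono[OF q] unfolding H_def by blast
      then show ?thesis using x by (simp add: pH)
    qed
  qed (use p pH in auto)
  then show ?thesis by blast
qed

end

section \<open>The Coxeter functor\<close>

text \<open>The three atomic factors with explicit upper indices, for comparing the elements belonging to two
different generators.\<close>

lemma e_elem_three:
  assumes "{k, m, a, b} = UNIV"
  shows "e_elem k c = (e k \<sqinter> atomic a b (c (k \<oplus> m))) \<sqinter> (e k \<sqinter> atomic m b (c (k \<oplus> a))) \<sqinter>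
    (e k \<sqinter> atomic m a (c (k \<oplus> b)))"
proof -
  have l: "{k, a, m, b} = UNIV" "{k, b, m, a} = UNIV" using assms by (simp_all add: insert_commute)
  have "{G1, k \<oplus> m, k \<oplus> a, k \<oplus> b} = UNIV"
    using assms unfolding UNIV_idx_iff by (auto simp: eq_commute[of G1])
  from e_elem_eq[OF this, of k c] show ?thesis
    unfolding e_inf_atomic[OF assms] e_inf_atomic[OF l(1)] e_inf_atomic[OF l(2)]
    by (simp add: ac_simps)
qed

text \<open>A vector space with a linear map onto its own fourth power, with components \<open>\<phi>\<close>. Families of four
vectors are thus encoded by single vectors, and the Coxeter functor, which produces subspaces of such
families, leads to representations in the same space, so that it can be iterated.\<close>

locale quarter = vector_space scale
  for scale :: "'k::field \<Rightarrow> 'u::ab_group_add \<Rightarrow> 'u" +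
  fixes \<phi> :: "idx \<Rightarrow> 'u \<Rightarrow> 'u"
  assumes \<phi>_add: "\<phi> i (x + y) = \<phi> i x + \<phi> i y"
    and \<phi>_scale: "\<phi> i (scale a x) = scale a (\<phi> i x)"
    and \<phi>_surj: "\<exists>x. \<forall>i. \<phi> i x = g i"
begin

lemma \<phi>_0 [simp]: "\<phi> i 0 = 0"
  using \<phi>_add[of i 0 0] by simp

lemma \<phi>_neg: "\<phi> i (- x) = - \<phi> i x"
  using \<phi>_add[of i x "- x"] by (simp add: eq_neg_iff_add_eq_0 add.commute)

lemma \<phi>_diff: "\<phi> i (x - y) = \<phi> i x - \<phi> i y"
  using \<phi>_add[of i x "- y"] by (simp add: \<phi>_neg)

lemma subspace_vimage_\<phi>: "subspace W \<Longrightarrow> subspace {x. \<phi> i x \<in> W}"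
  by (simp add: subspace_def \<phi>_add \<phi>_scale)

lemma \<phi>_obtain:
  assumes "{i, j, k, l} = UNIV"
  obtains x where "\<phi> i x = a" "\<phi> j x = b" "\<phi> k x = c" "\<phi> l x = d"
proof -
  obtain x where "\<forall>m. \<phi> m x = (if m = i then a else if m = j then b else if m = k then c else d)"
    using \<phi>_surj[of "\<lambda>m. if m = i then a else if m = j then b else if m = k then c else d"] by blast
  moreover have "j \<noteq> i" "k \<noteq> i" "k \<noteq> j" "l \<noteq> i" "l \<noteq> j" "l \<noteq> k"
    using assms by (auto simp: UNIV_idx_iff)
  ultimately have "\<phi> i x = a" "\<phi> j x = b" "\<phi> k x = c" "\<phi> l x = d" by simp_all
  then show ?thesis by (rule that)
qed

definition plus_space :: "(d4 \<Rightarrow> 'u set) \<Rightarrow> 'u set" where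
  "plus_space \<rho> = {x. (\<forall>i. \<phi> i x \<in> \<rho> (e i)) \<and> (\<Sum>i\<in>UNIV. \<phi> i x) = 0}"

text \<open>\<open>\<rho>'\<close> is $\rho^+$, with a family $(x_i)$ encoded by the vectors \<open>x\<close> that have the components $x_i$.\<close>

definition coxeter :: "(d4 \<Rightarrow> 'u set) \<Rightarrow> (d4 \<Rightarrow> 'u set) \<Rightarrow> bool" where
  "coxeter \<rho> \<rho>' \<longleftrightarrow> rep \<rho> \<and> rep \<rho>' \<and> \<rho>' \<top> = plus_space \<rho> \<and>
     (\<forall>i. \<rho>' (e i) = {x \<in> plus_space \<rho>. \<phi> i x = 0})"

lemma coxeter_exists:
  assumes "rep \<rho>"
  shows "\<exists>\<rho>'. coxeter \<rho> \<rho>'"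
proof -
  have V: "subspace (plus_space \<rho>)"
    unfolding subspace_def
  proof (intro conjI ballI allI)
    show "0 \<in> plus_space \<rho>" by (simp add: plus_space_def rep_0[OF assms])
    show "x + y \<in> plus_space \<rho>" if "x \<in> plus_space \<rho>" "y \<in> plus_space \<rho>" for x y
      using that by (simp add: plus_space_def \<phi>_add sum.distrib rep_add[OF assms])
    show "scale a x \<in> plus_space \<rho>" if "x \<in> plus_space \<rho>" for a x
      using that subspace_scale[OF rep_subspace[OF assms]]
      by (simp add: plus_space_def \<phi>_scale scale_sum_right[symmetric])
  qed
  have A: "subspace {x \<in> plus_space \<rho>. \<phi> i x = 0}" for i
    using subspace_inter[OF V subspace_vimage_\<phi>[OF subspace_single_0, of i]]
    by (simp add: Int_def)
  have "\<exists>\<rho>'. rep \<rho>' \<and> \<rho>' \<top> = plus_space \<rho> \<and> (\<forall>i. \<rho>' (e i) = {x \<in> plus_space \<rho>. \<phi> i x = 0})"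
    by (rule rep_exists[OF V A]) blast
  then show ?thesis
    unfolding coxeter_def using assms by (simp only: simp_thms)
qed

end

locale coxeter_pair = quarter scale \<phi>
  for scale :: "'k::field \<Rightarrow> 'u::ab_group_add \<Rightarrow> 'u" and \<phi> :: "idx \<Rightarrow> 'u \<Rightarrow> 'u" +
  fixes \<rho> \<rho>' :: "d4 \<Rightarrow> 'u set"
  assumes cox: "coxeter \<rho> \<rho>'"
begin

lemma q: "rep \<rho>" and q': "rep \<rho>'"
  using cox by (simp_all add: coxeter_def)

lemma top': "\<rho>' \<top> = plus_space \<rho>" and gen': "\<rho>' (e i) = {x \<in> plus_space \<rho>. \<phi> i x = 0}"
  using cox by (simp_all add: coxeter_def)

lemma in_plus_space: "x \<in> \<rho>' a \<Longrightarrow> x \<in> plus_space \<rho>"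
  using rep_top[OF q', of x a] unfolding top' .

lemma \<phi>_in: "x \<in> plus_space \<rho> \<Longrightarrow> \<phi> i x \<in> \<rho> (e i)"
  by (simp add: plus_space_def)

lemma plus_space_iff:
  assumes "{i, j, k, l} = UNIV"
  shows "x \<in> plus_space \<rho> \<longleftrightarrow> \<phi> i x \<in> \<rho> (e i) \<and> \<phi> j x \<in> \<rho> (e j) \<and> \<phi> k x \<in> \<rho> (e k) \<and> \<phi> l x \<in> \<rho> (e l) \<and>
    \<phi> i x + \<phi> j x + \<phi> k x + \<phi> l x = 0"
proof -
  have "m \<in> {i, j, k, l}" for m using assms by simp
  then have "(\<forall>m. \<phi> m x \<in> \<rho> (e m)) \<longleftrightarrow>
      \<phi> i x \<in> \<rho> (e i) \<and> \<phi> j x \<in> \<rho> (e j) \<and> \<phi> k x \<in> \<rho> (e k) \<and> \<phi> l x \<in> \<rho> (e l)"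
    by (metis empty_iff insert_iff)
  then show ?thesis by (simp add: plus_space_def sum_labels[OF assms])
qed

text \<open>For \<open>x\<close> with $x_j=0$ the relation $x_i=-x_k-x_l$ holds. If moreover $x=y+z$ with $y_k=0$, then
$x_k=z_k$ lies in the image of a smaller case with the roles of the indices permuted, and \<open>atomic_swap\<close>
puts the result into the required form. For surjectivity, the components of a preimage are prescribed.\<close>

lemma \<phi>_atomic:
  assumes "{i, j, k, l} = UNIV"
  shows "\<phi> i ` \<rho>' (e j \<sqinter> atomic k l n) = \<rho> (e i \<sqinter> atomic k l (Suc n))"
  using assms
proof (induction n arbitrary: i j k l)
  case 0
  have l: "{k, l, i, j} = UNIV" by (rule labels_perm(4)[OF 0])
  have a: "atomic k l (Suc 0) = e k \<squnion> e l" unfolding atomic_Suc[OF l] by simp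
  show ?case
  proof (intro subset_antisym subsetI)
    fix v assume "v \<in> \<phi> i ` \<rho>' (e j \<sqinter> atomic k l 0)"
    then obtain x where x: "v = \<phi> i x" "x \<in> plus_space \<rho>" "\<phi> j x = 0" by (auto simp: gen')
    then have *: "\<phi> i x \<in> \<rho> (e i)" "\<phi> k x \<in> \<rho> (e k)" "\<phi> l x \<in> \<rho> (e l)" "\<phi> i x + \<phi> k x + \<phi> l x = 0"
      using plus_space_iff[OF 0, of x] by auto
    have "\<phi> i x = - \<phi> k x + - \<phi> l x" using *(4) by (simp add: algebra_simps eq_neg_iff_add_eq_0)
    then have "\<phi> i x \<in> \<rho> (e k \<squnion> e l)"
      unfolding rep_sup[OF q] using rep_neg[OF q *(2)] rep_neg[OF q *(3)] by blast
    then show "v \<in> \<rho> (e i \<sqinter> atomic k l (Suc 0))"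
      unfolding a rep_inf[OF q] x(1) using *(1) by blast
  next
    fix v assume "v \<in> \<rho> (e i \<sqinter> atomic k l (Suc 0))"
    then obtain y z where v: "v \<in> \<rho> (e i)" "v = y + z" "y \<in> \<rho> (e k)" "z \<in> \<rho> (e l)"
      unfolding a rep_inf[OF q] by (auto simp: rep_sup[OF q])
    obtain x where x: "\<phi> i x = v" "\<phi> j x = 0" "\<phi> k x = - y" "\<phi> l x = - z"
      by (rule \<phi>_obtain[OF 0])
    have "x \<in> \<rho>' (e j)"
      unfolding gen' using v x by (simp add: plus_space_iff[OF 0] rep_neg[OF q] rep_0[OF q])
    then show "v \<in> \<phi> i ` \<rho>' (e j \<sqinter> atomic k l 0)" using x(1) by auto
  qed
next
  case (Suc n)
  have l: "{k, l, i, j} = UNIV" "{l, k, i, j} = UNIV" "{i, k, l, j} = UNIV"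
    using Suc.prems by (simp_all add: insert_commute)
  have a: "atomic k l (Suc n) = e k \<squnion> (e l \<sqinter> atomic i j n)" by (rule atomic_Suc[OF l(1)])
  have b: "e i \<sqinter> atomic k l (Suc (Suc n)) = e i \<sqinter> (e l \<squnion> (e k \<sqinter> atomic i j (Suc n)))"
    unfolding atomic_swap[OF l(3)] atomic_Suc[OF l(2)] ..
  have IH: "\<phi> k ` \<rho>' (e l \<sqinter> atomic i j n) = \<rho> (e k \<sqinter> atomic i j (Suc n))"
    by (rule Suc.IH[OF l(1)])
  show ?case
  proof (intro subset_antisym subsetI)
    fix v assume "v \<in> \<phi> i ` \<rho>' (e j \<sqinter> atomic k l (Suc n))"
    then obtain x y z where x: "v = \<phi> i x" "x \<in> \<rho>' (e j)" "x = y + z" and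
        y: "y \<in> \<rho>' (e k)" and z: "z \<in> \<rho>' (e l \<sqinter> atomic i j n)"
      unfolding a by (auto simp: rep_inf[OF q'] rep_sup[OF q'])
    have xV: "\<phi> j x = 0" "\<phi> i x \<in> \<rho> (e i)" "\<phi> l x \<in> \<rho> (e l)" "\<phi> i x + \<phi> k x + \<phi> l x = 0"
      using x(2) unfolding gen' by (auto simp: plus_space_iff[OF Suc.prems])
    have "\<phi> k y = 0" using y unfolding gen' by simp
    then have "\<phi> k x = \<phi> k z" using x(3) by (simp add: \<phi>_add)
    then have "\<phi> k x \<in> \<rho> (e k \<sqinter> atomic i j (Suc n))" using z IH by blast
    from rep_neg[OF q this] have k: "- \<phi> k x \<in> \<rho> (e k \<sqinter> atomic i j (Suc n))" .
    have "\<phi> i x = - \<phi> l x + - \<phi> k x"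
      using xV(4) by (simp add: algebra_simps eq_neg_iff_add_eq_0)
    then have "\<phi> i x \<in> \<rho> (e l \<squnion> (e k \<sqinter> atomic i j (Suc n)))"
      unfolding rep_sup[OF q] using k rep_neg[OF q xV(3)] by blast
    then show "v \<in> \<rho> (e i \<sqinter> atomic k l (Suc (Suc n)))"
      unfolding b x(1) rep_inf[OF q, of "e i"] using xV(2) by blast
  next
    fix v assume "v \<in> \<rho> (e i \<sqinter> atomic k l (Suc (Suc n)))"
    then obtain u w where v: "v \<in> \<rho> (e i)" "v = u + w" "u \<in> \<rho> (e l)"
        "w \<in> \<rho> (e k \<sqinter> atomic i j (Suc n))"
      unfolding b rep_inf[OF q, of "e i"] by (auto simp: rep_sup[OF q])
    then obtain z where z: "w = \<phi> k z" "z \<in> \<rho>' (e l \<sqinter> atomic i j n)" using IH by blast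
    obtain x where x: "\<phi> i x = v" "\<phi> j x = 0" "\<phi> k x = - w" "\<phi> l x = - u"
      by (rule \<phi>_obtain[OF Suc.prems])
    have "w \<in> \<rho> (e k)" using v(4) by (simp add: rep_inf[OF q])
    then have xV: "x \<in> plus_space \<rho>"
      using v x by (simp add: plus_space_iff[OF Suc.prems] rep_neg[OF q] rep_0[OF q])
    have z': "- z \<in> \<rho>' (e l \<sqinter> atomic i j n)" using z(2) by (rule rep_neg[OF q'])
    have "x - (- z) \<in> plus_space \<rho>"
      using rep_diff[OF q', of x \<top> "- z"] xV in_plus_space[OF z'] top' by simp
    moreover have "\<phi> k (x - (- z)) = 0" using x(3) z(1) by (simp add: \<phi>_add)
    ultimately have k: "x - (- z) \<in> \<rho>' (e k)" unfolding gen' by blast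
    have "x = (x - (- z)) + (- z)" by simp
    then have "x \<in> \<rho>' (atomic k l (Suc n))"
      unfolding a rep_sup[OF q'] using k z' by blast
    moreover have "x \<in> \<rho>' (e j)" unfolding gen' using xV x(2) by simp
    ultimately show "v \<in> \<phi> i ` \<rho>' (e j \<sqinter> atomic k l (Suc n))"
      using x(1) by (auto simp: rep_inf[OF q'])
  qed
qed

text \<open>An atomic element that starts with $e_i$ contains the kernel of $\varphi_i$ and so is a full preimage.\<close>

lemma \<phi>_atomic_kernel:
  assumes "{i, l, j, k} = UNIV" "x \<in> plus_space \<rho>"
  shows "x \<in> \<rho>' (atomic i l n) \<longleftrightarrow> \<phi> i x \<in> \<rho> (e i \<sqinter> atomic j k n)"
proof (cases n)
  case 0
  then show ?thesis using assms(2) by (simp add: top' \<phi>_in)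
next
  case (Suc m)
  have a: "atomic i l n = e i \<squnion> (e l \<sqinter> atomic j k m)" unfolding Suc by (rule atomic_Suc[OF assms(1)])
  have im: "\<phi> i ` \<rho>' (e l \<sqinter> atomic j k m) = \<rho> (e i \<sqinter> atomic j k n)"
    unfolding Suc by (rule \<phi>_atomic[OF assms(1)])
  show ?thesis
  proof
    assume "x \<in> \<rho>' (atomic i l n)"
    then obtain y z where "x = y + z" "y \<in> \<rho>' (e i)" "z \<in> \<rho>' (e l \<sqinter> atomic j k m)"
      unfolding a by (auto simp: rep_sup[OF q'])
    moreover from this have "\<phi> i x = \<phi> i z" by (simp add: gen' \<phi>_add)
    ultimately show "\<phi> i x \<in> \<rho> (e i \<sqinter> atomic j k n)" using im by blast
  next
    assume "\<phi> i x \<in> \<rho> (e i \<sqinter> atomic j k n)"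
    then obtain z where z: "\<phi> i x = \<phi> i z" "z \<in> \<rho>' (e l \<sqinter> atomic j k m)" using im by blast
    have "x - z \<in> plus_space \<rho>" using rep_diff[OF q', of x \<top> z] assms(2) in_plus_space[OF z(2)] top' by simp
    then have "x - z \<in> \<rho>' (e i)" unfolding gen' using z(1) by (simp add: \<phi>_diff)
    then show "x \<in> \<rho>' (atomic i l n)"
      unfolding a rep_sup[OF q'] using z(2) by (intro exI[of _ "x - z"] exI[of _ z]) simp
  qed
qed

text \<open>One atomic factor of \<open>e_elem k c\<close> is treated by \<open>\<phi>_atomic\<close>; the other two are full preimages under
$\varphi_i$, so the image of the meet is the meet of the images.\<close>

lemma \<phi>_e_elem:
  assumes "i \<noteq> k"
  shows "\<phi> i ` \<rho>' (e_elem k c) = \<rho> (e_elem i (c(i \<oplus> k := Suc (c (i \<oplus> k)))))"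
proof -
  obtain j l where ikjl: "{i, k, j, l} = UNIV" using assms by (rule four_labels)
  then have p: "{k, i, j, l} = UNIV" "{i, l, j, k} = UNIV" "{i, j, l, k} = UNIV"
    "{k, j, i, l} = UNIV" "{i, k, l, j} = UNIV" "{i, j, k, l} = UNIV" "{i, l, k, j} = UNIV"
    by (simp_all add: insert_commute)
  have kj: "k \<oplus> j = i \<oplus> l" "k \<oplus> l = i \<oplus> j" "k \<oplus> i = i \<oplus> k"
    using kadd_complement[OF p(2)] kadd_complement[OF p(3)] by (simp_all add: kadd_comm)
  have ne: "i \<oplus> j \<noteq> i \<oplus> k" "i \<oplus> l \<noteq> i \<oplus> k" using ikjl by (auto simp: UNIV_idx_iff)
  have Ek: "x \<in> \<rho>' (e_elem k c) \<longleftrightarrow> x \<in> \<rho>' (e k \<sqinter> atomic j l (c (i \<oplus> k))) \<and>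
      \<phi> i x \<in> \<rho> (e i \<sqinter> atomic j k (c (i \<oplus> l))) \<and> \<phi> i x \<in> \<rho> (e i \<sqinter> atomic l k (c (i \<oplus> j)))" for x
  proof -
    have "x \<in> \<rho>' (e_elem k c) \<longleftrightarrow> x \<in> \<rho>' (e k \<sqinter> atomic j l (c (i \<oplus> k))) \<and>
      x \<in> \<rho>' (atomic i l (c (i \<oplus> l))) \<and> x \<in> \<rho>' (atomic i j (c (i \<oplus> j)))"
      unfolding e_elem_three[OF p(1)] kj by (auto simp: rep_inf[OF q'])
    moreover have "x \<in> plus_space \<rho>" if "x \<in> \<rho>' (e k \<sqinter> atomic j l (c (i \<oplus> k)))" using that by (rule in_plus_space)
    ultimately show ?thesis
      using \<phi>_atomic_kernel[OF p(2)] \<phi>_atomic_kernel[OF p(3)] by blast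
  qed
  have Ei: "e_elem i (c(i \<oplus> k := Suc (c (i \<oplus> k)))) = (e i \<sqinter> atomic j l (Suc (c (i \<oplus> k)))) \<sqinter>
      (e i \<sqinter> atomic j k (c (i \<oplus> l))) \<sqinter> (e i \<sqinter> atomic l k (c (i \<oplus> j)))"
    unfolding e_elem_three[OF ikjl] using ne atomic_swap[OF p(6)] atomic_swap[OF p(7)]
    by (simp add: ac_simps)
  have im: "\<phi> i ` \<rho>' (e k \<sqinter> atomic j l (c (i \<oplus> k))) = \<rho> (e i \<sqinter> atomic j l (Suc (c (i \<oplus> k))))"
    by (rule \<phi>_atomic[OF ikjl])
  show ?thesis
    unfolding Ei rep_inf[OF q, of "_ \<sqinter> (_ \<sqinter> _)"] rep_inf[OF q, of "e i \<sqinter> atomic j l _"]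
      im[symmetric] using Ek by blast
qed

lemma \<phi>_e_elem_in: "i \<noteq> k \<Longrightarrow> x \<in> \<rho>' (e_elem k c) \<Longrightarrow> \<phi> i x \<in> \<rho> (e_elem i (c(i \<oplus> k := Suc (c (i \<oplus> k)))))"
  using \<phi>_e_elem by blast

text \<open>The image of a sum decomposition in \<open>f_form\<close> under $\varphi_i$ is again one, with an exponent that may
exceed the required one. In the case of zero exponents, an element of $e_k(e_i+e_j+e_l)$ loses its
component in $e_i$.\<close>

lemma \<phi>_f_elem:
  assumes "i \<noteq> k"
  shows "\<phi> i ` \<rho>' (f_elem k c) \<subseteq> \<rho> (f_elem i (c(i \<oplus> k := Suc (c (i \<oplus> k)))))"
proof (rule image_subsetI)
  fix x assume x: "x \<in> \<rho>' (f_elem k c)"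
  let ?t = "i \<oplus> k"
  let ?c = "c(?t := Suc (c ?t))"
  have t: "?t \<noteq> G1" using assms by simp
  show "\<phi> i x \<in> \<rho> (f_elem i ?c)"
  proof (cases "\<exists>r. r \<noteq> G1 \<and> c r \<ge> 1")
    case True
    then obtain r where r: "r \<noteq> G1" "c r \<ge> 1" by blast
    then obtain p s where "{G1, r, p, s} = UNIV" using four_labels[of G1 r] by metis
    then have psr: "{G1, p, s, r} = UNIV" by (simp add: insert_commute)
    then have d: "p \<noteq> s" "p \<noteq> r" "s \<noteq> r" by (simp_all add: UNIV_idx_iff)
    have k: "f_elem k c = f_form k c p s r" using f_elem_eq[OF psr, of c k] r(2) by simp
    have i: "f_elem i ?c = f_form i ?c p s r" using f_elem_eq[OF psr, of ?c i] r(2) by simp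
    obtain y z where yz: "x \<in> \<rho>' (e_elem k c)" "x = y + z"
        "y \<in> \<rho>' (e_elem k ((\<lambda>_. 0)(p := Suc (c p))))"
        "z \<in> \<rho>' (e_elem k ((\<lambda>_. 0)(s := Suc (c s), r := c r - 1)))"
      using x unfolding k f_form_def rep_inf[OF q'] by (auto simp: rep_sup[OF q'])
    have "\<phi> i y \<in> \<rho> (e_elem i ((\<lambda>_. 0)(p := Suc (?c p))))"
      by (rule subsetD[OF rep_mono[OF q e_elem_antimono] \<phi>_e_elem_in[OF assms yz(3)]]) (auto simp: d)
    moreover have "\<phi> i z \<in> \<rho> (e_elem i ((\<lambda>_. 0)(s := Suc (?c s), r := ?c r - 1)))"
      by (rule subsetD[OF rep_mono[OF q e_elem_antimono] \<phi>_e_elem_in[OF assms yz(4)]]) (use d r in auto)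
    moreover have "\<phi> i x = \<phi> i y + \<phi> i z" by (simp add: yz(2) \<phi>_add)
    ultimately have "\<phi> i x \<in> \<rho> (e_elem i ((\<lambda>_. 0)(p := Suc (?c p))) \<squnion>
        e_elem i ((\<lambda>_. 0)(s := Suc (?c s), r := ?c r - 1)))"
      unfolding rep_sup[OF q] by blast
    then show ?thesis
      unfolding i f_form_def rep_inf[OF q] using \<phi>_e_elem_in[OF assms yz(1)] by blast
  next
    case False
    then have 0: "c r = 0" if "r \<noteq> G1" for r using that by auto
    obtain j l where ikjl: "{i, k, j, l} = UNIV" using assms by (rule four_labels)
    then have ijl: "i \<noteq> j" "i \<noteq> l" by (simp_all add: UNIV_idx_iff)
    have kijl: "{k, i, j, l} = UNIV" using ikjl by (simp add: insert_commute)
    have psr: "{G1, i \<oplus> j, i \<oplus> l, ?t} = UNIV"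
      using ikjl unfolding UNIV_idx_iff by (auto simp: eq_commute[of G1])
    have i: "f_elem i ?c = f_form i ?c (i \<oplus> j) (i \<oplus> l) ?t" using f_elem_eq[OF psr, of ?c i] by simp
    have k: "f_elem k c = e k \<sqinter> (e i \<squnion> (e j \<squnion> e l))"
      using 0 by (simp add: f_elem_def compl_single[OF kijl])
    obtain a b d where x: "x \<in> \<rho>' (e k)" "x = a + (b + d)" "a \<in> \<rho>' (e i)" "b \<in> \<rho>' (e j)" "d \<in> \<rho>' (e l)"
      using x unfolding k rep_inf[OF q'] by (auto simp: rep_sup[OF q'])
    have "\<phi> i a = 0" using x(3) by (simp add: gen')
    then have "\<phi> i x = \<phi> i b + \<phi> i d" using x(2) by (simp add: \<phi>_add)
    moreover have "\<phi> i b \<in> \<rho> (e_elem i ((\<lambda>_. 0)(i \<oplus> j := Suc 0)))"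
      using \<phi>_e_elem_in[OF ijl(1), of b "\<lambda>_. 0"] x(4) by simp
    moreover have "\<phi> i d \<in> \<rho> (e_elem i ((\<lambda>_. 0)(i \<oplus> l := Suc 0, ?t := 0)))"
    proof -
      have "(\<lambda>_. 0)(i \<oplus> l := Suc 0, ?t := 0) = (\<lambda>_. 0)(i \<oplus> l := Suc 0)"
        using ikjl by (auto simp: UNIV_idx_iff fun_eq_iff)
      then show ?thesis using \<phi>_e_elem_in[OF ijl(2), of d "\<lambda>_. 0"] x(5) by simp
    qed
    moreover have "\<phi> i x \<in> \<rho> (e_elem i ?c)"
    proof -
      have "e_elem i ?c = e_elem i ((\<lambda>_. 0)(?t := Suc 0))" using t 0 by (intro e_elem_cong) auto
      then show ?thesis using \<phi>_e_elem_in[OF assms, of x "\<lambda>_. 0"] x(1) by simp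
    qed
    ultimately have *: "\<phi> i x \<in> \<rho> (e_elem i ((\<lambda>_. 0)(i \<oplus> j := Suc 0)) \<squnion>
        e_elem i ((\<lambda>_. 0)(i \<oplus> l := Suc 0, ?t := 0)))" "\<phi> i x \<in> \<rho> (e_elem i ?c)"
      unfolding rep_sup[OF q] by blast+
    have "?c (i \<oplus> j) = 0" "?c (i \<oplus> l) = 0" "?c ?t - 1 = 0"
      using 0 ikjl t by (auto simp: UNIV_idx_iff)
    then show ?thesis
      unfolding i f_form_def rep_inf[OF q] using * by (simp only: IntI)
  qed
qed

end

lemma cnt_Cons:
  "\<alpha> \<noteq> [] \<Longrightarrow> cnt (i # \<alpha>) = (cnt \<alpha>)(i \<oplus> hd \<alpha> := Suc (cnt \<alpha> (i \<oplus> hd \<alpha>)))"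
  by (cases \<alpha>) simp_all

lemma admissible_Cons: "\<alpha> \<noteq> [] \<Longrightarrow> admissible (i # \<alpha>) \<longleftrightarrow> admissible \<alpha> \<and> i \<noteq> hd \<alpha>"
  by (cases \<alpha>) (auto simp: admissible_def)

lemma f_elem_le_e: "f_elem k c \<le> e k"
  by (auto simp: f_elem_def f_form_def intro: le_infI1 e_elem_le_e)

context coxeter_pair
begin

text \<open>The subspace $\sum_i\varphi_i(X)$.\<close>

definition push :: "'u set \<Rightarrow> 'u set" where
  "push X = {v. \<exists>x. (\<forall>i. x i \<in> X) \<and> v = (\<Sum>i\<in>UNIV. \<phi> i (x i))}"

lemma pushI: "(\<And>i. x i \<in> X) \<Longrightarrow> v = (\<Sum>i\<in>UNIV. \<phi> i (x i)) \<Longrightarrow> v \<in> push X"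
  unfolding push_def by (intro CollectI exI[of _ x]) simp

lemma pushE:
  assumes "v \<in> push X"
  obtains x where "\<And>i. x i \<in> X" "v = (\<Sum>i\<in>UNIV. \<phi> i (x i))"
  using assms unfolding push_def by blast

lemma push_mono:
  assumes "X \<subseteq> Y"
  shows "push X \<subseteq> push Y"
proof
  fix v assume "v \<in> push X"
  then obtain x where "\<And>i. x i \<in> X" "v = (\<Sum>i\<in>UNIV. \<phi> i (x i))" by (rule pushE) blast
  then show "v \<in> push Y" using assms by (intro pushI[of x]) auto
qed

lemma subspace_push:
  assumes "subspace X"
  shows "subspace (push X)"
  unfolding subspace_def
proof (intro conjI ballI allI)
  show "0 \<in> push X"
    using subspace_0[OF assms] by (intro pushI[of "\<lambda>_. 0"]) simp_all
next
  fix v w assume "v \<in> push X" "w \<in> push X"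
  then obtain x y where xy: "\<And>i. x i \<in> X" "\<And>i. y i \<in> X"
      "v = (\<Sum>i\<in>UNIV. \<phi> i (x i))" "w = (\<Sum>i\<in>UNIV. \<phi> i (y i))"
    unfolding push_def by blast
  have "v + w = (\<Sum>i\<in>UNIV. \<phi> i (x i + y i))" by (simp add: xy(3,4) \<phi>_add sum.distrib)
  moreover have "x i + y i \<in> X" for i using xy subspace_add[OF assms] by simp
  ultimately show "v + w \<in> push X" by (intro pushI[of "\<lambda>i. x i + y i"])
next
  fix a v assume "v \<in> push X"
  then obtain x where x: "\<And>i. x i \<in> X" "v = (\<Sum>i\<in>UNIV. \<phi> i (x i))"
    unfolding push_def by blast
  have "scale a v = (\<Sum>i\<in>UNIV. \<phi> i (scale a (x i)))" by (simp add: x(2) \<phi>_scale scale_sum_right)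
  moreover have "scale a (x i) \<in> X" for i using x subspace_scale[OF assms] by simp
  ultimately show "scale a v \<in> push X" by (intro pushI[of "\<lambda>i. scale a (x i)"])
qed

lemma \<phi>_in_push:
  assumes "x \<in> X" "0 \<in> X"
  shows "\<phi> i x \<in> push X"
proof -
  have "(\<Sum>j\<in>UNIV. \<phi> j (if j = i then x else 0)) = (\<Sum>j\<in>UNIV. if j = i then \<phi> i x else 0)"
    by (rule sum.cong) simp_all
  then have "\<phi> i x = (\<Sum>j\<in>UNIV. \<phi> j (if j = i then x else 0))" by simp
  then show ?thesis using assms by (intro pushI[of "\<lambda>j. if j = i then x else 0"]) simp_all
qed

lemma push_subset:
  assumes "subspace W" "\<And>i x. x \<in> X \<Longrightarrow> \<phi> i x \<in> W"
  shows "push X \<subseteq> W"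
  using assms by (auto elim!: pushE intro!: subspace_sum)

lemma push_sup: "push (\<rho>' (a \<squnion> b)) = {v + w | v w. v \<in> push (\<rho>' a) \<and> w \<in> push (\<rho>' b)}" (is "_ = ?r")
proof (rule subset_antisym)
  have s: "subspace ?r" by (intro subspace_sums subspace_push rep_subspace[OF q'])
  show "push (\<rho>' (a \<squnion> b)) \<subseteq> ?r"
  proof (rule push_subset[OF s])
    fix i x assume "x \<in> \<rho>' (a \<squnion> b)"
    then obtain y z where "x = y + z" "y \<in> \<rho>' a" "z \<in> \<rho>' b" by (auto simp: rep_sup[OF q'])
    moreover from this have "\<phi> i y \<in> push (\<rho>' a)" "\<phi> i z \<in> push (\<rho>' b)"
      by (auto intro: \<phi>_in_push rep_0[OF q'])
    ultimately show "\<phi> i x \<in> ?r" using \<phi>_add by blast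
  qed
  have "push (\<rho>' a) \<subseteq> push (\<rho>' (a \<squnion> b))" "push (\<rho>' b) \<subseteq> push (\<rho>' (a \<squnion> b))"
    by (intro push_mono rep_mono[OF q']; simp)+
  then show "?r \<subseteq> push (\<rho>' (a \<squnion> b))"
    using subspace_add[OF subspace_push[OF rep_subspace[OF q']]] by blast
qed

lemma \<phi>_kills: "x \<in> \<rho>' b \<Longrightarrow> b \<le> e i \<Longrightarrow> \<phi> i x = 0"
  using rep_mono[OF q', of b "e i"] gen' by blast

lemma \<phi>_adm:
  assumes v: "\<And>\<alpha>. admissible \<alpha> \<Longrightarrow> v \<alpha> = X (hd \<alpha>) (cnt \<alpha>)"
    and sub: "\<And>i k c. i \<noteq> k \<Longrightarrow> \<phi> i ` \<rho>' (X k c) \<subseteq> \<rho> (X i (c(i \<oplus> k := Suc (c (i \<oplus> k)))))"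
    and a: "\<alpha> \<noteq> []" "admissible (i # \<alpha>)"
  shows "\<phi> i ` \<rho>' (v \<alpha>) \<subseteq> \<rho> (v (i # \<alpha>))"
proof -
  have "admissible \<alpha>" "i \<noteq> hd \<alpha>" using a by (simp_all add: admissible_Cons)
  with sub[of i "hd \<alpha>" "cnt \<alpha>"] v[of \<alpha>] v[OF a(2)] show ?thesis by (simp add: cnt_Cons[OF a(1)])
qed

text \<open>Sequences are now lengthened at their end, while the start stays fixed. A sequence that already ends
at \<open>i\<close> contributes nothing, because $\varphi_i$ kills $\rho^+(e_i)$.\<close>

lemma push_cum_subset:
  assumes v: "\<And>\<alpha>. admissible \<alpha> \<Longrightarrow> v \<alpha> = X (hd \<alpha>) (cnt \<alpha>)"
    and sub: "\<And>i k c. i \<noteq> k \<Longrightarrow> \<phi> i ` \<rho>' (X k c) \<subseteq> \<rho> (X i (c(i \<oplus> k := Suc (c (i \<oplus> k)))))"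
    and le: "\<And>k c. X k c \<le> e k" and n: "n \<ge> 1"
  shows "push (\<rho>' (cum v s n)) \<subseteq> \<rho> (cum v s (Suc n))"
proof (rule push_subset[OF rep_subspace[OF q]])
  fix i x assume x: "x \<in> \<rho>' (cum v s n)"
  have "\<rho>' (cum v s n) \<subseteq> {x. \<phi> i x \<in> \<rho> (cum v s (Suc n))}"
    unfolding cum_def[of v s n]
  proof (rule rep_Sup_fin[OF q' _ _ subspace_vimage_\<phi>[OF rep_subspace[OF q]]])
    show "v ` {\<alpha> \<in> adm_set n. last \<alpha> = s} \<noteq> {}" using adm_exists_last[OF n, of s] by auto
    fix a assume "a \<in> v ` {\<alpha> \<in> adm_set n. last \<alpha> = s}"
    then obtain \<alpha> where \<alpha>: "a = v \<alpha>" "admissible \<alpha>" "length \<alpha> = n" "last \<alpha> = s"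
      by (auto simp: adm_set_def)
    then have ne: "\<alpha> \<noteq> []" by (simp add: admissible_def)
    show "\<rho>' a \<subseteq> {x. \<phi> i x \<in> \<rho> (cum v s (Suc n))}"
    proof (cases "i = hd \<alpha>")
      case True
      have "\<phi> i x = 0" if "x \<in> \<rho>' a" for x
        by (rule \<phi>_kills[OF that]) (simp add: \<alpha> v le True)
      then show ?thesis using rep_0[OF q] by auto
    next
      case False
      then have ad: "admissible (i # \<alpha>)" using \<alpha>(2) ne by (simp add: admissible_Cons)
      have "i # \<alpha> \<in> adm_set (Suc n)" using ad \<alpha>(3) by (simp add: adm_set_def)
      from cum_upper[OF this, of v] have "v (i # \<alpha>) \<le> cum v s (Suc n)" using \<alpha>(4) ne by simp
      then have "\<phi> i ` \<rho>' a \<subseteq> \<rho> (cum v s (Suc n))"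
        using \<phi>_adm[of v X, OF v sub ne ad] rep_mono[OF q] \<alpha>(1) by blast
      then show ?thesis by blast
    qed
  qed simp
  then show "\<phi> i x \<in> \<rho> (cum v s (Suc n))" using x by blast
qed

lemma push_e_cum:
  assumes "n \<ge> 1"
  shows "\<rho> (e_cum s (Suc n)) = push (\<rho>' (e_cum s n))"
proof (rule subset_antisym)
  show "push (\<rho>' (e_cum s n)) \<subseteq> \<rho> (e_cum s (Suc n))"
    unfolding e_cum_eq using assms
    by (intro push_cum_subset[of _ e_elem]) (simp_all add: e_adm_eq \<phi>_e_elem e_elem_le_e)
  show "\<rho> (e_cum s (Suc n)) \<subseteq> push (\<rho>' (e_cum s n))"
    unfolding e_cum_eq cum_def[of e_adm s "Suc n"]
  proof (rule rep_Sup_fin[OF q])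
    show "e_adm ` {\<alpha> \<in> adm_set (Suc n). last \<alpha> = s} \<noteq> {}"
      using adm_exists_last[of "Suc n" s] by auto
    show "subspace (push (\<rho>' (cum e_adm s n)))" by (rule subspace_push[OF rep_subspace[OF q']])
    fix a assume "a \<in> e_adm ` {\<alpha> \<in> adm_set (Suc n). last \<alpha> = s}"
    then obtain \<beta> where \<beta>: "a = e_adm \<beta>" "admissible \<beta>" "length \<beta> = Suc n" "last \<beta> = s"
      by (auto simp: adm_set_def)
    then obtain i \<alpha> where i: "\<beta> = i # \<alpha>" by (cases \<beta>) auto
    have ne: "\<alpha> \<noteq> []" using \<beta>(3) i assms by auto
    then have \<alpha>: "admissible \<alpha>" "i \<noteq> hd \<alpha>" using \<beta>(2) by (simp_all add: i admissible_Cons)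
    have "\<alpha> \<in> adm_set n" "last \<alpha> = s" using \<beta> \<alpha>(1) ne by (simp_all add: i adm_set_def)
    then have le: "e_adm \<alpha> \<le> cum e_adm s n" using cum_upper[of \<alpha> n e_adm] by simp
    have "\<rho> a = \<phi> i ` \<rho>' (e_adm \<alpha>)"
      using \<phi>_e_elem[OF \<alpha>(2), of "cnt \<alpha>"] \<beta>(2) \<alpha>(1) by (simp add: \<beta>(1) i e_adm_eq cnt_Cons[OF ne])
    also have "\<dots> \<subseteq> push (\<rho>' (cum e_adm s n))"
      using rep_mono[OF q' le] \<phi>_in_push rep_0[OF q'] by blast
    finally show "\<rho> a \<subseteq> push (\<rho>' (cum e_adm s n))" .
  qed simp
qed

lemma rho_sup: "\<rho> (a \<squnion> b) = {v + w | v w. v \<in> \<rho> a \<and> w \<in> \<rho> b}"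
  using rep_sup[OF q] by blast

lemma push_h:
  assumes "n \<ge> 1"
  shows "\<rho> (h s (Suc n)) = push (\<rho>' (h s n))"
  by (cases s) (simp_all only: h_eqs push_sup rho_sup push_e_cum[OF assms])

lemma push_t_poly:
  assumes "n \<ge> 1"
  shows "push (\<rho>' (t_poly n)) \<subseteq> \<rho> (t_poly (Suc n))"
proof -
  have c: "push (\<rho>' (cum f_adm s n)) \<subseteq> \<rho> (cum f_adm s (Suc n))" for s
    using assms \<phi>_f_elem by (intro push_cum_subset[of _ f_elem]) (simp_all add: f_adm_eq f_elem_le_e)
  have t: "t_poly n = total f_adm n" "t_poly (Suc n) = total f_adm (Suc n)"
    using assms by (simp_all add: t_poly_eq)
  have s: "{v + w | v w. v \<in> A \<and> w \<in> B} \<subseteq> {v + w | v w. v \<in> A' \<and> w \<in> B'}"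
    if "A \<subseteq> A'" "B \<subseteq> B'" for A B A' B' :: "'u set"
    using that by blast
  show ?thesis unfolding t total_def push_sup rho_sup by (intro s c)
qed

lemma rho_f_single: "\<rho> (f_adm [i]) = \<phi> i ` plus_space \<rho>"
proof -
  obtain j k l where l: "{i, j, k, l} = UNIV"
    by (metis four_labels idx.distinct(1))
  have f: "f_adm [i] = e i \<sqinter> (e j \<squnion> (e k \<squnion> e l))"
    unfolding f_adm_single compl_single[OF l] by simp
  show ?thesis
  proof (intro subset_antisym subsetI)
    fix v assume "v \<in> \<rho> (f_adm [i])"
    then obtain a b c where v: "v \<in> \<rho> (e i)" "v = a + (b + c)" "a \<in> \<rho> (e j)" "b \<in> \<rho> (e k)" "c \<in> \<rho> (e l)"
      unfolding f rep_inf[OF q] by (auto simp: rep_sup[OF q])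
    obtain x where x: "\<phi> i x = v" "\<phi> j x = - a" "\<phi> k x = - b" "\<phi> l x = - c"
      by (rule \<phi>_obtain[OF l])
    then have "x \<in> plus_space \<rho>" using v by (simp add: plus_space_iff[OF l] rep_neg[OF q])
    then show "v \<in> \<phi> i ` plus_space \<rho>" using x(1) by blast
  next
    fix v assume "v \<in> \<phi> i ` plus_space \<rho>"
    then obtain x where x: "v = \<phi> i x" "x \<in> plus_space \<rho>" by blast
    have *: "\<phi> m x \<in> \<rho> (e m)" for m by (rule \<phi>_in[OF x(2)])
    have "\<phi> i x + \<phi> j x + \<phi> k x + \<phi> l x = 0" using x(2) plus_space_iff[OF l] by blast
    then have "\<phi> i x = - \<phi> j x + (- \<phi> k x + - \<phi> l x)"
      by (simp add: algebra_simps eq_neg_iff_add_eq_0)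
    then have "\<phi> i x \<in> \<rho> (e j \<squnion> (e k \<squnion> e l))"
      unfolding rep_sup[OF q] using rep_neg[OF q *] by blast
    then show "v \<in> \<rho> (f_adm [i])" unfolding f rep_inf[OF q] x(1) using * by blast
  qed
qed

text \<open>$\varphi_i(V^+)$ is $e_i(e_j+e_k+e_l)$, and these elements add up to $t_1$.\<close>

lemma push_top: "push (\<rho>' \<top>) = \<rho> (t_poly 1)"
proof -
  have t: "t_poly 1 = total f_adm 1" using total_f_one by simp
  have c: "cum f_adm i 1 = f_adm [i]" for i by (rule cum_1)
  show ?thesis
  proof (rule subset_antisym)
    show "push (\<rho>' \<top>) \<subseteq> \<rho> (t_poly 1)"
    proof (rule push_subset[OF rep_subspace[OF q]])
      fix i x assume "x \<in> \<rho>' \<top>"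
      then have "\<phi> i x \<in> \<rho> (cum f_adm i 1)" unfolding c rho_f_single top' by blast
      then show "\<phi> i x \<in> \<rho> (t_poly 1)"
        unfolding t using rep_mono[OF q total_upper[of f_adm i 1]] by blast
    qed
    have "\<rho> (cum f_adm i 1) \<subseteq> push (\<rho>' \<top>)" for i
      unfolding c rho_f_single top' using \<phi>_in_push[of _ "plus_space \<rho>"] rep_0[OF q', of \<top>] top' by blast
    then show "\<rho> (t_poly 1) \<subseteq> push (\<rho>' \<top>)"
      unfolding t total_def rho_sup using subspace_add[OF subspace_push[OF rep_subspace[OF q']]] by blast
  qed
qed

lemma retraction_diff:
  assumes "retraction \<rho>' a p" "x \<in> plus_space \<rho>" "y \<in> plus_space \<rho>"
  shows "p (x - y) = p x - p y"
proof -
  have "x - y \<in> \<rho>' \<top>" using assms rep_diff[OF q', of _ \<top>] top' by simp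
  then have "p ((x - y) + y) = p (x - y) + p y"
    using assms unfolding retraction_def top' by blast
  then show ?thesis by simp
qed

text \<open>A retraction of $\rho^+$ respects the relation $\sum\varphi_i(x_i)=\sum\varphi_i(y_i)$. Indeed the
differences $z_i=x_i-y_i$ satisfy $\sum\varphi_i(z_i)=0$, so a vector \<open>d\<close> with components
$\varphi_i(z_i)$ lies in $V^+$ and $z_i-d$ lies in the kernel $\rho^+(e_i)$ of $\varphi_i$. Both
properties are inherited by the images under \<open>p\<close>.\<close>

lemma push_retraction_cong:
  assumes p: "retraction \<rho>' a p" and x: "\<And>i. x i \<in> plus_space \<rho>" and y: "\<And>i. y i \<in> plus_space \<rho>"
    and eq: "(\<Sum>i\<in>UNIV. \<phi> i (x i)) = (\<Sum>i\<in>UNIV. \<phi> i (y i))"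
  shows "(\<Sum>i\<in>UNIV. \<phi> i (p (x i))) = (\<Sum>i\<in>UNIV. \<phi> i (p (y i)))"
proof -
  have z: "x i - y i \<in> plus_space \<rho>" for i using rep_diff[OF q', of _ \<top>] x y top' by simp
  obtain d where d: "\<And>i. \<phi> i d = \<phi> i (x i - y i)" using \<phi>_surj[of "\<lambda>i. \<phi> i (x i - y i)"] by blast
  have "(\<Sum>i\<in>UNIV. \<phi> i d) = 0" unfolding d using eq by (simp add: \<phi>_diff sum_subtractf)
  then have dV: "d \<in> plus_space \<rho>" unfolding plus_space_def using d \<phi>_in[OF z] by simp
  have "\<phi> i (p (x i)) - \<phi> i (p (y i)) = \<phi> i (p d)" for i
  proof -
    have "(x i - y i) - d \<in> plus_space \<rho>" using rep_diff[OF q', of _ \<top>] z dV top' by simp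
    then have "(x i - y i) - d \<in> \<rho>' (e i)" unfolding gen' using d by (simp add: \<phi>_diff)
    then have "p ((x i - y i) - d) \<in> \<rho>' (e i)" by (rule retraction_preserves[OF q' p])
    then have "\<phi> i (p ((x i - y i) - d)) = 0" unfolding gen' by simp
    then show ?thesis
      using retraction_diff[OF p z dV] retraction_diff[OF p x y] by (simp add: \<phi>_diff)
  qed
  then have "(\<Sum>i\<in>UNIV. \<phi> i (p (x i))) - (\<Sum>i\<in>UNIV. \<phi> i (p (y i))) = (\<Sum>i\<in>UNIV. \<phi> i (p d))"
    by (simp flip: sum_subtractf)
  also have "p d \<in> plus_space \<rho>" using retraction_preserves[OF q' p, of d \<top>] dV top' by simp
  then have "(\<Sum>i\<in>UNIV. \<phi> i (p d)) = 0" by (simp add: plus_space_def)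
  finally show ?thesis by simp
qed

text \<open>Given two presentations $\sum\varphi_i(x_i)=\sum\varphi_i(y_i)$ of a vector with $x_i$ in $\rho^+(a)$ and
$y_i$ in $\rho^+(b)$, the retraction onto $\rho^+(a)$ fixes the first and moves the second into
$\rho^+(ab)$.\<close>

lemma push_inf:
  assumes p: "retraction \<rho>' a p"
  shows "push (\<rho>' a) \<inter> push (\<rho>' b) \<subseteq> push (\<rho>' (a \<sqinter> b))"
proof
  fix v assume "v \<in> push (\<rho>' a) \<inter> push (\<rho>' b)"
  then obtain x y where x: "\<And>i. x i \<in> \<rho>' a" "v = (\<Sum>i\<in>UNIV. \<phi> i (x i))"
    and y: "\<And>i. y i \<in> \<rho>' b" "v = (\<Sum>i\<in>UNIV. \<phi> i (y i))"
    unfolding push_def by blast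
  have px: "p (x i) = x i" for i using p x(1) by (simp add: retraction_def)
  have "v = (\<Sum>i\<in>UNIV. \<phi> i (p (y i)))"
    using push_retraction_cong[OF p in_plus_space[OF x(1)] in_plus_space[OF y(1)]] x(2) y(2) by (simp add: px)
  moreover have "p (y i) \<in> \<rho>' (a \<sqinter> b)" for i
    using retraction_preserves[OF q' p y(1)[of i]] p rep_top[OF q' y(1)[of i]]
    by (simp add: rep_inf[OF q'] retraction_def)
  ultimately show "v \<in> push (\<rho>' (a \<sqinter> b))" by (intro pushI[of "\<lambda>i. p (y i)"])
qed

text \<open>By \<open>push_retraction_cong\<close> a retraction \<open>p\<close> of $\rho^+$ induces the map
$\sum\varphi_i(x_i)\mapsto\sum\varphi_i(p\,x_i)$ on $\rho(t_1)$. It is composed with a retraction of the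
whole representation onto $\rho(t_1)$.\<close>

lemma retraction_lift:
  assumes p: "retraction \<rho>' a p" and r: "retraction \<rho> (t_poly 1) r" and b: "\<rho> b = push (\<rho>' a)"
  shows "\<exists>p. retraction \<rho> b p"
proof -
  \<comment> \<open>some presentation of a vector of $\rho(t_1)$; the result does not depend on the choice\<close>
  define pre where "pre v = (SOME x. (\<forall>i. x i \<in> plus_space \<rho>) \<and> v = (\<Sum>i\<in>UNIV. \<phi> i (x i)))" for v
  define p' where "p' v = (\<Sum>i\<in>UNIV. \<phi> i (p (pre v i)))" for v
  have p': "p' v = (\<Sum>i\<in>UNIV. \<phi> i (p (x i)))" if "\<And>i. x i \<in> plus_space \<rho>" "v = (\<Sum>i\<in>UNIV. \<phi> i (x i))" for v x
  proof -
    have "\<exists>x. (\<forall>i. x i \<in> plus_space \<rho>) \<and> v = (\<Sum>i\<in>UNIV. \<phi> i (x i))" using that by blast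
    from someI_ex[OF this] have "\<And>i. pre v i \<in> plus_space \<rho>" "v = (\<Sum>i\<in>UNIV. \<phi> i (pre v i))"
      unfolding pre_def[symmetric] by auto
    then show ?thesis unfolding p'_def using push_retraction_cong[OF p _ that(1)] that(2) by simp
  qed
  have t: "\<rho> (t_poly 1) = push (plus_space \<rho>)" using push_top top' by simp
  have pV: "p x \<in> plus_space \<rho>" if "x \<in> plus_space \<rho>" for x
    using retraction_preserves[OF q' p, of x \<top>] that top' by simp
  have p'_single: "p' (\<phi> i x) = \<phi> i (p x)" if "x \<in> plus_space \<rho>" for i x
  proof -
    have 0: "0 \<in> plus_space \<rho>" using rep_0[OF q', of \<top>] top' by simp
    have "p 0 = 0" using retraction_diff[OF p 0 0] by simp
    define y where "y j = (if j = i then x else 0)" for j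
    have "\<phi> j (y j) = (if j = i then \<phi> i x else 0)" "\<phi> j (p (y j)) = (if j = i then \<phi> i (p x) else 0)" for j
      using \<open>p 0 = 0\<close> by (simp_all add: y_def)
    then have s: "(\<Sum>j\<in>UNIV. \<phi> j (y j)) = \<phi> i x" "(\<Sum>j\<in>UNIV. \<phi> j (p (y j))) = \<phi> i (p x)" by simp_all
    have "y j \<in> plus_space \<rho>" for j using that 0 by (simp add: y_def)
    from p'[OF this s(1)[symmetric]] show ?thesis unfolding s(2) .
  qed
  have r_in: "r v \<in> push (plus_space \<rho>)" if "v \<in> \<rho> \<top>" for v using r that t unfolding retraction_def by blast
  have "retraction \<rho> b (p' \<circ> r)"
    unfolding retraction_def comp_def
  proof (intro conjI ballI allI)
    fix v w assume vw: "v \<in> \<rho> \<top>" "w \<in> \<rho> \<top>"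
    obtain x where x: "\<And>i. x i \<in> plus_space \<rho>" "r v = (\<Sum>i\<in>UNIV. \<phi> i (x i))"
      using r_in[OF vw(1)] unfolding push_def by blast
    obtain y where y: "\<And>i. y i \<in> plus_space \<rho>" "r w = (\<Sum>i\<in>UNIV. \<phi> i (y i))"
      using r_in[OF vw(2)] unfolding push_def by blast
    have "r (v + w) = r v + r w" using r vw unfolding retraction_def by blast
    also have "\<dots> = (\<Sum>i\<in>UNIV. \<phi> i (x i + y i))" by (simp add: x y \<phi>_add sum.distrib)
    finally have "p' (r (v + w)) = (\<Sum>i\<in>UNIV. \<phi> i (p (x i + y i)))"
      using x y rep_add[OF q', of _ \<top>] top' by (intro p') simp_all
    also have "\<dots> = (\<Sum>i\<in>UNIV. \<phi> i (p (x i) + p (y i)))"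
      using p x(1) y(1) unfolding retraction_def top' by simp
    also have "\<dots> = p' (r v) + p' (r w)"
      unfolding p'[OF x] p'[OF y] by (simp add: \<phi>_add sum.distrib)
    finally show "p' (r (v + w)) = p' (r v) + p' (r w)" .
  next
    fix i v assume v: "v \<in> \<rho> (e i)"
    have "r v \<in> \<rho> (e i)" by (rule retraction_preserves[OF q r v])
    moreover have "r v \<in> \<rho> (t_poly 1)" using r rep_top[OF q v] unfolding retraction_def by blast
    moreover have "e i \<sqinter> t_poly 1 \<le> f_adm [i]"
    proof -
      have "e i \<sqinter> t_poly 1 \<le> e i \<sqinter> h i 1"
        unfolding h_min_one[symmetric] by (intro inf_mono order_refl h_bounds)
      moreover have "h i 1 = Sup_fin (e ` (- {i}))"
        unfolding h_def e_cum_eq cum_1 by (simp add: e_adm_eq)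
      ultimately show ?thesis by (simp add: f_adm_single)
    qed
    ultimately have "r v \<in> \<rho> (f_adm [i])" using rep_mono[OF q] rep_inf[OF q] by blast
    then obtain x where "r v = \<phi> i x" "x \<in> plus_space \<rho>" unfolding rho_f_single by blast
    then show "p' (r v) \<in> \<rho> (e i)" using p'_single pV \<phi>_in by simp
  next
    fix v assume v: "v \<in> \<rho> \<top>"
    obtain x where x: "\<And>i. x i \<in> plus_space \<rho>" "r v = (\<Sum>i\<in>UNIV. \<phi> i (x i))"
      using r_in[OF v] unfolding push_def by blast
    have "p (x i) \<in> \<rho>' a" for i using p x(1) unfolding retraction_def top' by blast
    then show "p' (r v) \<in> \<rho> b" unfolding b p'[OF x] by (rule pushI) (rule refl)
  next
    fix v assume v: "v \<in> \<rho> b"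
    then obtain x where x: "\<And>i. x i \<in> \<rho>' a" "v = (\<Sum>i\<in>UNIV. \<phi> i (x i))"
      unfolding b push_def by blast
    have "v \<in> push (plus_space \<rho>)" using in_plus_space[OF x(1)] x(2) by (rule pushI)
    then have "r v = v" using r t unfolding retraction_def by blast
    moreover have "p (x i) = x i" for i using p x(1) unfolding retraction_def by blast
    ultimately show "p' (r v) = v" using p'[OF in_plus_space[OF x(1)] x(2)] x(2) by simp
  qed
  then show ?thesis by blast
qed

end

context quarter
begin

text \<open>The two claims are proved together: the retractions for \<open>n\<close> are what makes \<open>push\<close> commute
with the intersection of the $h_s(n)$.\<close>

lemma h_min_le_t_poly:
  assumes "n \<ge> 1" "rep \<rho>"
  shows "(\<forall>s. \<exists>p. retraction \<rho> (h s n) p) \<and> \<rho> (h_min n) \<subseteq> \<rho> (t_poly n)"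
  using assms
proof (induction n arbitrary: \<rho> rule: nat_induct_at_least)
  case base
  then show ?case using retraction_h_one by (simp only: h_min_one order_refl simp_thms)
next
  case (Suc n)
  obtain \<rho>' where "coxeter \<rho> \<rho>'" using coxeter_exists[OF Suc.prems] by blast
  then interpret coxeter_pair scale \<phi> \<rho> \<rho>' by unfold_locales
  obtain r where r: "\<And>s. retraction \<rho> (h s 1) (r s)" using retraction_h_one[OF Suc.prems] by metis
  have t1: "retraction \<rho> (t_poly 1) (r G1 \<circ> r G2 \<circ> r G3 \<circ> r G4)"
    unfolding h_min_one[symmetric] h_min_def by (intro retraction_comp Suc.prems r)
  obtain p where p: "\<And>s. retraction \<rho>' (h s n) (p s)" using Suc.IH[OF q'] by metis
  have "\<exists>p. retraction \<rho> (h s (Suc n)) p" for s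
    by (rule retraction_lift[OF p t1 push_h[OF Suc.hyps]])
  moreover have "\<rho> (h_min (Suc n)) \<subseteq> \<rho> (t_poly (Suc n))"
  proof -
    let ?x = "\<lambda>s. h s n"
    have "\<rho> (h_min (Suc n)) =
        push (\<rho>' (?x G4)) \<inter> (push (\<rho>' (?x G3)) \<inter> (push (\<rho>' (?x G2)) \<inter> push (\<rho>' (?x G1))))"
      unfolding h_min_def rep_inf[OF q] push_h[OF Suc.hyps] by blast
    also have "\<dots> \<subseteq> push (\<rho>' (?x G4 \<sqinter> (?x G3 \<sqinter> (?x G2 \<sqinter> ?x G1))))"
      using push_inf[OF p] by blast
    also have "?x G4 \<sqinter> (?x G3 \<sqinter> (?x G2 \<sqinter> ?x G1)) = h_min n" unfolding h_min_def by (simp only: ac_simps)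
    also have "push (\<rho>' (h_min n)) \<subseteq> push (\<rho>' (t_poly n))" using Suc.IH[OF q'] by (intro push_mono) blast
    also have "\<dots> \<subseteq> \<rho> (t_poly (Suc n))" by (rule push_t_poly[OF Suc.hyps])
    finally show ?thesis .
  qed
  ultimately show ?case by blast
qed

end

fun digit :: "idx \<Rightarrow> nat" where
  "digit G1 = 0" | "digit G2 = 1" | "digit G3 = 2" | "digit G4 = 3"

text \<open>Sequences of vectors split into four subsequences by residues modulo 4.\<close>

lemma quarter_sequences:
  assumes "vector_space (scale :: 'k::field \<Rightarrow> 'v::ab_group_add \<Rightarrow> 'v)"
  shows "quarter (\<lambda>a (f :: nat \<Rightarrow> 'v) m. scale a (f m)) (\<lambda>i f m. f (4 * m + digit i))"
proof -
  interpret vector_space scale by fact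
  show ?thesis
  proof unfold_locales
    fix g :: "idx \<Rightarrow> nat \<Rightarrow> 'v"
    define x where "x m = g (if m mod 4 = 0 then G1 else if m mod 4 = 1 then G2
      else if m mod 4 = 2 then G3 else G4) (m div 4)" for m
    have dm: "(4 * m + digit i) mod 4 = digit i" "(4 * m + digit i) div 4 = m" for m i
      by (cases i; simp; presburger)+
    have "x (4 * m + digit i) = g i m" for m i
      unfolding x_def dm by (cases i) simp_all
    then have "(\<lambda>m. x (4 * m + digit i)) = g i" for i by (rule ext)
    then show "\<exists>x. \<forall>i. (\<lambda>m. x (4 * m + digit i)) = g i" by blast
  qed (simp_all add: fun_eq_iff scale_right_distrib scale_left_distrib)
qed

text \<open>The given representation is copied into the space of sequences as constant sequences.\<close>

theorem h_min_eq_t_poly_in_reps: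
  fixes scale :: "'k::field \<Rightarrow> 'v::ab_group_add \<Rightarrow> 'v"
  assumes "vector_space scale" "vector_space.d4_rep scale V \<rho>" "n \<ge> 1"
  shows "\<rho> (h_min n) = \<rho> (t_poly n)"
proof -
  interpret vector_space scale by fact
  interpret U: quarter "\<lambda>a (f :: nat \<Rightarrow> 'v) m. scale a (f m)" "\<lambda>i f m. f (4 * m + digit i)"
    by (rule quarter_sequences) fact
  have q: "rep \<rho>" using assms(2) by (simp add: d4_rep_def rep_def)
  define \<sigma> where "\<sigma> a = {f :: nat \<Rightarrow> 'v. \<exists>v \<in> \<rho> a. f = (\<lambda>_. v)}" for a
  have mem: "(\<lambda>_. v) \<in> \<sigma> a \<longleftrightarrow> v \<in> \<rho> a" for v a by (auto simp: \<sigma>_def fun_eq_iff)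
  have "U.rep \<sigma>"
    unfolding U.rep_def
  proof (intro conjI allI)
    fix a b
    show "U.subspace (\<sigma> a)"
      unfolding U.subspace_def
    proof (intro conjI ballI allI)
      show "0 \<in> \<sigma> a" using mem[of 0 a] rep_0[OF q] by (simp add: zero_fun_def)
      show "f + g \<in> \<sigma> a" if "f \<in> \<sigma> a" "g \<in> \<sigma> a" for f g
        using that rep_add[OF q] by (auto simp: \<sigma>_def plus_fun_def)
      show "(\<lambda>m. scale c (f m)) \<in> \<sigma> a" if "f \<in> \<sigma> a" for c f
        using that subspace_scale[OF rep_subspace[OF q]] by (auto simp: \<sigma>_def)
    qed
    show "\<sigma> (a \<squnion> b) = U.subspace_sum (\<sigma> a) (\<sigma> b)"
    proof (intro subset_antisym subsetI)
      fix f assume "f \<in> \<sigma> (a \<squnion> b)"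
      then obtain y z where "f = (\<lambda>_. y + z)" "y \<in> \<rho> a" "z \<in> \<rho> b"
        unfolding \<sigma>_def by (auto simp: rep_sup[OF q])
      then have "f = (\<lambda>_. y) + (\<lambda>_. z)" "(\<lambda>_. y) \<in> \<sigma> a" "(\<lambda>_. z) \<in> \<sigma> b"
        by (simp_all add: plus_fun_def mem)
      then show "f \<in> U.subspace_sum (\<sigma> a) (\<sigma> b)" unfolding U.subspace_sum_def by blast
    next
      fix f assume "f \<in> U.subspace_sum (\<sigma> a) (\<sigma> b)"
      then obtain y z where yz: "y \<in> \<rho> a" "z \<in> \<rho> b" "f = (\<lambda>_. y) + (\<lambda>_. z)"
        unfolding U.subspace_sum_def \<sigma>_def by blast
      have "y + z \<in> \<rho> (a \<squnion> b)" using yz(1,2) unfolding rep_sup[OF q] by blast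
      then show "f \<in> \<sigma> (a \<squnion> b)" unfolding yz(3) plus_fun_def by (simp only: mem)
    qed
    show "\<sigma> (a \<sqinter> b) = \<sigma> a \<inter> \<sigma> b"
      unfolding \<sigma>_def rep_inf[OF q] by (auto simp: fun_eq_iff)
  next
    show "\<sigma> \<bottom> = {0}" using q by (auto simp: \<sigma>_def rep_def zero_fun_def)
  qed
  from U.h_min_le_t_poly[OF assms(3) this] have "\<sigma> (h_min n) \<subseteq> \<sigma> (t_poly n)" by blast
  then have "\<rho> (h_min n) \<subseteq> \<rho> (t_poly n)" using mem by blast
  moreover have "\<rho> (t_poly n) \<subseteq> \<rho> (h_min n)" by (rule rep_mono[OF q t_poly_le_h_min[OF assms(3)]])
  ultimately show ?thesis by (rule subset_antisym)
qed

theorem theorem3p3: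
  fixes scale :: "'k::field \<Rightarrow> 'v::ab_group_add \<Rightarrow> 'v" and n :: nat
  assumes "vector_space scale" and "n \<ge> 1"
  shows
    "(h_max n \<in> B_plus n \<and> (\<forall>x \<in> B_plus n. x \<le> h_max n) \<and>
      s_poly n = h_max n \<and>
      s_poly n = (R ^^ (n - 1)) (s_poly 1) \<and>
      s_poly n = Sup_fin {(gamma G1 G2 ^^ t) ((gamma G1 G3 ^^ s) ((gamma G1 G4 ^^ r)
        (e G1 \<squnion> e G2 \<squnion> e G3 \<squnion> e G4))) | r s t. r + s + t = n - 1} \<and>
      s_poly n = e_inv G1 n \<squnion> e_inv G2 n \<squnion> e_inv G3 n \<squnion> e_inv G4 n \<and>
      s_poly n = e_cum G1 n \<squnion> e_cum G2 n \<squnion> e_cum G3 n \<squnion> e_cum G4 n) \<and>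
     (h_min n \<in> B_plus n \<and> (\<forall>x \<in> B_plus n. h_min n \<le> x) \<and>
      vector_space.lin_equiv scale (t_poly n) (h_min n) \<and>
      t_poly n = (R ^^ (n - 1)) (t_poly 1) \<and>
      t_poly n = Sup_fin {(gamma G1 G2 ^^ t) ((gamma G1 G3 ^^ s) ((gamma G1 G4 ^^ r)
        ((e G1 \<sqinter> (e G2 \<squnion> e G3 \<squnion> e G4)) \<squnion> (e G2 \<sqinter> (e G1 \<squnion> e G3 \<squnion> e G4)) \<squnion>
         (e G3 \<sqinter> (e G1 \<squnion> e G2 \<squnion> e G4))))) | r s t. r + s + t = n - 1} \<and>
      t_poly n = f0_inv (n + 1) \<and>
      t_poly n = f0_cum (n + 1)) \<and>
     (\<forall>i j k l. {i, j, k, l} = (UNIV :: idx set) \<longrightarrow>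
      h j n \<sqinter> h k n \<sqinter> h l n \<in> B_plus n \<and>
      vector_space.lin_equiv scale (p_poly i n) (h j n \<sqinter> h k n \<sqinter> h l n) \<and>
      p_poly i n = e_cum i n \<squnion> f0_inv (n + 1) \<and>
      p_poly i n = e_cum i n \<squnion> f0_cum (n + 1))"
proof -
  interpret vector_space scale by fact
  have eq: "lin_equiv (x \<squnion> t_poly n) (x \<squnion> h_min n)" for x
    unfolding lin_equiv_def
  proof (intro allI impI)
    fix V \<rho> assume "indecomposable_rep V \<rho>"
    then have r: "d4_rep V \<rho>" unfolding indecomposable_rep_def by (rule conjunct1)
    then have "\<rho> (x \<squnion> y) = subspace_sum (\<rho> x) (\<rho> y)" for y by (simp add: d4_rep_def)
    then show "\<rho> (x \<squnion> t_poly n) = \<rho> (x \<squnion> h_min n)"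
      by (simp only: h_min_eq_t_poly_in_reps[OF assms(1) r assms(2)])
  qed
  have lt: "lin_equiv (t_poly n) (h_min n)"
    using eq[of \<bottom>] by simp
  have B: "h_max n \<in> B_plus n \<and> (\<forall>x \<in> B_plus n. x \<le> h_max n)"
    "h_min n \<in> B_plus n \<and> (\<forall>x \<in> B_plus n. h_min n \<le> x)"
    using h_max_in_B h_min_in_B B_bounds by blast+
  have s: "s_poly n = h_max n" "s_poly n = e_cum G1 n \<squnion> e_cum G2 n \<squnion> e_cum G3 n \<squnion> e_cum G4 n"
    using s_poly_eq[OF assms(2)] by (simp_all add: h_max_eq total_def e_cum_eq)
  have s': "s_poly n = e_inv G1 n \<squnion> e_inv G2 n \<squnion> e_inv G3 n \<squnion> e_inv G4 n"
    unfolding s_poly_diag_sum[OF assms(2)] diag_sum_e_total e_inv_eq ..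
  have R: "s_poly n = (R ^^ (n - 1)) (s_poly 1)" "t_poly n = (R ^^ (n - 1)) (t_poly 1)"
    by (rule R_power; use assms(2) s_poly_Suc t_poly_Suc in simp)+
  have gE: "(gamma G1 G2 ^^ t) ((gamma G1 G3 ^^ s) ((gamma G1 G4 ^^ r) (e_total (\<lambda>_. 0)))) = e_total (counts t s r)"
    and gF: "(gamma G1 G2 ^^ t) ((gamma G1 G3 ^^ s) ((gamma G1 G4 ^^ r) (f_total (\<lambda>_. 0)))) = f_total (counts t s r)"
    for t s r
    by (rule gamma_powers, erule gamma_e_total) (rule gamma_powers, erule gamma_f_total)
  have sd: "s_poly n = Sup_fin {(gamma G1 G2 ^^ t) ((gamma G1 G3 ^^ s) ((gamma G1 G4 ^^ r)
        (e G1 \<squnion> e G2 \<squnion> e G3 \<squnion> e G4))) | r s t. r + s + t = n - 1}"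
    unfolding s_poly_diag_sum[OF assms(2)] diag_sum_def e_total_zero[symmetric] gE ..
  have F: "(e G1 \<sqinter> (e G2 \<squnion> e G3 \<squnion> e G4)) \<squnion> (e G2 \<sqinter> (e G1 \<squnion> e G3 \<squnion> e G4)) \<squnion>
         (e G3 \<sqinter> (e G1 \<squnion> e G2 \<squnion> e G4)) = f_total (\<lambda>_. 0)"
    unfolding f_total_zero using meet4[of "e G1" "e G2" "e G3" "e G4"] by simp
  have td: "t_poly n = Sup_fin {(gamma G1 G2 ^^ t) ((gamma G1 G3 ^^ s) ((gamma G1 G4 ^^ r)
        ((e G1 \<sqinter> (e G2 \<squnion> e G3 \<squnion> e G4)) \<squnion> (e G2 \<sqinter> (e G1 \<squnion> e G3 \<squnion> e G4)) \<squnion>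
         (e G3 \<sqinter> (e G1 \<squnion> e G2 \<squnion> e G4))))) | r s t. r + s + t = n - 1}"
    unfolding t_poly_diag_sum[OF assms(2)] diag_sum_def F gF ..
  have t: "t_poly n = f0_cum (n + 1)" "t_poly n = f0_inv (n + 1)"
    using t_poly_eq[OF assms(2)] f0_cum_eq[OF assms(2)] f0_inv_eq[OF assms(2)] by simp_all
  have "h j n \<sqinter> h k n \<sqinter> h l n \<in> B_plus n \<and>
      lin_equiv (p_poly i n) (h j n \<sqinter> h k n \<sqinter> h l n) \<and>
      p_poly i n = e_cum i n \<squnion> f0_inv (n + 1) \<and>
      p_poly i n = e_cum i n \<squnion> f0_cum (n + 1)" if "{i, j, k, l} = UNIV" for i j k l
    unfolding t(1,2)[symmetric] p_poly_eq[OF assms(2)]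
    by (intro conjI h_triple_in_B refl) (simp only: h_triple[OF that] eq)
  then show ?thesis
    by (intro conjI B[THEN conjunct1] B[THEN conjunct2] s s' R sd td t lt allI impI) blast+
qed

end
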